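(* Let $X,Y$ be complex Banach spaces, $0<p\le1$, $\alpha>-1$ and $\gamma=(n+1+\alpha)\left(\frac1p-1\right)$. Let $b\in\mathcal{H}(\mathbb{B}_n,\mathcal{L}(\overline{X},Y))$ satisfy $$\int_{\mathbb{B}_n}\frac{\|b(w)\|_{\mathcal{L}(\overline{X},Y)}}{|1-\langle z,w\rangle|^{n+1+\alpha}}\mathrm{d}\nu_\alpha(w)<\infty\ \text{ for every } z\in\mathbb{B}_n,\qquad \int_{\mathbb{B}_n}\|b(z)\|_{\mathcal{L}(\overline{X},Y)}\log\left(\frac1{1-|z|^2}\right)\mathrm{d}\nu_\alpha(z)<\infty.$$ The little Hankel operator $h_b$ extends to a bounded operator from $A^p_\alpha(\mathbb{B}_n,X)$ into $A^q_\alpha(\mathbb{B}_n,Y)$ for some positive $q<1$ if and only if $b\in\Gamma_\gamma(\mathbb{B}_n,\mathcal{L}(\overline{X},Y))$.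
   Context: $n\ge1$; $\mathbb{B}_n$ is the open unit ball of $\mathbb{C}^n$, $\langle z,w\rangle=\sum_j z_j\overline{w_j}$. $\mathrm{d}\nu_\alpha(z)=c_\alpha(1-|z|^2)^\alpha\mathrm{d}\nu(z)$, $c_\alpha=\frac{\Gamma(n+\alpha+1)}{n!\Gamma(\alpha+1)}$, where $\nu$ is Lebesgue measure normalized so that $\nu_\alpha$ is a probability measure on $\mathbb{B}_n$. For a complex Banach space $X$: $\mathcal{H}(\mathbb{B}_n,X)$ is the space of $X$-valued holomorphic functions on $\mathbb{B}_n$; $H^\infty(\mathbb{B}_n,X)$ the bounded ones; $A^p_\alpha(\mathbb{B}_n,X)$ those with $\|f\|^p_{p,\alpha,X}=\int_{\mathbb{B}_n}\|f(z)\|_X^p\mathrm{d}\nu_\alpha(z)<\infty$. $H^\infty(\mathbb{B}_n,X)$ is dense in $A^p_\alpha(\mathbb{B}_n,X)$. $X^{\star}$ is the dual of $X$ with scalar multiplication $(\lambda x^{\star})(x)=\overline\lambda x^{\star}(x)$. The complex conjugate of $x\in X$ is the functional $\overline{x}(x^{\star})=\overline{x^{\star}(x)}$ on $X^{\star}$, and $\overline{X}=\{\overline{x}:x\in X\}$ with norm $\|\overline{x}\|=\sup_{\|x^{\star}\|=1}|\overline{x}(x^{\star})|=\|x\|_X$; $\overline{X}$ is a Banach space and $x\mapsto\overline{x}$ is an isometric conjugate-linear bijection. $\mathcal{L}(\overline{X},Y)$ is the Banach space of bounded linear operators $\overline X\to Y$. The little Hankel operator is $h_bf(z)=\int_{\mathbb{B}_n}\frac{b(w)\overline{f(w)}}{(1-\langle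 z,w\rangle)^{n+1+\alpha}}\mathrm{d}\nu_\alpha(w)$ for $f\in H^\infty(\mathbb{B}_n,X)$, $z\in\mathbb{B}_n$ (a conjugate-linear map). It extends to a bounded operator from $A^p_\alpha(\mathbb{B}_n,X)$ into $A^q_\alpha(\mathbb{B}_n,Y)$ if $\|h_bf\|_{q,\alpha,Y}\le C\|f\|_{p,\alpha,X}$ for all $f\in H^\infty(\mathbb{B}_n,X)$, with $C$ independent of $f$. Radial derivative: $Nf(z)=\sum_j z_j\frac{\partial f}{\partial z_j}(z)$; $N^k$ is its $k$-fold iterate. For $\gamma\ge0$, $\Gamma_\gamma(\mathbb{B}_n,X)$ is the space of $f\in\mathcal{H}(\mathbb{B}_n,X)$ for which there is an integer $k>\gamma$ with $\|f(0)\|_X+\sup_{z\in\mathbb{B}_n}(1-|z|^2)^{k-\gamma}\|N^kf(z)\|_X<\infty$ (independent of $k$). *)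

theory Defs
  imports "HOL-Analysis.Analysis"
begin

section \<open>Complex Banach spaces\<close>

class complex_normed_vector = real_normed_vector +
  fixes scaleC :: "complex \<Rightarrow> 'a \<Rightarrow> 'a"  (infixr "*\<^sub>C" 75)
  assumes scaleR_scaleC: "r *\<^sub>R x = complex_of_real r *\<^sub>C x"
    and scaleC_add_right: "c *\<^sub>C (x + y) = c *\<^sub>C x + c *\<^sub>C y"
    and scaleC_add_left: "(c + d) *\<^sub>C x = c *\<^sub>C x + d *\<^sub>C x"
    and scaleC_scaleC: "c *\<^sub>C d *\<^sub>C x = (c * d) *\<^sub>C x"
    and scaleC_one: "1 *\<^sub>C x = x"
    and norm_scaleC: "norm (c *\<^sub>C x) = cmod c * norm x"

class cbanach = complex_normed_vector + banach

instantiation complex :: cbanach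
begin

definition scaleC_complex :: "complex \<Rightarrow> complex \<Rightarrow> complex"
  where "scaleC_complex c z = c * z"

instance
  by standard (simp_all add: scaleC_complex_def scaleR_conv_of_real algebra_simps norm_mult)

end

lemma bounded_linear_scaleC: "bounded_linear (\<lambda>x::'a::complex_normed_vector. c *\<^sub>C x)"
proof (rule bounded_linear_intro[where K = "cmod c"])
  fix r and x :: 'a
  show "c *\<^sub>C r *\<^sub>R x = r *\<^sub>R c *\<^sub>C x"
    by (simp add: scaleR_scaleC scaleC_scaleC mult.commute)
qed (simp_all add: scaleC_add_right norm_scaleC mult.commute)

lemmas scaleC_zero_right = linear_0[OF bounded_linear.linear[OF bounded_linear_scaleC]]
lemmas scaleC_minus_right = linear_neg[OF bounded_linear.linear[OF bounded_linear_scaleC]]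
lemmas scaleC_diff_right = linear_diff[OF bounded_linear.linear[OF bounded_linear_scaleC]]

section \<open>Bounded complex-linear operators\<close>

typedef (overloaded) ('a, 'b) clinop  ("(_ \<Rightarrow>\<^sub>C\<^sub>L /_)" [22, 21] 21) =
  "{f :: 'a::complex_normed_vector \<Rightarrow>\<^sub>L 'b::complex_normed_vector.
      \<forall>c x. blinfun_apply f (c *\<^sub>C x) = c *\<^sub>C blinfun_apply f x}"
  morphisms blinfun_of_clinop Abs_clinop
  by (rule exI[of _ 0]) (simp add: scaleC_zero_right)

setup_lifting type_definition_clinop

lift_definition clinop_apply :: "('a::complex_normed_vector \<Rightarrow>\<^sub>C\<^sub>L 'b::complex_normed_vector) \<Rightarrow> 'a \<Rightarrow> 'b"
  is "\<lambda>f. blinfun_apply f" .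

lemma clinop_apply_scaleC: "clinop_apply f (c *\<^sub>C x) = c *\<^sub>C clinop_apply f x"
  by transfer simp

lemma bounded_linear_clinop_apply: "bounded_linear (clinop_apply f)"
  by transfer (rule blinfun.bounded_linear_right)

lemma clinop_eqI: "(\<And>x. clinop_apply f x = clinop_apply g x) \<Longrightarrow> f = g"
  by transfer (rule blinfun_eqI)

definition clinop_of :: "('a::complex_normed_vector \<Rightarrow> 'b::complex_normed_vector) \<Rightarrow> 'a \<Rightarrow>\<^sub>C\<^sub>L 'b"
  where "clinop_of f = Abs_clinop (Blinfun f)"

lemma clinop_apply_clinop_of:
  assumes "bounded_linear f" "\<And>c x. f (c *\<^sub>C x) = c *\<^sub>C f x"
  shows "clinop_apply (clinop_of f) = f"
  using assms
  by (simp add: clinop_of_def clinop_apply.rep_eq Abs_clinop_inverse bounded_linear_Blinfun_apply)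

instantiation clinop :: (complex_normed_vector, complex_normed_vector) complex_normed_vector
begin

lift_definition norm_clinop :: "'a \<Rightarrow>\<^sub>C\<^sub>L 'b \<Rightarrow> real" is norm .

lift_definition zero_clinop :: "'a \<Rightarrow>\<^sub>C\<^sub>L 'b" is 0
  by (simp add: scaleC_zero_right)

lift_definition plus_clinop :: "'a \<Rightarrow>\<^sub>C\<^sub>L 'b \<Rightarrow> 'a \<Rightarrow>\<^sub>C\<^sub>L 'b \<Rightarrow> 'a \<Rightarrow>\<^sub>C\<^sub>L 'b" is "(+)"
  by (simp add: blinfun.add_left scaleC_add_right)

lift_definition minus_clinop :: "'a \<Rightarrow>\<^sub>C\<^sub>L 'b \<Rightarrow> 'a \<Rightarrow>\<^sub>C\<^sub>L 'b \<Rightarrow> 'a \<Rightarrow>\<^sub>C\<^sub>L 'b" is "(-)"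
  by (simp add: blinfun.diff_left scaleC_diff_right)

lift_definition uminus_clinop :: "'a \<Rightarrow>\<^sub>C\<^sub>L 'b \<Rightarrow> 'a \<Rightarrow>\<^sub>C\<^sub>L 'b" is uminus
  by (simp add: blinfun.minus_left scaleC_minus_right)

lift_definition scaleR_clinop :: "real \<Rightarrow> 'a \<Rightarrow>\<^sub>C\<^sub>L 'b \<Rightarrow> 'a \<Rightarrow>\<^sub>C\<^sub>L 'b" is scaleR
  by (simp add: blinfun.scaleR_left scaleR_scaleC scaleC_scaleC mult.commute)

lift_definition scaleC_clinop :: "complex \<Rightarrow> 'a \<Rightarrow>\<^sub>C\<^sub>L 'b \<Rightarrow> 'a \<Rightarrow>\<^sub>C\<^sub>L 'b"
  is "\<lambda>c f. blinfun_compose (Blinfun (\<lambda>y. c *\<^sub>C y)) f"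
  by (simp add: bounded_linear_Blinfun_apply bounded_linear_scaleC scaleC_scaleC mult.commute)

definition dist_clinop :: "'a \<Rightarrow>\<^sub>C\<^sub>L 'b \<Rightarrow> 'a \<Rightarrow>\<^sub>C\<^sub>L 'b \<Rightarrow> real"
  where "dist_clinop f g = norm (f - g)"

definition sgn_clinop :: "'a \<Rightarrow>\<^sub>C\<^sub>L 'b \<Rightarrow> 'a \<Rightarrow>\<^sub>C\<^sub>L 'b"
  where "sgn_clinop f = inverse (norm f) *\<^sub>R f"

definition uniformity_clinop :: "(('a \<Rightarrow>\<^sub>C\<^sub>L 'b) \<times> ('a \<Rightarrow>\<^sub>C\<^sub>L 'b)) filter"
  where "uniformity_clinop = (INF e\<in>{0 <..}. principal {(f, g). dist f g < e})"

definition open_clinop :: "('a \<Rightarrow>\<^sub>C\<^sub>L 'b) set \<Rightarrow> bool"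
  where "open_clinop S = (\<forall>f\<in>S. \<forall>\<^sub>F (f', g) in uniformity. f' = f \<longrightarrow> g \<in> S)"

instance
proof
  fix f :: "'a \<Rightarrow>\<^sub>C\<^sub>L 'b" and c :: complex
  show "norm (c *\<^sub>C f) = cmod c * norm f"
  proof (transfer fixing: c)
    fix f :: "'a \<Rightarrow>\<^sub>L 'b"
    have *: "norm (blinfun_compose (Blinfun (\<lambda>y. c *\<^sub>C y)) g) \<le> cmod c * norm g" for c and g :: "'a \<Rightarrow>\<^sub>L 'b"
      by (rule norm_blinfun_bound)
        (simp_all add: bounded_linear_Blinfun_apply bounded_linear_scaleC norm_scaleC
          mult.assoc mult_left_mono norm_blinfun)
    let ?g = "blinfun_compose (Blinfun (\<lambda>y. c *\<^sub>C y)) f"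
    show "norm ?g = cmod c * norm f"
    proof (cases "c = 0")
      case True
      then show ?thesis
        using *[of 0 f] by simp
    next
      case False
      have "blinfun_compose (Blinfun (\<lambda>y. inverse c *\<^sub>C y)) ?g = f"
        by (rule blinfun_eqI)
          (simp add: bounded_linear_Blinfun_apply bounded_linear_scaleC scaleC_scaleC scaleC_one False)
      then have "norm f \<le> inverse (cmod c) * norm ?g"
        using *[of "inverse c" ?g] by (simp add: norm_inverse)
      then have "cmod c * norm f \<le> norm ?g"
        using False by (simp add: field_simps)
      then show ?thesis
        using *[of c f] by simp
    qed
  qed
next
  fix f :: "'a \<Rightarrow>\<^sub>C\<^sub>L 'b" and r :: real
  show "r *\<^sub>R f = complex_of_real r *\<^sub>C f"
    by transfer
      (simp add: blinfun_eqI blinfun.scaleR_left bounded_linear_Blinfun_apply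
        bounded_linear_scaleC scaleR_scaleC)
next
  fix f g :: "'a \<Rightarrow>\<^sub>C\<^sub>L 'b" and c :: complex
  show "c *\<^sub>C (f + g) = c *\<^sub>C f + c *\<^sub>C g"
    by transfer
      (simp add: blinfun_eqI blinfun.add_left bounded_linear_Blinfun_apply
        bounded_linear_scaleC scaleC_add_right)
next
  fix f :: "'a \<Rightarrow>\<^sub>C\<^sub>L 'b" and c d :: complex
  show "(c + d) *\<^sub>C f = c *\<^sub>C f + d *\<^sub>C f"
    by transfer
      (simp add: blinfun_eqI blinfun.add_left bounded_linear_Blinfun_apply
        bounded_linear_scaleC scaleC_add_left)
  show "c *\<^sub>C d *\<^sub>C f = (c * d) *\<^sub>C f"
    by transfer
      (simp add: blinfun_eqI bounded_linear_Blinfun_apply bounded_linear_scaleC scaleC_scaleC)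
  show "1 *\<^sub>C f = f"
    by transfer
      (simp add: blinfun_eqI bounded_linear_Blinfun_apply bounded_linear_scaleC scaleC_one)
qed (unfold dist_clinop_def sgn_clinop_def uniformity_clinop_def open_clinop_def,
    (rule refl | (transfer, simp add: algebra_simps norm_triangle_ineq))+)

end

lemma clinop_apply_scaleC_left: "clinop_apply (c *\<^sub>C f) x = c *\<^sub>C clinop_apply f x"
  by transfer (simp add: bounded_linear_Blinfun_apply bounded_linear_scaleC)

lemma clinop_apply_add_left: "clinop_apply (f + g) x = clinop_apply f x + clinop_apply g x"
  by transfer (simp add: blinfun.add_left)

lemma clinop_apply_scaleR_left: "clinop_apply (r *\<^sub>R f) x = r *\<^sub>R clinop_apply f x"
  by transfer (simp add: blinfun.scaleR_left)

lemma norm_clinop_onorm: "norm f = onorm (clinop_apply f)"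
  by transfer (rule norm_blinfun.rep_eq)

lemma norm_clinop_apply: "norm (clinop_apply f x) \<le> norm f * norm x"
  by transfer (rule norm_blinfun)

instance clinop :: (complex_normed_vector, cbanach) cbanach
proof
  fix F :: "nat \<Rightarrow> 'a \<Rightarrow>\<^sub>C\<^sub>L 'b"
  assume "Cauchy F"
  have dist: "dist (blinfun_of_clinop f) (blinfun_of_clinop g) = dist f g" for f g :: "'a \<Rightarrow>\<^sub>C\<^sub>L 'b"
    by (simp add: dist_norm norm_clinop.rep_eq minus_clinop.rep_eq)
  have "Cauchy (\<lambda>i. blinfun_of_clinop (F i))"
    using \<open>Cauchy F\<close> by (simp add: Cauchy_def dist)
  then obtain L where L: "(\<lambda>i. blinfun_of_clinop (F i)) \<longlonglongrightarrow> L"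
    by (meson Cauchy_convergent convergent_def)
  have ptw: "(\<lambda>i. blinfun_apply (blinfun_of_clinop (F i)) x) \<longlonglongrightarrow> blinfun_apply L x" for x
    by (intro blinfun.tendsto L tendsto_const)
  have "blinfun_apply L (c *\<^sub>C x) = c *\<^sub>C blinfun_apply L x" for c x
  proof (rule LIMSEQ_unique)
    show "(\<lambda>i. blinfun_apply (blinfun_of_clinop (F i)) (c *\<^sub>C x)) \<longlonglongrightarrow> blinfun_apply L (c *\<^sub>C x)"
      by (rule ptw)
    have "(\<lambda>i. c *\<^sub>C blinfun_apply (blinfun_of_clinop (F i)) x) \<longlonglongrightarrow> c *\<^sub>C blinfun_apply L x"
      by (rule bounded_linear.tendsto[OF bounded_linear_scaleC ptw])
    then show "(\<lambda>i. blinfun_apply (blinfun_of_clinop (F i)) (c *\<^sub>C x)) \<longlonglongrightarrow> c *\<^sub>C blinfun_apply L x"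
      by (simp add: blinfun_of_clinop[simplified])
  qed
  then have "blinfun_of_clinop (Abs_clinop L) = L"
    by (simp add: Abs_clinop_inverse)
  then have "(\<lambda>i. dist (F i) (Abs_clinop L)) \<longlonglongrightarrow> 0"
    using L[THEN tendsto_dist_iff[THEN iffD1]] by (simp add: dist[symmetric])
  then have "F \<longlonglongrightarrow> Abs_clinop L"
    by (rule tendsto_dist_iff[THEN iffD2])
  then show "convergent F"
    by (auto simp: convergent_def)
qed

section \<open>The dual with conjugated scalars, and the complex conjugate space\<close>

text \<open>
  The elements of \<open>'a cdual\<close> are the bounded complex-linear functionals on \<open>'a\<close>; the type is
  separate from \<open>'a \<Rightarrow>\<^sub>C\<^sub>L complex\<close> because its scalar multiplication is
  \<open>(c *\<^sub>C \<phi>) x = cnj c * \<phi> x\<close>.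
\<close>

typedef (overloaded) 'a cdual = "UNIV :: ('a::complex_normed_vector \<Rightarrow>\<^sub>C\<^sub>L complex) set"
  morphisms functional_of cdual_of ..

setup_lifting type_definition_cdual

lift_definition cdual_apply :: "'a::complex_normed_vector cdual \<Rightarrow> 'a \<Rightarrow> complex" is clinop_apply .

instantiation cdual :: (complex_normed_vector) complex_normed_vector
begin

lift_definition norm_cdual :: "'a cdual \<Rightarrow> real" is norm .
lift_definition zero_cdual :: "'a cdual" is 0 .
lift_definition plus_cdual :: "'a cdual \<Rightarrow> 'a cdual \<Rightarrow> 'a cdual" is "(+)" .
lift_definition minus_cdual :: "'a cdual \<Rightarrow> 'a cdual \<Rightarrow> 'a cdual" is "(-)" .
lift_definition uminus_cdual :: "'a cdual \<Rightarrow> 'a cdual" is uminus .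
lift_definition scaleR_cdual :: "real \<Rightarrow> 'a cdual \<Rightarrow> 'a cdual" is scaleR .
lift_definition scaleC_cdual :: "complex \<Rightarrow> 'a cdual \<Rightarrow> 'a cdual" is "\<lambda>c \<phi>. cnj c *\<^sub>C \<phi>" .

definition dist_cdual :: "'a cdual \<Rightarrow> 'a cdual \<Rightarrow> real"
  where "dist_cdual f g = norm (f - g)"

definition sgn_cdual :: "'a cdual \<Rightarrow> 'a cdual"
  where "sgn_cdual f = inverse (norm f) *\<^sub>R f"

definition uniformity_cdual :: "('a cdual \<times> 'a cdual) filter"
  where "uniformity_cdual = (INF e\<in>{0 <..}. principal {(f, g). dist f g < e})"

definition open_cdual :: "'a cdual set \<Rightarrow> bool"
  where "open_cdual S = (\<forall>f\<in>S. \<forall>\<^sub>F (f', g) in uniformity. f' = f \<longrightarrow> g \<in> S)"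

instance
  by standard (unfold dist_cdual_def sgn_cdual_def uniformity_cdual_def open_cdual_def,
    (rule refl | (transfer, simp add: algebra_simps norm_triangle_ineq scaleR_scaleC
        scaleC_add_right scaleC_add_left scaleC_scaleC scaleC_one norm_scaleC))+)

end

lemma cdual_apply_scaleC_left: "cdual_apply (c *\<^sub>C \<phi>) x = cnj c * cdual_apply \<phi> x"
  by transfer (simp add: clinop_apply_scaleC_left scaleC_complex_def)

lemma cdual_apply_add_left: "cdual_apply (\<phi> + \<psi>) x = cdual_apply \<phi> x + cdual_apply \<psi> x"
  by transfer (simp add: clinop_apply_add_left)

lemma cdual_apply_scaleR_left: "cdual_apply (r *\<^sub>R \<phi>) x = r *\<^sub>R cdual_apply \<phi> x"
  by transfer (simp add: clinop_apply_scaleR_left)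

lemma cdual_apply_scaleC_right: "cdual_apply \<phi> (c *\<^sub>C x) = c * cdual_apply \<phi> x"
  by transfer (simp add: clinop_apply_scaleC scaleC_complex_def)

lemma cdual_apply_add_right: "cdual_apply \<phi> (x + y) = cdual_apply \<phi> x + cdual_apply \<phi> y"
  by transfer (rule linear_add[OF bounded_linear.linear[OF bounded_linear_clinop_apply]])

lemma norm_cdual_apply: "cmod (cdual_apply \<phi> x) \<le> norm \<phi> * norm x"
  by transfer (rule norm_clinop_apply)

definition conj_functional :: "'a::complex_normed_vector \<Rightarrow> ('a cdual \<Rightarrow>\<^sub>C\<^sub>L complex)"
  where "conj_functional x = clinop_of (\<lambda>\<phi>. cnj (cdual_apply \<phi> x))"

lemma conj_functional_apply [simp]:
  "clinop_apply (conj_functional x) \<phi> = cnj (cdual_apply \<phi> x)"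
proof -
  have "bounded_linear (\<lambda>\<phi>. cnj (cdual_apply \<phi> x))"
    by (rule bounded_linear_intro[where K = "norm x"])
      (simp_all add: cdual_apply_add_left cdual_apply_scaleR_left norm_cdual_apply)
  then show ?thesis
    unfolding conj_functional_def
    by (subst clinop_apply_clinop_of) (simp_all add: cdual_apply_scaleC_left scaleC_complex_def)
qed

lemma conj_functional_add: "conj_functional (x + y) = conj_functional x + conj_functional y"
  by (rule clinop_eqI) (simp add: clinop_apply_add_left cdual_apply_add_right)

lemma conj_functional_scaleC: "conj_functional (c *\<^sub>C x) = cnj c *\<^sub>C conj_functional x"
  by (rule clinop_eqI) (simp add: clinop_apply_scaleC_left cdual_apply_scaleC_right scaleC_complex_def)

lemma conj_functional_zero: "conj_functional 0 = 0"
  using conj_functional_add[of 0 0] by simp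

lemma conj_functional_minus: "conj_functional (- x) = - conj_functional x"
  using conj_functional_add[of "- x" x]
  by (simp add: conj_functional_zero eq_neg_iff_add_eq_0)

lemma conj_functional_diff: "conj_functional (x - y) = conj_functional x - conj_functional y"
  using conj_functional_add[of x "- y"] by (simp add: conj_functional_minus)

lemma scaleC_conj_functional: "c *\<^sub>C conj_functional x = conj_functional (cnj c *\<^sub>C x)"
  by (simp add: conj_functional_scaleC)

text \<open>
  The norm of a conjugate vector is its operator norm as a functional on the dual, i.e. the
  supremum over functionals of norm 1, read as 0 when the space is trivial.
\<close>

typedef (overloaded) 'a conj_space = "range (conj_functional :: 'a::complex_normed_vector \<Rightarrow> _)"
  by blast

setup_lifting type_definition_conj_space

lift_definition conj_vec :: "'a::complex_normed_vector \<Rightarrow> 'a conj_space" is conj_functional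
  by blast

instantiation conj_space :: (complex_normed_vector) complex_normed_vector
begin

lift_definition norm_conj_space :: "'a conj_space \<Rightarrow> real" is norm .

lift_definition scaleC_conj_space :: "complex \<Rightarrow> 'a conj_space \<Rightarrow> 'a conj_space" is scaleC
  by (auto simp: scaleC_conj_functional)

lift_definition scaleR_conj_space :: "real \<Rightarrow> 'a conj_space \<Rightarrow> 'a conj_space" is scaleR
  by (auto simp: scaleR_scaleC scaleC_conj_functional)

lift_definition zero_conj_space :: "'a conj_space" is 0
  by (metis conj_functional_zero rangeI)

lift_definition plus_conj_space :: "'a conj_space \<Rightarrow> 'a conj_space \<Rightarrow> 'a conj_space" is "(+)"
  by (auto simp: conj_functional_add[symmetric])

lift_definition uminus_conj_space :: "'a conj_space \<Rightarrow> 'a conj_space" is uminus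
  by (auto simp: conj_functional_minus[symmetric])

lift_definition minus_conj_space :: "'a conj_space \<Rightarrow> 'a conj_space \<Rightarrow> 'a conj_space" is "(-)"
  by (auto simp: conj_functional_diff[symmetric])

definition dist_conj_space :: "'a conj_space \<Rightarrow> 'a conj_space \<Rightarrow> real"
  where "dist_conj_space f g = norm (f - g)"

definition sgn_conj_space :: "'a conj_space \<Rightarrow> 'a conj_space"
  where "sgn_conj_space f = inverse (norm f) *\<^sub>R f"

definition uniformity_conj_space :: "('a conj_space \<times> 'a conj_space) filter"
  where "uniformity_conj_space = (INF e\<in>{0 <..}. principal {(f, g). dist f g < e})"

definition open_conj_space :: "'a conj_space set \<Rightarrow> bool"
  where "open_conj_space S = (\<forall>f\<in>S. \<forall>\<^sub>F (f', g) in uniformity. f' = f \<longrightarrow> g \<in> S)"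

instance
  by standard (unfold dist_conj_space_def sgn_conj_space_def uniformity_conj_space_def open_conj_space_def,
    (rule refl | (transfer, simp add: algebra_simps norm_triangle_ineq scaleR_scaleC
        scaleC_add_right scaleC_add_left scaleC_scaleC scaleC_one norm_scaleC))+)

end

lemma conj_vec_add: "conj_vec (x + y) = conj_vec x + conj_vec y"
  by transfer (rule conj_functional_add)

lemma conj_vec_scaleC: "conj_vec (c *\<^sub>C x) = cnj c *\<^sub>C conj_vec x"
  by transfer (rule conj_functional_scaleC)

section \<open>Bochner integral in an arbitrary normed space\<close>

text \<open>
  The library defines the Bochner integral only for second countable spaces, which would exclude
  nonseparable Banach spaces. The definition below is the same without that restriction. Since
  simple functions take finitely many values, the \<open>L\<^sup>1\<close> approximation forces the integrand to be
  strongly measurable even if the space is not separable.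
\<close>

inductive has_bochner_int :: "'m measure \<Rightarrow> ('m \<Rightarrow> 'a::real_normed_vector) \<Rightarrow> 'a \<Rightarrow> bool"
  for M f x where
  "f \<in> borel_measurable M \<Longrightarrow>
    (\<And>i. Bochner_Integration.simple_bochner_integrable M (s i)) \<Longrightarrow>
    (\<lambda>i. \<integral>\<^sup>+w. norm (f w - s i w) \<partial>M) \<longlonglongrightarrow> 0 \<Longrightarrow>
    (\<lambda>i. Bochner_Integration.simple_bochner_integral M (s i)) \<longlonglongrightarrow> x \<Longrightarrow>
    has_bochner_int M f x"

definition bochner_int :: "'m measure \<Rightarrow> ('m \<Rightarrow> 'a::real_normed_vector) \<Rightarrow> 'a"
  where "bochner_int M f =
    (if \<exists>x. has_bochner_int M f x then THE x. has_bochner_int M f x else 0)"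

lemma has_bochner_int_iff_has_bochner_integral:
  fixes f :: "'m \<Rightarrow> 'a::{real_normed_vector, second_countable_topology}"
  shows "has_bochner_int M f x \<longleftrightarrow> has_bochner_integral M f x"
  by (simp add: has_bochner_int.simps has_bochner_integral.simps)

lemma bochner_int_eq_lebesgue_integral:
  fixes f :: "'m \<Rightarrow> 'a::{banach, second_countable_topology}"
  shows "bochner_int M f = integral\<^sup>L M f"
proof -
  have "has_bochner_int M f = has_bochner_integral M f"
    by (rule ext) (rule has_bochner_int_iff_has_bochner_integral)
  then show ?thesis
    by (simp add: bochner_int_def lebesgue_integral_def)
qed

section \<open>Holomorphic functions on the unit ball and weighted measures\<close>

abbreviation unit_ball :: "(complex ^ 'n) set"
  where "unit_ball \<equiv> ball 0 1"

definition hinner :: "complex ^ 'n \<Rightarrow> complex ^ 'n \<Rightarrow> complex"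
  where "hinner z w = (\<Sum>j\<in>UNIV. z $ j * cnj (w $ j))"

definition normalized_lebesgue :: "(complex ^ 'n) measure"
  where "normalized_lebesgue = uniform_measure (restrict_space lborel unit_ball) unit_ball"

definition nu_weight :: "'n::finite itself \<Rightarrow> real \<Rightarrow> real"
  where "nu_weight _ \<alpha> =
    Gamma (real CARD('n) + \<alpha> + 1) / (fact CARD('n) * Gamma (\<alpha> + 1))"

definition nu :: "real \<Rightarrow> (complex ^ 'n) measure"
  where "nu \<alpha> = density normalized_lebesgue
    (\<lambda>z. ennreal (nu_weight TYPE('n) \<alpha> * (1 - (norm z)\<^sup>2) powr \<alpha>))"

definition holomorphic :: "(complex ^ 'n) set \<Rightarrow> (complex ^ 'n \<Rightarrow> 'a::complex_normed_vector) set"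
  where "holomorphic S = {f. open S \<and>
    (\<forall>z\<in>S. \<exists>D. (f has_derivative D) (at z) \<and> (\<forall>c v. D (c *s v) = c *\<^sub>C D v))}"

definition hardy_infinity :: "(complex ^ 'n \<Rightarrow> 'a::complex_normed_vector) set"
  where "hardy_infinity = {f \<in> holomorphic unit_ball. bounded (f ` unit_ball)}"

definition bergman_space :: "real \<Rightarrow> real \<Rightarrow> (complex ^ 'n \<Rightarrow> 'a::complex_normed_vector) set"
  where "bergman_space p \<alpha> =
    {f \<in> holomorphic unit_ball. (\<integral>\<^sup>+z. ennreal (norm (f z) powr p) \<partial>nu \<alpha>) < \<infinity>}"

definition bergman_norm :: "real \<Rightarrow> real \<Rightarrow> (complex ^ 'n \<Rightarrow> 'a::complex_normed_vector) \<Rightarrow> real"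
  where "bergman_norm p \<alpha> f =
    enn2real (\<integral>\<^sup>+z. ennreal (norm (f z) powr p) \<partial>nu \<alpha>) powr (1 / p)"

section \<open>Little Hankel operators and the spaces \<open>\<Gamma>\<^sub>\<gamma>\<close>\<close>

definition little_hankel ::
    "real \<Rightarrow> (complex ^ 'n \<Rightarrow> ('x::complex_normed_vector conj_space \<Rightarrow>\<^sub>C\<^sub>L 'y::complex_normed_vector)) \<Rightarrow>
      (complex ^ 'n \<Rightarrow> 'x) \<Rightarrow> complex ^ 'n \<Rightarrow> 'y"
  where "little_hankel \<alpha> b f z = bochner_int (nu \<alpha>)
    (\<lambda>w. inverse ((1 - hinner z w) powr complex_of_real (real CARD('n) + 1 + \<alpha>)) *\<^sub>C
      clinop_apply (b w) (conj_vec (f w)))"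

definition hankel_extends_boundedly ::
    "real \<Rightarrow> (complex ^ 'n \<Rightarrow> ('x::complex_normed_vector conj_space \<Rightarrow>\<^sub>C\<^sub>L 'y::complex_normed_vector)) \<Rightarrow>
      real \<Rightarrow> real \<Rightarrow> bool"
  where "hankel_extends_boundedly \<alpha> b p q \<longleftrightarrow>
    (\<exists>C. \<forall>f\<in>hardy_infinity. little_hankel \<alpha> b f \<in> bergman_space q \<alpha> \<and>
      bergman_norm q \<alpha> (little_hankel \<alpha> b f) \<le> C * bergman_norm p \<alpha> f)"

definition cpartial :: "'n \<Rightarrow> (complex ^ 'n \<Rightarrow> 'a::complex_normed_vector) \<Rightarrow> complex ^ 'n \<Rightarrow> 'a"
  where "cpartial j f z =
    (THE d. ((\<lambda>t. f (z + axis j t)) has_derivative (\<lambda>t. t *\<^sub>C d)) (at 0))"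

definition radial_deriv :: "(complex ^ 'n \<Rightarrow> 'a::complex_normed_vector) \<Rightarrow> complex ^ 'n \<Rightarrow> 'a"
  where "radial_deriv f z = (\<Sum>j\<in>UNIV. z $ j *\<^sub>C cpartial j f z)"

definition Gamma_space :: "real \<Rightarrow> (complex ^ 'n \<Rightarrow> 'a::complex_normed_vector) set"
  where "Gamma_space \<gamma> = {f \<in> holomorphic unit_ball. \<exists>k::nat. real k > \<gamma> \<and>
    ennreal (norm (f 0)) +
      (SUP z\<in>unit_ball. ennreal ((1 - (norm z)\<^sup>2) powr (real k - \<gamma>) * norm ((radial_deriv ^^ k) f z))) < \<infinity>}"

end

theory Submission
  imports Defs "HOL-Complex_Analysis.Cauchy_Integral_Formula"
begin

text \<open>
  By complex Hahn-Banach, vector-valued identities may be tested on functionals, so that everything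
  rests on the scalar reproducing formula for the kernel \<open>(1 - \<langle>z, w\<rangle>) powr (- N)\<close>,
  \<open>N = n + 1 + \<alpha>\<close>. That formula is obtained from its Gaussian analogue, which is translation invariance
  of Lebesgue measure combined with the mean value property, by writing the Gaussian as a
  superposition of dilates of the weight \<open>(1 - |w|\<^sup>2) powr \<alpha>\<close> and comparing homogeneous parts.

  Let \<open>B\<^sub>j(z)\<close> be the integral of \<open>(1 - \<langle>z, w\<rangle>) powr (- N - j) b(w)\<close>. Then \<open>B\<^sub>0\<close> is a multiple of \<open>b\<close>, and
  \<open>R B\<^sub>j = (N + j) (B\<^sub>j\<^sub>+\<^sub>1 - B\<^sub>j)\<close> for the radial derivative \<open>R\<close>; hence \<open>b\<close> lies in \<open>\<Gamma>\<^sub>\<gamma>\<close>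
  iff \<open>B\<^sub>0, \<dots>, B\<^sub>k\<close> are \<open>O((1 - |z|\<^sup>2) powr (\<gamma> - k))\<close> for some \<open>k > \<gamma>\<close>.

  If \<open>b\<close> lies in \<open>\<Gamma>\<^sub>\<gamma>\<close>, the reproducing formula with weight \<open>\<alpha> + k\<close> and Fubini's theorem turn the
  pairing of \<open>b\<close> with a bounded holomorphic \<open>g\<close> into that of \<open>B\<^sub>k\<close> with \<open>g\<close> against
  \<open>\<nu>\<^sub>\<alpha>\<^sub>+\<^sub>k\<close>, which is bounded by the \<open>L\<^sup>p\<close> norm of \<open>g\<close>. For \<open>g(w) = (1 - \<langle>w, z\<rangle>) powr (- N) f(w)\<close> this
  bounds \<open>h\<^sub>b f(z)\<close> by \<open>(1 - |z|) powr (- N)\<close> times the \<open>L\<^sup>p\<close> norm of \<open>f\<close>, and this is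
  \<open>q\<close>-integrable for small \<open>q\<close>. Conversely, \<open>h\<^sub>b f(0) = B\<^sub>j(a) x\<close> for
  \<open>f(w) = (1 - \<langle>w, a\<rangle>) powr (- N - j) x\<close>, point evaluation at \<open>0\<close> is bounded on \<open>A\<^sup>q\<^sub>\<alpha>\<close>, and for large \<open>k\<close>
  and \<open>j \<le> k\<close> the \<open>L\<^sup>p\<close> norm of \<open>f\<close> is \<open>O((1 - |a|\<^sup>2) powr (\<gamma> - k))\<close>, because the reproducing formula evaluates the
  integral of \<open>|1 - \<langle>w, a\<rangle>| powr (- 2 N)\<close>.
\<close>

section \<open>Norming functionals\<close>

text \<open>Since \<open>X\<close> and \<open>Y\<close> may be nonseparable, Fubini's theorem and
  the exchange of sums and limits with integrals are applied to scalar integrands only, after a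
  functional has been fixed; existence of the vector integrals rests on continuity of the integrand.
  Sharp asymptotics of kernel integrals are replaced by a single exact evaluation, the one with
  exponent \<open>2 N\<close>. Other kernels are compared with it pointwise, at the price of a large
  order \<open>k\<close> with \<open>k p \<ge> 2 N\<close>. This is harmless because one
  \<open>k > \<gamma>\<close> decides membership in the space. For \<open>p < 1\<close> the
  reproducing formula gives no direct \<open>L^p\<close> estimate. The \<open>L^1\<close> estimate
  improves itself, because \<open>\<gamma>\<close> is the number with
  \<open>N + \<gamma> = N / p\<close>, equivalently
  \<open>(N + \<gamma>) (1 - p) = \<gamma>\<close>. The self-improvement cancels a power of a norm
  that must be finite beforehand, which boundedness of the function ensures. An element of a Bergman
  space need not be bounded and is therefore dilated into the ball of radius 1/2 before point
  evaluation is estimated.\<close>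

definition norm_dominated_graphs :: "('a::real_normed_vector \<times> real) set set"
  where "norm_dominated_graphs = {G. subspace G \<and> (\<forall>(v, r)\<in>G. r \<le> norm v)}"

text \<open>Partial functionals are encoded as subspaces of pairs, so that extension is inclusion
  and a chain is bounded by its union. Single-valuedness is automatic: \<open>(0, r)\<close> and its
  negative are both dominated by 0, which forces \<open>r = 0\<close>.\<close>

lemma norm_dominated_graphs_chain_Union:
  assumes "\<C> \<noteq> {}" "subset.chain norm_dominated_graphs \<C>"
  shows "\<Union>\<C> \<in> (norm_dominated_graphs :: ('a::real_normed_vector \<times> real) set set)"
proof -
  have sub: "\<And>G. G \<in> \<C> \<Longrightarrow> subspace G" and dom: "\<And>G v r. G \<in> \<C> \<Longrightarrow> (v, r) \<in> G \<Longrightarrow> r \<le> norm v"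
    using assms(2) by (auto simp: subset.chain_def norm_dominated_graphs_def)
  have tot: "\<And>G H. G \<in> \<C> \<Longrightarrow> H \<in> \<C> \<Longrightarrow> G \<subseteq> H \<or> H \<subseteq> G"
    using assms(2) by (auto simp: subset.chain_def)
  have "subspace (\<Union>\<C>)"
  proof (rule subspaceI)
    show "0 \<in> \<Union>\<C>"
      using assms(1) sub subspace_0 by blast
    show "x + y \<in> \<Union>\<C>" if "x \<in> \<Union>\<C>" "y \<in> \<Union>\<C>" for x y
    proof -
      from that obtain G H where "G \<in> \<C>" "H \<in> \<C>" "x \<in> G" "y \<in> H"
        by (elim UnionE)
      then have "\<exists>K\<in>\<C>. x \<in> K \<and> y \<in> K"
        using tot[of G H] by blast
      then show ?thesis
        using sub subspace_add by blast
    qed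
    show "c *\<^sub>R x \<in> \<Union>\<C>" if "x \<in> \<Union>\<C>" for c x
      using that sub subspace_scale by blast
  qed
  then show ?thesis
    using dom by (fastforce simp: norm_dominated_graphs_def)
qed

text \<open>One-step Hahn-Banach extension: every lower bound for the value at \<open>v\<close> lies
  below every upper bound by the triangle inequality, and \<open>c\<close> is the supremum of the
  lower ones. If \<open>v\<close> is already in the domain, these bounds force \<open>c\<close> to
  be the old value, so no case distinction arises.\<close>

lemma norm_dominated_graphs_extend:
  fixes G :: "('a::real_normed_vector \<times> real) set"
  assumes "G \<in> norm_dominated_graphs"
  obtains H where "H \<in> norm_dominated_graphs" "G \<subseteq> H" "v \<in> fst ` H"
proof -
  have sub: "subspace G" and dom: "\<And>v r. (v, r) \<in> G \<Longrightarrow> r \<le> norm v"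
    using assms by (auto simp: norm_dominated_graphs_def)
  have G0: "(0, 0) \<in> G"
    using subspace_0[OF sub] by (simp add: zero_prod_def)
  define S where "S = {r - norm (u - v) | u r. (u, r) \<in> G}"
  have le: "r - norm (u - v) \<le> norm (u' + v) - r'" if "(u, r) \<in> G" "(u', r') \<in> G" for u r u' r'
  proof -
    have "(u + u', r + r') \<in> G"
      using subspace_add[OF sub that] by simp
    then have "r + r' \<le> norm (u + u')"
      by (rule dom)
    also have "\<dots> \<le> norm (u - v) + norm (u' + v)"
      using norm_triangle_ineq[of "u - v" "u' + v"] by simp
    finally show ?thesis by simp
  qed
  have ne: "S \<noteq> {}"
    using G0 unfolding S_def by blast
  have bdd: "bdd_above S"
    unfolding S_def bdd_above_def using le[OF _ G0] by blast
  define c where "c = Sup S"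
  have c1: "r - norm (u - v) \<le> c" if "(u, r) \<in> G" for u r
    unfolding c_def by (rule cSup_upper[OF _ bdd]) (use that S_def in blast)
  have c2: "c \<le> norm (u' + v) - r'" if "(u', r') \<in> G" for u' r'
    unfolding c_def by (rule cSup_least[OF ne]) (use that S_def le in blast)
  define H where "H = {(u + t *\<^sub>R v, r + t * c) | u r t. (u, r) \<in> G}"
  have "r + t * c \<le> norm (u + t *\<^sub>R v)" if ur: "(u, r) \<in> G" for u r t
  proof -
    have sc: "(u /\<^sub>R s, r / s) \<in> G" for s
      using subspace_scale[OF sub ur, of "inverse s"] by (simp add: divide_inverse mult.commute)
    \<comment> \<open>Dividing by the modulus of \<open>t\<close> reduces to the coefficients 1 and
      -1 of \<open>v\<close>, which are \<open>c2\<close> and \<open>c1\<close>.\<close>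
    consider "t = 0" | "t > 0" | "t < 0" by linarith
    then show ?thesis
    proof cases
      case 1
      then show ?thesis using dom[OF ur] by simp
    next
      case 2
      have "t * c \<le> t * (norm (u /\<^sub>R t + v) - r / t)"
        using 2 by (intro mult_left_mono c2 sc) auto
      also have "\<dots> = norm (t *\<^sub>R (u /\<^sub>R t + v)) - r"
        using 2 by (simp add: right_diff_distrib)
      also have "t *\<^sub>R (u /\<^sub>R t + v) = u + t *\<^sub>R v"
        using 2 by (simp add: algebra_simps)
      finally show ?thesis by simp
    next
      case 3
      have "(-t) * (r / (-t) - norm (u /\<^sub>R (-t) - v)) \<le> (-t) * c"
        using 3 by (intro mult_left_mono c1 sc) auto
      also have "(-t) * (r / (-t) - norm (u /\<^sub>R (-t) - v)) = r - norm ((-t) *\<^sub>R (u /\<^sub>R (-t) - v))"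
        using 3 norm_scaleR[of "-t" "u /\<^sub>R (-t) - v"] by (simp add: right_diff_distrib)
      also have "(-t) *\<^sub>R (u /\<^sub>R (-t) - v) = u + t *\<^sub>R v"
        using 3 by (simp add: algebra_simps)
      finally show ?thesis by simp
    qed
  qed
  then have domH: "\<forall>(v, r)\<in>H. r \<le> norm v"
    unfolding H_def by auto
  have "subspace H"
  proof (rule subspaceI)
    show "0 \<in> H"
      unfolding H_def using G0 by (force simp: zero_prod_def)
    show "x + y \<in> H" if xy: "x \<in> H" "y \<in> H" for x y
    proof -
      from xy obtain u r t u' r' t' where
        "x = (u + t *\<^sub>R v, r + t * c)" "(u, r) \<in> G" "y = (u' + t' *\<^sub>R v, r' + t' * c)" "(u', r') \<in> G"
        unfolding H_def by blast
      then have "x + y = ((u + u') + (t + t') *\<^sub>R v, (r + r') + (t + t') * c)" "(u + u', r + r') \<in> G"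
        using subspace_add[OF sub, of "(u, r)" "(u', r')"] by (auto simp: algebra_simps)
      then show ?thesis
        unfolding H_def by blast
    qed
    show "k *\<^sub>R x \<in> H" if x: "x \<in> H" for k x
    proof -
      from x obtain u r t where
        "x = (u + t *\<^sub>R v, r + t * c)" "(u, r) \<in> G"
        unfolding H_def by blast
      then have "k *\<^sub>R x = (k *\<^sub>R u + (k * t) *\<^sub>R v, k * r + (k * t) * c)" "(k *\<^sub>R u, k * r) \<in> G"
        using subspace_scale[OF sub, of "(u, r)" k] by (auto simp: algebra_simps)
      then show ?thesis
        unfolding H_def by blast
    qed
  qed
  with domH have "H \<in> norm_dominated_graphs"
    by (simp add: norm_dominated_graphs_def)
  moreover have "G \<subseteq> H"
    unfolding H_def by force
  moreover have "v \<in> fst ` H"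
    using G0 unfolding H_def
    by (intro image_eqI[of _ _ "(v, c)"] CollectI exI[of _ "0::'a"] exI[of _ "0::real"] exI[of _ "1::real"]) auto
  ultimately show ?thesis
    using that by blast
qed

text \<open>Zorn's lemma above the line spanned by \<open>(x, norm x)\<close>; by the one-step
  extension a maximal graph has full domain.\<close>

lemma norming_functional_real:
  fixes x :: "'a::real_normed_vector"
  obtains f where "linear f" "\<And>v. f v \<le> norm v" "f x = norm x"
proof -
  let ?A = "{G \<in> (norm_dominated_graphs :: ('a \<times> real) set set). (x, norm x) \<in> G}"
  have "linear (\<lambda>t. t *\<^sub>R (x, norm x))"
    by (rule linearI) (auto simp: algebra_simps)
  then have "range (\<lambda>t. t *\<^sub>R (x, norm x)) \<in> ?A"
    by (auto simp: norm_dominated_graphs_def intro!: linear_subspace_image[OF _ subspace_UNIV]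
        image_eqI[of _ _ 1] mult_right_mono)
  then have "\<exists>M\<in>?A. \<forall>X\<in>?A. M \<subseteq> X \<longrightarrow> X = M"
  proof (intro subset_Zorn_nonempty)
    show "\<Union>\<C> \<in> ?A" if "\<C> \<noteq> {}" "subset.chain ?A \<C>" for \<C>
      using that norm_dominated_graphs_chain_Union[of \<C>] by (auto simp: subset.chain_def)
  qed auto
  then obtain M where M: "M \<in> norm_dominated_graphs" "(x, norm x) \<in> M"
    and max: "\<And>X. X \<in> ?A \<Longrightarrow> M \<subseteq> X \<Longrightarrow> X = M"
    by blast
  have tot: "\<exists>r. (v, r) \<in> M" for v
  proof -
    obtain H where "H \<in> norm_dominated_graphs" "M \<subseteq> H" "v \<in> fst ` H"
      using norm_dominated_graphs_extend[OF M(1)] by blast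
    with max[of H] M(2) show ?thesis
      by force
  qed
  have sub: "subspace M" and dom: "\<And>v r. (v, r) \<in> M \<Longrightarrow> r \<le> norm v"
    using M by (auto simp: norm_dominated_graphs_def)
  have uniq: "r = s" if "(v, r) \<in> M" "(v, s) \<in> M" for v r s
    using dom[of 0 "r - s"] dom[of 0 "s - r"] subspace_diff[OF sub that] subspace_diff[OF sub that(2,1)]
    by simp
  define f where "f v = (THE r. (v, r) \<in> M)" for v
  have f: "(v, f v) \<in> M" for v
    unfolding f_def using tot uniq by (metis theI)
  have feq: "f v = r" if "(v, r) \<in> M" for v r
    using uniq f that by blast
  show ?thesis
  proof
    show "linear f"
      by (rule linearI; rule feq)
        (use subspace_add[OF sub f f] subspace_scale[OF sub f] in auto)
    show "f v \<le> norm v" for v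
      by (rule dom) (rule f)
    show "f x = norm x"
      by (rule feq) (rule M)
  qed
qed

text \<open>The closed unit ball of the dual, with ordinary (not conjugated) scalars. Norm at most 1
  lets estimates pass through functionals without constants.\<close>

definition complex_functional :: "('a::complex_normed_vector \<Rightarrow> complex) \<Rightarrow> bool"
  where "complex_functional \<phi> \<longleftrightarrow> bounded_linear \<phi> \<and> (\<forall>c x. \<phi> (c *\<^sub>C x) = c * \<phi> x) \<and>
    (\<forall>x. cmod (\<phi> x) \<le> norm x)"

text \<open>The complexification \<open>f v - \<i> f (\<i> v)\<close> of a real norming functional
  \<open>f\<close>.\<close>

lemma norming_functional:
  fixes x :: "'a::complex_normed_vector"
  obtains \<phi> where "complex_functional \<phi>" "\<phi> x = of_real (norm x)"
proof -
  obtain f :: "'a \<Rightarrow> real" where f: "linear f" "\<And>v. f v \<le> norm v" "f x = norm x"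
    using norming_functional_real by blast
  note [simp] = linear_add[OF f(1)] linear_scale[OF f(1)] linear_neg[OF f(1)] linear_diff[OF f(1)]
  define \<phi> where "\<phi> v = Complex (f v) (- f (\<i> *\<^sub>C v))" for v
  have ii: "\<i> *\<^sub>C \<i> *\<^sub>C v = - v" for v :: 'a
    using scaleR_scaleC[of "-1" v] by (simp add: scaleC_scaleC)
  have R: "\<i> *\<^sub>C r *\<^sub>R v = r *\<^sub>R \<i> *\<^sub>C v" for r and v :: 'a
    by (simp add: scaleR_scaleC scaleC_scaleC mult.commute)
  have \<phi>C: "\<phi> (c *\<^sub>C v) = c * \<phi> v" for c v
  proof -
    have c: "c *\<^sub>C v = Re c *\<^sub>R v + Im c *\<^sub>R \<i> *\<^sub>C v"
      by (simp add: scaleR_scaleC scaleC_scaleC flip: scaleC_add_left)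
        (metis complex_eq mult.commute)
    show ?thesis
      by (simp add: \<phi>_def c scaleC_add_right R ii complex_eq_iff)
  qed
  have bound: "cmod (\<phi> v) \<le> norm v" for v
  proof (cases "\<phi> v = 0")
    case False
    \<comment> \<open>Rotating \<open>v\<close> until \<open>\<phi>\<close> is real and nonnegative
      there turns the modulus into a value of \<open>f\<close>.\<close>
    define c where "c = cnj (sgn (\<phi> v))"
    have "cmod c = 1"
      using False by (simp add: c_def norm_sgn)
    have "c * \<phi> v = of_real (cmod (\<phi> v))"
      using False by (simp add: c_def sgn_eq complex_norm_square[symmetric] power2_eq_square field_simps)
    then have "cmod (\<phi> v) = Re (\<phi> (c *\<^sub>C v))"
      by (simp add: \<phi>C)
    also have "\<dots> = f (c *\<^sub>C v)"
      by (simp add: \<phi>_def)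
    also have "\<dots> \<le> norm (c *\<^sub>C v)"
      by (rule f)
    finally show ?thesis
      by (simp add: norm_scaleC \<open>cmod c = 1\<close>)
  qed simp
  have lin: "bounded_linear \<phi>"
    by (rule bounded_linear_intro[where K = 1])
      (use bound in \<open>simp_all add: \<phi>_def scaleC_add_right R complex_eq_iff\<close>)
  \<comment> \<open>The real part at \<open>x\<close> already exhausts the bound
    \<open>norm x\<close>, so the imaginary part vanishes.\<close>
  have "(norm x)\<^sup>2 + (f (\<i> *\<^sub>C x))\<^sup>2 \<le> (norm x)\<^sup>2"
    using power_mono[OF bound[of x], of 2] by (simp add: \<phi>_def f(3) cmod_power2)
  then have "\<phi> x = of_real (norm x)"
    by (simp add: \<phi>_def f(3) complex_eq_iff)
  with lin \<phi>C bound show ?thesis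
    using that[of \<phi>] by (auto simp: complex_functional_def)
qed

lemma norm_conj_vec: "norm (conj_vec x) = norm (x :: 'x::complex_normed_vector)"
proof (rule antisym)
  have *: "norm (clinop_of g) \<le> K"
    if "bounded_linear g" "\<And>c x. g (c *\<^sub>C x) = c *\<^sub>C g x" "0 \<le> K" "\<And>x. norm (g x) \<le> K * norm x"
    for g :: "'z::complex_normed_vector \<Rightarrow> complex" and K
    using that by (simp add: norm_clinop_onorm clinop_apply_clinop_of onorm_bound)
  have **: "norm f \<le> K"
    if "0 \<le> K" "\<And>x. norm (clinop_apply f x) \<le> K * norm x"
    for f :: "'z::complex_normed_vector \<Rightarrow>\<^sub>C\<^sub>L complex" and K
    using that by (simp add: norm_clinop_onorm onorm_bound)
  show "norm (conj_vec x) \<le> norm x"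
    using norm_cdual_apply[of _ x]
    by (simp add: norm_conj_space.rep_eq conj_vec.rep_eq ** mult.commute)
  \<comment> \<open>A norming functional, regarded as an element of \<open>cdual\<close>, gives the
    reverse inequality.\<close>
  obtain \<phi> where \<phi>: "complex_functional \<phi>" "\<phi> x = of_real (norm x)"
    by (rule norming_functional)
  define f where "f = cdual_of (clinop_of \<phi>)"
  have fa: "cdual_apply f = \<phi>"
    using \<phi>(1) unfolding f_def
    by (simp add: cdual_apply.abs_eq clinop_apply_clinop_of complex_functional_def scaleC_complex_def)
  have "norm f \<le> 1"
    using \<phi>(1) unfolding f_def norm_cdual.abs_eq
    by (intro *) (auto simp: complex_functional_def scaleC_complex_def)
  have "norm x = norm (clinop_apply (conj_functional x) f)"
    by (simp add: fa \<phi>(2))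
  also have "\<dots> \<le> norm (conj_functional x) * norm f"
    by (rule norm_clinop_apply)
  also have "\<dots> \<le> norm (conj_functional x) * 1"
    using \<open>norm f \<le> 1\<close> by (rule mult_left_mono) simp
  finally show "norm x \<le> norm (conj_vec x)"
    by (simp add: norm_conj_space.rep_eq conj_vec.rep_eq)
qed

section \<open>The Bochner integral\<close>

text \<open>In a nonseparable space a difference of measurable functions can fail to be measurable.
  Here \<open>s\<close> has finitely many values, and on each level set only a constant is
  subtracted.\<close>

lemma borel_measurable_norm_diff_simple:
  fixes f :: "'m \<Rightarrow> 'a::real_normed_vector"
  assumes f: "f \<in> borel_measurable M" and s: "simple_function M s"
  shows "(\<lambda>x. norm (f x - s x)) \<in> borel_measurable M"
proof (rule measurable_compose_countable'[where g = s and f = "\<lambda>y x. norm (f x - y)" and I = "s ` space M"])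
  show "(\<lambda>x. norm (f x - y)) \<in> borel_measurable M" for y
    by (rule measurable_compose[OF f])
      (intro borel_measurable_continuous_onI continuous_intros)
  show "s \<in> measurable M (count_space (s ` space M))"
    using measurable_simple_function[OF s] by (auto simp: measurable_def)
  show "countable (s ` space M)"
    using s by (intro countable_finite) (simp add: simple_function_def)
qed

text \<open>Images of the approximating simple functions approximate the image. With a scalar-valued
  \<open>T\<close> this turns the integral into an ordinary complex one.\<close>

lemma has_bochner_int_linear:
  fixes f :: "'m \<Rightarrow> 'a::real_normed_vector" and T :: "'a \<Rightarrow> 'b::real_normed_vector"
  assumes T: "bounded_linear T" and f: "has_bochner_int M f x"
  shows "has_bochner_int M (\<lambda>w. T (f w)) (T x)"
  using f
proof cases
  case (1 s)
  obtain K where K: "\<And>v. norm (T v) \<le> norm v * K" "K \<ge> 0"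
    using bounded_linear.nonneg_bounded[OF T] by blast
  have sf: "simple_function M (s i)" for i
    using 1(2)[of i] by (simp add: simple_bochner_integrable.simps)
  have lin: "linear T"
    using T by (rule bounded_linear.linear)
  show ?thesis
  proof (rule has_bochner_int.intros)
    show "(\<lambda>w. T (f w)) \<in> borel_measurable M"
      by (rule measurable_compose[OF 1(1)])
        (intro borel_measurable_continuous_onI bounded_linear.continuous_on[OF T] continuous_intros)
    show "Bochner_Integration.simple_bochner_integrable M (\<lambda>w. T (s i w))" for i
      using simple_bochner_integrable_compose2[of "\<lambda>x y. T x", OF _ 1(2)[of i] 1(2)[of i]]
      by (simp add: linear_0[OF lin])
    have le: "(\<integral>\<^sup>+w. norm (T (f w) - T (s i w)) \<partial>M) \<le> ennreal K * (\<integral>\<^sup>+w. norm (f w - s i w) \<partial>M)" for i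
    proof -
      have "(\<integral>\<^sup>+w. norm (T (f w) - T (s i w)) \<partial>M) \<le> (\<integral>\<^sup>+w. ennreal K * norm (f w - s i w) \<partial>M)"
        using K by (intro nn_integral_mono)
          (auto simp: linear_diff[OF lin, symmetric] ennreal_mult[symmetric] mult.commute intro!: ennreal_leI)
      also have "\<dots> = ennreal K * (\<integral>\<^sup>+w. norm (f w - s i w) \<partial>M)"
        by (intro nn_integral_cmult measurable_compose[OF borel_measurable_norm_diff_simple[OF 1(1) sf]]) simp
      finally show ?thesis .
    qed
    have lim: "(\<lambda>i. ennreal K * (\<integral>\<^sup>+w. norm (f w - s i w) \<partial>M)) \<longlonglongrightarrow> 0"
      using tendsto_mult_ennreal[OF tendsto_const 1(3), of "ennreal K"] by simp
    show "(\<lambda>i. \<integral>\<^sup>+w. norm (T (f w) - T (s i w)) \<partial>M) \<longlonglongrightarrow> 0"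
      by (rule tendsto_sandwich[OF always_eventually always_eventually tendsto_const lim]) (use le in simp_all)
    show "(\<lambda>i. Bochner_Integration.simple_bochner_integral M (\<lambda>w. T (s i w))) \<longlonglongrightarrow> T x"
      using bounded_linear.tendsto[OF T 1(4)] 1(2)
      by (simp add: simple_bochner_integral_linear[OF lin])
  qed
qed

lemma complex_functional_eqI:
  fixes x y :: "'a::complex_normed_vector"
  assumes "\<And>\<phi>. complex_functional \<phi> \<Longrightarrow> \<phi> x = \<phi> y"
  shows "x = y"
proof -
  obtain \<phi> where \<phi>: "complex_functional \<phi>" "\<phi> (x - y) = of_real (norm (x - y))"
    by (rule norming_functional)
  then have "\<phi> (x - y) = \<phi> x - \<phi> y"
    using linear_diff[OF bounded_linear.linear[of \<phi>]] by (simp add: complex_functional_def)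
  with \<phi> assms[of \<phi>] show ?thesis
    by auto
qed

lemma complex_functional_norm_le:
  fixes x :: "'a::complex_normed_vector"
  assumes "\<And>\<phi>. complex_functional \<phi> \<Longrightarrow> cmod (\<phi> x) \<le> B"
  shows "norm x \<le> B"
proof -
  obtain \<phi> where \<phi>: "complex_functional \<phi>" "\<phi> x = of_real (norm x)"
    by (rule norming_functional)
  then show ?thesis
    using assms[OF \<phi>(1)] by simp
qed

lemma has_bochner_int_functional:
  fixes f :: "'m \<Rightarrow> 'a::complex_normed_vector"
  assumes "complex_functional \<phi>" "has_bochner_int M f x"
  shows "has_bochner_integral M (\<lambda>w. \<phi> (f w)) (\<phi> x)"
proof -
  have "bounded_linear \<phi>"
    using assms(1) by (simp only: complex_functional_def)
  from has_bochner_int_linear[OF this assms(2)] show ?thesis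
    by (rule has_bochner_int_iff_has_bochner_integral[THEN iffD1])
qed

text \<open>The uniqueness behind the \<open>THE\<close> in \<open>bochner_int\<close>: two values
  agree under every functional, by uniqueness of the scalar integral.\<close>

lemma bochner_int_eqI:
  fixes f :: "'m \<Rightarrow> 'a::complex_normed_vector"
  assumes "has_bochner_int M f x"
  shows "bochner_int M f = x"
proof -
  have "y = x" if "has_bochner_int M f y" for y
  proof (rule complex_functional_eqI)
    fix \<phi> :: "'a \<Rightarrow> complex" assume \<phi>: "complex_functional \<phi>"
    show "\<phi> y = \<phi> x"
      by (rule has_bochner_integral_eq[OF has_bochner_int_functional[OF \<phi> that] has_bochner_int_functional[OF \<phi> assms]])
  qed
  then have "(THE y. has_bochner_int M f y) = x"
    by (rule the_equality[where P = "has_bochner_int M f", OF assms])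
  moreover have "\<exists>y. has_bochner_int M f y"
    using assms by (rule exI)
  ultimately show ?thesis
    unfolding bochner_int_def by simp
qed

text \<open>Comparing \<open>s i\<close> and \<open>s j\<close> through \<open>f\<close> bounds the
  distance of their integrals by \<open>d i + d j\<close>. The integrals are therefore Cauchy and
  completeness supplies the value.\<close>

lemma has_bochner_int_limit:
  fixes f :: "'m \<Rightarrow> 'a::cbanach"
  assumes f: "f \<in> borel_measurable M"
    and s: "\<And>i. Bochner_Integration.simple_bochner_integrable M (s i)"
    and lim: "(\<lambda>i. \<integral>\<^sup>+w. norm (f w - s i w) \<partial>M) \<longlonglongrightarrow> 0"
  obtains x where "has_bochner_int M f x"
proof -
  define I where "I i = Bochner_Integration.simple_bochner_integral M (s i)" for i
  define d where "d i = (\<integral>\<^sup>+w. norm (f w - s i w) \<partial>M)" for i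
  have sf: "simple_function M (s i)" for i
    using s[of i] by (simp add: simple_bochner_integrable.simps)
  have bound: "ennreal (norm (I i - I j)) \<le> d i + d j" for i j
  proof -
    have "ennreal (norm (I i - I j)) = norm (Bochner_Integration.simple_bochner_integral M (\<lambda>x. s i x - s j x))"
      using s unfolding I_def by (subst simple_bochner_integral_diff) auto
    also have "\<dots> \<le> Bochner_Integration.simple_bochner_integral M (\<lambda>x. norm (s i x - s j x))"
      using simple_bochner_integrable_compose2[of "(-)" M "s i" "s j"] s
      by (auto intro!: simple_bochner_integral_norm_bound)
    also have "\<dots> = (\<integral>\<^sup>+x. norm (s i x - s j x) \<partial>M)"
      using simple_bochner_integrable_compose2[of "\<lambda>x y. norm (x - y)" M "s i" "s j"] s
      by (auto intro!: simple_bochner_integral_eq_nn_integral)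
    also have "\<dots> \<le> (\<integral>\<^sup>+x. ennreal (norm (f x - s i x)) + ennreal (norm (f x - s j x)) \<partial>M)"
    proof (rule nn_integral_mono)
      show "ennreal (norm (s i x - s j x)) \<le> ennreal (norm (f x - s i x)) + ennreal (norm (f x - s j x))" for x
        using norm_triangle_ineq4[of "f x - s j x" "f x - s i x"]
        by (simp flip: ennreal_plus add: ennreal_leI)
    qed
    also have "\<dots> = d i + d j"
      unfolding d_def
      by (intro nn_integral_add measurable_compose[OF borel_measurable_norm_diff_simple[OF f sf]]) auto
    finally show ?thesis .
  qed
  have "Cauchy I"
  proof (rule metric_CauchyI)
    fix e :: real assume "e > 0"
    then have "eventually (\<lambda>i. d i < ennreal (e / 2)) sequentially"
      using lim unfolding d_def by (intro order_tendstoD(2)) auto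
    then obtain k where k: "\<And>i. i \<ge> k \<Longrightarrow> d i < ennreal (e / 2)"
      by (auto simp: eventually_sequentially)
    have "dist (I i) (I j) < e" if "i \<ge> k" "j \<ge> k" for i j
    proof -
      have "ennreal (norm (I i - I j)) < ennreal (e / 2) + ennreal (e / 2)"
        using bound[of i j] k[OF that(1)] k[OF that(2)] by (meson add_strict_mono le_less_trans)
      also have "\<dots> = ennreal e"
        using \<open>e > 0\<close> by (simp flip: ennreal_plus)
      finally show ?thesis
        using \<open>e > 0\<close> by (simp add: dist_norm ennreal_less_iff)
    qed
    then show "\<exists>k. \<forall>m\<ge>k. \<forall>n\<ge>k. dist (I m) (I n) < e"
      by blast
  qed
  then obtain x where "I \<longlonglongrightarrow> x"
    by (meson Cauchy_convergent convergent_def)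
  then show ?thesis
    unfolding I_def by (rule that[OF has_bochner_int.intros[OF f s lim]])
qed

section \<open>Lebesgue measure on the complex coordinate space\<close>

lemma nn_integral_lborel_translate:
  fixes f :: "'a::euclidean_space \<Rightarrow> ennreal"
  assumes [measurable]: "f \<in> borel_measurable borel"
  shows "(\<integral>\<^sup>+x. f (a + x) \<partial>lborel) = (\<integral>\<^sup>+x. f x \<partial>lborel)"
proof -
  have "(\<integral>\<^sup>+x. f x \<partial>lborel) = (\<integral>\<^sup>+x. f x \<partial>distr lborel borel ((+) a))"
    by (simp add: lborel_distr_plus)
  also have "\<dots> = (\<integral>\<^sup>+x. f (a + x) \<partial>lborel)"
    by (subst nn_integral_distr) simp_all
  finally show ?thesis by simp
qed

text \<open>
  The usual uniqueness argument for Haar measure: integrating \<open>indicator (ball 0 1) x * g (T y + x)\<close>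
  over \<open>x\<close> and \<open>y\<close> in either order gives the measure of the ball times the integral of \<open>g \<circ> T\<close> and
  of \<open>g\<close> respectively.
\<close>

lemma nn_integral_lborel_isometry:
  fixes T :: "'a::euclidean_space \<Rightarrow> 'a"
  assumes T: "linear T" "\<And>x. norm (T x) = norm x" "surj T" and g[measurable]: "g \<in> borel_measurable borel"
  shows "(\<integral>\<^sup>+x. g (T x) \<partial>lborel) = (\<integral>\<^sup>+x. g x \<partial>lborel)"
proof -
  have cT: "continuous_on UNIV T"
    by (intro linear_continuous_on linear_conv_bounded_linear[THEN iffD1] T)
  then have [measurable]: "T \<in> borel_measurable borel"
    by (rule borel_measurable_continuous_onI)
  let ?B = "indicator (ball 0 1) :: 'a \<Rightarrow> ennreal"
  let ?V = "emeasure lborel (ball 0 1 :: 'a set)"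
  have cont: "continuous_on UNIV (\<lambda>p. T (fst p) + snd p)" "continuous_on UNIV (\<lambda>p. fst p - T (snd p))"
    by (auto intro!: continuous_intros continuous_on_compose2[OF cT])
  have B[measurable]: "?B \<in> borel_measurable borel"
    by (rule borel_measurable_indicator) simp
  have V: "(\<integral>\<^sup>+x. ?B x \<partial>lborel) = ?V"
    by simp
  have "?V * (\<integral>\<^sup>+y. g (T y) \<partial>lborel) = (\<integral>\<^sup>+x. ?B x * (\<integral>\<^sup>+y. g (T y) \<partial>lborel) \<partial>lborel)"
    by (subst nn_integral_multc) (simp_all add: V B)
  also have "\<dots> = (\<integral>\<^sup>+x. (\<integral>\<^sup>+y. ?B x * g (T y + x) \<partial>lborel) \<partial>lborel)"
  proof (rule nn_integral_cong)
    fix x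
    obtain s where x: "x = T s"
      using T(3) by blast
    have "(\<integral>\<^sup>+y. g (T y) \<partial>lborel) = (\<integral>\<^sup>+y. g (T (s + y)) \<partial>lborel)"
      using nn_integral_lborel_translate[of "\<lambda>y. g (T y)" s] by simp
    also have "\<dots> = (\<integral>\<^sup>+y. g (T y + x) \<partial>lborel)"
      by (simp add: x linear_add[OF T(1)] add.commute)
    finally show "?B x * (\<integral>\<^sup>+y. g (T y) \<partial>lborel) = (\<integral>\<^sup>+y. ?B x * g (T y + x) \<partial>lborel)"
      by (simp add: nn_integral_cmult)
  qed
  also have "\<dots> = (\<integral>\<^sup>+y. (\<integral>\<^sup>+x. ?B x * g (T y + x) \<partial>lborel) \<partial>lborel)"
  proof (rule lborel_pair.Fubini')
    show "(\<lambda>(y, x). ?B x * g (T y + x)) \<in> borel_measurable (lborel \<Otimes>\<^sub>M lborel)"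
      unfolding lborel_prod measurable_lborel2 case_prod_beta
      by (intro borel_measurable_times_ennreal measurable_compose[OF borel_measurable_continuous_onI B]
          measurable_compose[OF borel_measurable_continuous_onI[OF cont(1)] g] continuous_intros)
  qed
  also have "\<dots> = (\<integral>\<^sup>+y. (\<integral>\<^sup>+x. ?B (x - T y) * g x \<partial>lborel) \<partial>lborel)"
  proof (rule nn_integral_cong)
    fix y
    show "(\<integral>\<^sup>+x. ?B x * g (T y + x) \<partial>lborel) = (\<integral>\<^sup>+x. ?B (x - T y) * g x \<partial>lborel)"
      using nn_integral_lborel_translate[of "\<lambda>x. ?B (x - T y) * g x" "T y"] by simp
  qed
  also have "\<dots> = (\<integral>\<^sup>+x. (\<integral>\<^sup>+y. ?B (x - T y) * g x \<partial>lborel) \<partial>lborel)"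
  proof (rule lborel_pair.Fubini')
    show "(\<lambda>(x, y). ?B (x - T y) * g x) \<in> borel_measurable (lborel \<Otimes>\<^sub>M lborel)"
      unfolding lborel_prod measurable_lborel2 case_prod_beta
      by (intro borel_measurable_times_ennreal measurable_compose[OF borel_measurable_continuous_onI[OF cont(2)] B]
          measurable_compose[OF borel_measurable_continuous_onI g] continuous_intros)
  qed
  also have "\<dots> = (\<integral>\<^sup>+x. ?V * g x \<partial>lborel)"
  proof (rule nn_integral_cong)
    fix x
    obtain s where x: "x = T s"
      using T(3) by blast
    have "?B (x - T y) = ?B (- s + y)" for y
    proof -
      have "norm (x - T y) = norm (- s + y)"
        using T(2)[of "s - y"] by (simp add: x linear_diff[OF T(1)] norm_minus_commute)
      then show ?thesis
        by (simp add: indicator_def)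
    qed
    then have "(\<integral>\<^sup>+y. ?B (x - T y) * g x \<partial>lborel) = (\<integral>\<^sup>+y. ?B (- s + y) \<partial>lborel) * g x"
      by (simp add: nn_integral_multc)
    also have "(\<integral>\<^sup>+y. ?B (- s + y) \<partial>lborel) = ?V"
      using nn_integral_lborel_translate[of ?B "- s"] by simp
    finally show "(\<integral>\<^sup>+y. ?B (x - T y) * g x \<partial>lborel) = ?V * g x" .
  qed
  also have "\<dots> = ?V * (\<integral>\<^sup>+x. g x \<partial>lborel)"
    by (simp add: nn_integral_cmult)
  finally have eq: "?V * (\<integral>\<^sup>+y. g (T y) \<partial>lborel) = ?V * (\<integral>\<^sup>+x. g x \<partial>lborel)" .
  have "?V > 0"
    by (simp add: emeasure_ball unit_ball_vol_pos)
  moreover have "?V < top"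
    using emeasure_bounded_finite[of "ball 0 1 :: 'a set"] by simp
  ultimately show ?thesis
    using eq by (auto simp: ennreal_mult_cancel_left)
qed

section \<open>Complex scalar multiplication and rotation averages\<close>

lemma linear_vector_scalar_mult: "linear ((*s) (c::complex) :: complex ^ 'n \<Rightarrow> complex ^ 'n)"
  by (rule linearI) (simp_all add: vec_eq_iff algebra_simps)

lemma norm_vector_scalar_mult: "norm (c *s (w :: complex ^ 'n)) = cmod c * norm w"
proof -
  have "norm (c *s w) = sqrt (\<Sum>i\<in>UNIV. (cmod c)\<^sup>2 * (norm (w $ i))\<^sup>2)"
    by (simp add: norm_vec_def L2_set_def norm_mult power_mult_distrib)
  also have "\<dots> = cmod c * norm w"
    by (simp add: norm_vec_def L2_set_def sum_distrib_left[symmetric] real_sqrt_mult)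
  finally show ?thesis .
qed

lemma continuous_on_vector_scalar_mult [continuous_intros]:
  fixes f :: "'a::topological_space \<Rightarrow> complex" and g :: "'a \<Rightarrow> complex ^ 'n"
  assumes "continuous_on S f" "continuous_on S g"
  shows "continuous_on S (\<lambda>x. f x *s g x)"
  unfolding vector_scalar_mult_def
  by (intro continuous_intros assms)

lemma borel_measurable_vector_scalar_mult [measurable (raw)]:
  fixes f :: "'a \<Rightarrow> complex" and g :: "'a \<Rightarrow> complex ^ 'n"
  assumes "f \<in> borel_measurable M" "g \<in> borel_measurable M"
  shows "(\<lambda>x. f x *s g x) \<in> borel_measurable M"
  using assms by (rule borel_measurable_continuous_Pair) (intro continuous_intros)

lemma lborel_distr_rotation:
  assumes "cmod c = 1"
  shows "distr lborel borel ((*s) c :: complex ^ 'n \<Rightarrow> _) = lborel"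
proof (rule measure_eqI)
  have c: "c \<noteq> 0" using assms by auto
  have m[measurable]: "((*s) c :: complex ^ 'n \<Rightarrow> _) \<in> borel_measurable borel"
    by measurable
  have "surj ((*s) c :: complex ^ 'n \<Rightarrow> _)"
    by (rule surjI[of _ "(*s) (inverse c)"]) (simp add: vector_smult_assoc c)
  fix A :: "(complex ^ 'n) set" assume "A \<in> sets (distr lborel borel ((*s) c))"
  then have [measurable]: "A \<in> sets borel" by simp
  have "emeasure (distr lborel borel ((*s) c)) A = (\<integral>\<^sup>+x. indicator A x \<partial>distr lborel borel ((*s) c))"
    by simp
  also have "\<dots> = (\<integral>\<^sup>+x. indicator A (c *s x) \<partial>lborel)"
    by (subst nn_integral_distr) simp_all
  also have "\<dots> = (\<integral>\<^sup>+x. indicator A x \<partial>lborel)"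
    by (rule nn_integral_lborel_isometry)
      (simp_all add: linear_vector_scalar_mult norm_vector_scalar_mult assms \<open>surj _\<close>)
  finally show "emeasure (distr lborel borel ((*s) c)) A = emeasure lborel A"
    by simp
qed simp

lemma integrable_lborel_rotation:
  fixes g :: "complex ^ 'n \<Rightarrow> complex"
  assumes "cmod c = 1" "integrable lborel g"
  shows "integrable lborel (\<lambda>w. g (c *s w))"
proof -
  have "integrable (distr lborel borel ((*s) c)) g"
    using assms by (simp add: lborel_distr_rotation)
  then show ?thesis
    by (rule integrable_distr[rotated]) simp
qed

lemma integral_lborel_rotation:
  fixes g :: "complex ^ 'n \<Rightarrow> complex"
  assumes "cmod c = 1" "g \<in> borel_measurable borel"
  shows "(\<integral>w. g (c *s w) \<partial>lborel) = (\<integral>w. g w \<partial>lborel)"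
proof -
  have "(\<integral>w. g w \<partial>lborel) = (\<integral>w. g w \<partial>distr lborel borel ((*s) c))"
    using assms by (simp add: lborel_distr_rotation)
  also have "\<dots> = (\<integral>w. g (c *s w) \<partial>lborel)"
    by (rule integral_distr) (use assms in simp_all)
  finally show ?thesis by simp
qed

text \<open>All rotated integrals are equal, so their mean over \<theta> in [0, 1] is the original
  one, and Fubini moves the mean inside. The curve \<open>c\<close> is left general because both
  orientations of the circle occur later.\<close>

lemma integral_rotation_average:
  fixes g :: "complex ^ 'n \<Rightarrow> complex" and c :: "real \<Rightarrow> complex"
  assumes g: "integrable lborel g" and c: "continuous_on UNIV c" "\<And>\<theta>. cmod (c \<theta>) = 1"
  shows "(\<integral>w. g w \<partial>lborel) = (\<integral>w. (\<integral>\<theta>. indicator {0..1} \<theta> *\<^sub>R g (c \<theta> *s w) \<partial>lborel) \<partial>lborel)"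
proof -
  have [measurable]: "c \<in> borel_measurable borel"
    using c(1) by (rule borel_measurable_continuous_onI)
  have [measurable]: "g \<in> borel_measurable borel"
    using g by (simp add: borel_measurable_integrable)
  have "integrable (lborel \<Otimes>\<^sub>M lborel) (\<lambda>(\<theta>, w). indicator {0..1} \<theta> *\<^sub>R g (c \<theta> *s w))"
  proof (rule lborel_pair.Fubini_integrable)
    show "(\<lambda>(\<theta>, w). indicator {0..1} \<theta> *\<^sub>R g (c \<theta> *s w)) \<in> borel_measurable (lborel \<Otimes>\<^sub>M lborel)"
      by measurable
    have eq: "(\<integral>w. norm (indicator {0..1::real} \<theta> *\<^sub>R g (c \<theta> *s w)) \<partial>lborel) = indicator {0..1} \<theta> *\<^sub>R (\<integral>w. norm (g w) \<partial>lborel)" for \<theta>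
    proof -
      have "complex_of_real (\<integral>w. norm (g (c \<theta> *s w)) \<partial>lborel) = of_real (\<integral>w. norm (g w) \<partial>lborel)"
        using integral_lborel_rotation[OF c(2)[of \<theta>], of "\<lambda>w. of_real (norm (g w))"] by (simp add: integral_complex_of_real)
      then show ?thesis
        by simp
    qed
    show "integrable lborel (\<lambda>\<theta>. \<integral>w. norm (case (\<theta>, w) of (\<theta>, w) \<Rightarrow> indicator {0..1::real} \<theta> *\<^sub>R g (c \<theta> *s w)) \<partial>lborel)"
      unfolding prod.case eq by simp
    show "AE \<theta> in lborel. integrable lborel (\<lambda>w. case (\<theta>, w) of (\<theta>, w) \<Rightarrow> indicator {0..1::real} \<theta> *\<^sub>R g (c \<theta> *s w))"
      using integrable_lborel_rotation[OF c(2) g] by simp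
  qed
  then have "(\<integral>w. (\<integral>\<theta>. indicator {0..1} \<theta> *\<^sub>R g (c \<theta> *s w) \<partial>lborel) \<partial>lborel) =
      (\<integral>\<theta>. (\<integral>w. indicator {0..1} \<theta> *\<^sub>R g (c \<theta> *s w) \<partial>lborel) \<partial>lborel)"
    by (rule lborel_pair.Fubini_integral)
  also have "\<dots> = (\<integral>\<theta>. indicator {0..1::real} \<theta> *\<^sub>R (\<integral>w. g w \<partial>lborel) \<partial>lborel)"
    by (simp add: integral_lborel_rotation c)
  also have "\<dots> = (\<integral>w. g w \<partial>lborel)"
    by simp
  finally show ?thesis by simp
qed

section \<open>The Hermitian inner product\<close>

lemma hinner_add_left: "hinner (x + y) w = hinner x w + hinner y w"
  by (simp add: hinner_def sum.distrib algebra_simps)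

lemma hinner_add_right: "hinner z (x + y) = hinner z x + hinner z y"
  by (simp add: hinner_def sum.distrib algebra_simps)

lemma hinner_scale_left: "hinner (c *s z) w = c * hinner z w"
  by (simp add: hinner_def sum_distrib_left mult.assoc)

lemma hinner_scale_right: "hinner z (c *s w) = cnj c * hinner z w"
  by (simp add: hinner_def sum_distrib_left mult.left_commute)

lemma hinner_zero_left [simp]: "hinner 0 w = 0"
  by (simp add: hinner_def)

lemma cnj_hinner: "cnj (hinner z w) = hinner w z"
  by (simp add: hinner_def mult.commute)

lemma hinner_self: "hinner z z = of_real ((norm z)\<^sup>2)"
  by (simp add: hinner_def norm_vec_def L2_set_def sum_nonneg real_sqrt_pow2[OF sum_nonneg]
      flip: complex_norm_square)

lemma norm_hinner_le: "cmod (hinner z w) \<le> norm z * norm w"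
proof -
  have "cmod (hinner z w) \<le> (\<Sum>j\<in>UNIV. \<bar>norm (z $ j)\<bar> * \<bar>norm (w $ j)\<bar>)"
    unfolding hinner_def by (rule sum_norm_le) (simp add: norm_mult)
  also have "\<dots> \<le> norm z * norm w"
    unfolding norm_vec_def by (rule L2_set_mult_ineq)
  finally show ?thesis .
qed

lemma norm_hinner_le_left: "norm w \<le> 1 \<Longrightarrow> cmod (hinner z w) \<le> norm z"
  using norm_hinner_le[of z w] mult_left_le[of "norm w" "norm z"] by simp

lemma norm_hinner_less_1: "norm z < 1 \<Longrightarrow> norm w \<le> 1 \<Longrightarrow> cmod (hinner z w) < 1"
  using norm_hinner_le_left[of w z] by simp

lemma bounded_linear_hinner_left: "bounded_linear (\<lambda>z. hinner z w)"
  by (rule bounded_linear_intro[where K = "norm w"])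
    (simp_all add: hinner_add_left norm_hinner_le, simp add: hinner_def scaleR_sum_right)

lemma continuous_on_hinner [continuous_intros]:
  fixes f g :: "'a::topological_space \<Rightarrow> complex ^ 'n"
  assumes "continuous_on S f" "continuous_on S g"
  shows "continuous_on S (\<lambda>x. hinner (f x) (g x))"
  unfolding hinner_def by (intro continuous_intros assms)

lemma borel_measurable_hinner [measurable (raw)]:
  fixes f g :: "'a \<Rightarrow> complex ^ 'n"
  assumes "f \<in> borel_measurable M" "g \<in> borel_measurable M"
  shows "(\<lambda>x. hinner (f x) (g x)) \<in> borel_measurable M"
  using assms by (rule borel_measurable_continuous_Pair) (intro continuous_intros)

section \<open>Homogeneous expansions\<close>

text \<open>Complex-linear Frechet derivatives become one-variable complex derivatives, which makes
  Cauchy theory available on complex lines.\<close>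

lemma holomorphic_line:
  fixes f :: "complex ^ 'n \<Rightarrow> complex"
  assumes "f \<in> holomorphic S"
  shows "(\<lambda>t. f (z + t *s v)) holomorphic_on {t. z + t *s v \<in> S}"
proof (rule holomorphic_onI)
  fix t assume "t \<in> {t. z + t *s v \<in> S}"
  then obtain D where D: "(f has_derivative D) (at (z + t *s v))" "\<And>c v. D (c *s v) = c * D v"
    using assms unfolding holomorphic_def scaleC_complex_def by blast
  have "((\<lambda>t. z + t *s v) has_derivative (\<lambda>t. t *s v)) (at t)"
    by (auto intro!: derivative_eq_intros bounded_linear_imp_has_derivative linear_conv_bounded_linear[THEN iffD1]
        linearI simp: vec_eq_iff algebra_simps)
  from has_derivative_compose[OF this D(1)]
  have "((\<lambda>t. f (z + t *s v)) has_field_derivative D v) (at t)"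
    by (simp add: D(2) has_field_derivative_def mult.commute[of "D v"] mult_commute_abs)
  then show "(\<lambda>t. f (z + t *s v)) field_differentiable at t within {t. z + t *s v \<in> S}"
    using field_differentiable_at_within field_differentiable_def by blast
qed

lemma holomorphic_imp_continuous_on:
  fixes f :: "complex ^ 'n \<Rightarrow> 'a::complex_normed_vector"
  assumes "f \<in> holomorphic S"
  shows "continuous_on S f"
  using assms unfolding holomorphic_def
  by (auto intro!: continuous_at_imp_continuous_on dest: has_derivative_continuous)

lemma holomorphic_bounded_half_ball:
  fixes f :: "complex ^ 'n \<Rightarrow> 'a::complex_normed_vector"
  assumes "f \<in> holomorphic unit_ball"
  shows "\<exists>M. \<forall>v. norm v \<le> 1 / 2 \<longrightarrow> norm (f v) \<le> M"
proof -
  have "continuous_on (cball 0 (1/2)) f"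
    by (rule continuous_on_subset[OF holomorphic_imp_continuous_on[OF assms]]) auto
  then have "bounded (f ` cball 0 (1/2))"
    by (intro compact_imp_bounded compact_continuous_image) auto
  then show ?thesis
    unfolding bounded_iff by (metis image_eqI mem_cball_0)
qed

text \<open>The \<open>m\<close>-th homogeneous Taylor polynomial of \<open>f\<close> at 0, read off
  along the ray through \<open>w\<close>. A derivative at \<open>t = 0\<close> sees only small
  \<open>t\<close>, so \<open>w\<close> may be any vector; the Gaussian integrals need it on the
  whole space.\<close>

definition hpart :: "nat \<Rightarrow> (complex ^ 'n \<Rightarrow> complex) \<Rightarrow> complex ^ 'n \<Rightarrow> complex"
  where "hpart m f w = (deriv ^^ m) (\<lambda>t. f (t *s w)) 0 / fact m"

lemma hpart_0 [simp]: "hpart 0 f w = f 0"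
  by (simp add: hpart_def)

lemma holomorphic_ray:
  assumes "f \<in> holomorphic unit_ball" "r * norm w \<le> 1"
  shows "(\<lambda>t. f (t *s w)) holomorphic_on ball 0 r"
proof -
  have "ball 0 r \<subseteq> {t. 0 + t *s w \<in> unit_ball}"
  proof
    fix t :: complex assume t: "t \<in> ball 0 r"
    have "cmod t * norm w < 1"
    proof (cases "w = 0")
      case False
      then have "cmod t * norm w < r * norm w"
        using t by simp
      with assms(2) show ?thesis by linarith
    qed simp
    then show "t \<in> {t. 0 + t *s w \<in> unit_ball}"
      by (simp add: norm_vector_scalar_mult)
  qed
  with holomorphic_line[OF assms(1), of 0 w] show ?thesis
    by (simp add: holomorphic_on_subset)
qed

lemma hpart_scale:
  assumes f: "f \<in> holomorphic unit_ball"
  shows "hpart m f (c *s w) = c ^ m * hpart m f w"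
\<comment> \<open>The rescaled disc of radius \<open>r / cmod c\<close> requires
  \<open>c \<noteq> 0\<close>; for \<open>c = 0\<close> the claim is that higher derivatives of a
  constant vanish.\<close>
proof (cases "c = 0")
  case True
  have "(deriv ^^ Suc k) (\<lambda>t. f 0) 0 = 0" for k
    using higher_deriv_const[of "Suc k" "f 0"] by simp
  then show ?thesis
    using True by (cases m) (simp_all add: hpart_def)
next
  case False
  define r where "r = 1 / (1 + norm w)"
  have r: "r > 0" "r * norm w \<le> 1"
    by (simp_all add: r_def field_simps add_pos_nonneg)
  have "(deriv ^^ m) (\<lambda>t. (\<lambda>t. f (t *s w)) (c * t)) 0 = c ^ m * (deriv ^^ m) (\<lambda>t. f (t *s w)) (c * 0)"
  proof (rule higher_deriv_compose_linear[where S = "ball 0 (r / cmod c)" and T = "ball 0 r"])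
    show "(\<lambda>t. f (t *s w)) holomorphic_on ball 0 r"
      using holomorphic_ray[OF f] r by blast
    show "c * t \<in> ball 0 r" if "t \<in> ball 0 (r / cmod c)" for t
      using that False by (simp add: norm_mult field_simps)
  qed (use r False in auto)
  then show ?thesis
    by (simp add: hpart_def vector_smult_assoc mult.commute)
qed

lemma hpart_sums:
  assumes f: "f \<in> holomorphic unit_ball" and "norm w < 1"
  shows "(\<lambda>m. hpart m f w) sums f w"
proof -
  \<comment> \<open>The radius exceeds 1, so the power series along the ray may be evaluated at
    \<open>t = 1\<close>, while the ray up to \<open>r\<close> stays in the ball.\<close>
  define r where "r = 2 / (1 + norm w)"
  have r: "r > 1" "r * norm w \<le> 1"
    using assms(2) by (simp_all add: r_def field_simps add_pos_nonneg)
  have "((\<lambda>n. (deriv ^^ n) (\<lambda>t. f (t *s w)) 0 / fact n * (1 - 0) ^ n) sums f (1 *s w))"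
    by (rule holomorphic_power_series[OF holomorphic_ray[OF f r(2)]]) (use r in simp)
  then show ?thesis
    by (simp add: hpart_def)
qed

text \<open>Cauchy's inequality on the circle of radius \<open>1 / (2 * norm w)\<close>, which the
  ray maps into the sphere of radius 1/2.\<close>

lemma norm_hpart_le:
  assumes f: "f \<in> holomorphic unit_ball" and M: "\<And>v. norm v \<le> 1 / 2 \<Longrightarrow> cmod (f v) \<le> M"
  shows "cmod (hpart m f w) \<le> M * (2 * norm w) ^ m"
proof (cases "w = 0")
  case True
  then show ?thesis
    using hpart_scale[OF f, of m 0 0] M[of 0] by (cases m) auto
next
  case False
  define r where "r = 1 / (2 * norm w)"
  have r: "r > 0" "r * norm w = 1 / 2" "2 * r * norm w \<le> 1"
    using False by (simp_all add: r_def)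
  have hol: "(\<lambda>t. f (t *s w)) holomorphic_on ball 0 (2 * r)"
    using r by (intro holomorphic_ray[OF f]) simp
  have "norm ((deriv ^^ m) (\<lambda>t. f (t *s w)) 0) \<le> fact m * M / r ^ m"
  proof (rule Cauchy_inequality)
    show "(\<lambda>t. f (t *s w)) holomorphic_on ball 0 r" "continuous_on (cball 0 r) (\<lambda>t. f (t *s w))"
      using r by (auto intro!: holomorphic_on_subset[OF hol]
          continuous_on_subset[OF holomorphic_on_imp_continuous_on[OF hol]])
    show "norm (f (t *s w)) \<le> M" if "norm (0 - t) = r" for t
      using that r by (intro M) (simp add: norm_vector_scalar_mult)
  qed (use r in auto)
  then show ?thesis
    by (simp add: hpart_def norm_divide r_def field_simps)
qed

text \<open>Recovers \<open>hpart m f\<close> as a limit of rescaled remainders, uniformly on the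
  ball of radius \<open>R\<close>, so that regularity passes from \<open>f\<close> and the lower
  parts to it. After division by \<open>s ^ m\<close> the tail is dominated by a geometric series of
  ratio \<open>2 * R * s \<le> 1 / 2\<close>.\<close>

lemma hpart_remainder:
  assumes f: "f \<in> holomorphic unit_ball" and M: "\<And>v. norm v \<le> 1 / 2 \<Longrightarrow> cmod (f v) \<le> M"
    and R: "norm w \<le> R" and s: "0 < s" "4 * s * R \<le> 1"
  shows "cmod ((f (of_real s *s w) - (\<Sum>j<m. hpart j f w * of_real s ^ j)) / of_real s ^ m - hpart m f w)
    \<le> M * (2 * R) ^ m * (4 * R * s)"
proof -
  have R0: "0 \<le> R" and M0: "0 \<le> M"
    using R norm_ge_zero[of w] M[of 0] norm_ge_zero[of "f 0"] by (simp_all del: norm_ge_zero)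
  have 1: "s * norm w \<le> s * R"
    using s mult_left_mono[OF R, of s] by simp
  have 2: "s * R \<le> 1 / 4"
    using s(2) by (simp add: mult.assoc)
  have "norm (complex_of_real s *s w) = s * norm w"
    using s by (simp add: norm_vector_scalar_mult)
  with 1 2 have "norm (complex_of_real s *s w) < 1"
    by linarith
  then have "(\<lambda>j. hpart j f w * of_real s ^ j) sums f (of_real s *s w)"
    using hpart_sums[OF f, of "complex_of_real s *s w"] by (simp add: hpart_scale[OF f] mult.commute)
  then have "(\<lambda>j. hpart (j + Suc m) f w * of_real s ^ (j + Suc m)) sums
      (f (of_real s *s w) - (\<Sum>j<Suc m. hpart j f w * of_real s ^ j))"
    by (subst sums_iff_shift) simp
  from sums_divide[OF this, of "of_real s ^ m"]
  have sums: "(\<lambda>j. hpart (j + Suc m) f w * of_real s ^ Suc j) sums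
      ((f (of_real s *s w) - (\<Sum>j<m. hpart j f w * of_real s ^ j)) / of_real s ^ m - hpart m f w)"
    using s(1) by (simp add: power_add diff_divide_distrib add_divide_distrib algebra_simps)
  have bound: "cmod (hpart (j + Suc m) f w * of_real s ^ Suc j) \<le> M * (2 * R) ^ m * (2 * R * s) * (1 / 2) ^ j" for j
  proof -
    have "cmod (hpart (j + Suc m) f w * of_real s ^ Suc j) \<le> M * (2 * R) ^ (j + Suc m) * s ^ Suc j"
      using s R R0 M0 unfolding norm_mult norm_power norm_of_real
      by (intro mult_mono order_trans[OF norm_hpart_le[OF f M]] mult_left_mono power_mono) auto
    also have "\<dots> = M * (2 * R) ^ m * (2 * R * s) * (2 * R * s) ^ j"
      by (simp add: power_add power_mult_distrib algebra_simps)
    also have "\<dots> \<le> M * (2 * R) ^ m * (2 * R * s) * (1 / 2) ^ j"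
      using s R0 M0 2 by (intro mult_left_mono power_mono) (auto simp: mult_ac)
    finally show ?thesis .
  qed
  have geo: "(\<lambda>j. M * (2 * R) ^ m * (2 * R * s) * (1 / 2) ^ j) sums (M * (2 * R) ^ m * (2 * R * s) * 2)"
    by (intro sums_mult) (use geometric_sums[of "1 / 2 :: real"] in simp)
  show ?thesis
    using norm_sums_le[OF sums geo bound] by (simp add: mult_ac)
qed

text \<open>A null sequence of scales satisfying the smallness condition of
  \<open>hpart_remainder\<close> from its first term on; \<open>R + 1\<close> in place of
  \<open>R\<close> allows \<open>R = 0\<close>.\<close>

definition shrink :: "real \<Rightarrow> nat \<Rightarrow> real"
  where "shrink R k = 1 / (4 * (R + 1) * real (Suc k))"

lemma shrink_pos: "R \<ge> 0 \<Longrightarrow> 0 < shrink R k"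
  by (simp add: shrink_def)

lemma shrink_le: "R \<ge> 0 \<Longrightarrow> 4 * shrink R k * R \<le> 1"
proof -
  assume R: "R \<ge> 0"
  have "R \<le> (R + 1) * real (Suc k)"
    using R mult_mono[of R "R + 1" 1 "real (Suc k)"] by simp
  then show ?thesis
    using R by (simp add: shrink_def divide_simps) (simp add: algebra_simps)
qed

lemma shrink_tendsto_0: "shrink R \<longlonglongrightarrow> 0"
proof -
  have "shrink R = (\<lambda>k. 1 / (4 * (R + 1)) * inverse (real (Suc k)))"
    by (simp add: shrink_def fun_eq_iff divide_inverse)
  then show ?thesis
    using tendsto_mult_left[OF LIMSEQ_inverse_real_of_nat, of "1 / (4 * (R + 1))"] by simp
qed

lemma norm_shrink_less_1:
  assumes "R \<ge> 0" "norm w \<le> R"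
  shows "norm (complex_of_real (shrink R k) *s w) < 1"
proof -
  have "norm (complex_of_real (shrink R k) *s w) = shrink R k * norm w"
    using shrink_pos[OF assms(1), of k] by (simp add: norm_vector_scalar_mult)
  also have "\<dots> \<le> shrink R k * R"
    using shrink_pos[OF assms(1), of k] assms(2) by (intro mult_left_mono) auto
  finally show ?thesis
    using shrink_le[OF assms(1), of k] by simp
qed

lemma hpart_uniform_limit:
  assumes f: "f \<in> holomorphic unit_ball" and R: "R \<ge> 0"
  shows "uniform_limit (cball 0 R)
    (\<lambda>k w. (f (of_real (shrink R k) *s w) - (\<Sum>j<m. hpart j f w * of_real (shrink R k) ^ j)) / of_real (shrink R k) ^ m)
    (hpart m f) sequentially"
proof -
  obtain M where M: "\<And>v. norm v \<le> 1 / 2 \<Longrightarrow> cmod (f v) \<le> M"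
    using holomorphic_bounded_half_ball[OF f] by blast
  have "(\<lambda>k. M * (2 * R) ^ m * (4 * R * shrink R k)) \<longlonglongrightarrow> M * (2 * R) ^ m * (4 * R * 0)"
    by (intro tendsto_intros shrink_tendsto_0)
  then have lim: "(\<lambda>k. M * (2 * R) ^ m * (4 * R * shrink R k)) \<longlonglongrightarrow> 0"
    by simp
  show ?thesis
  proof (rule uniform_limitI)
    fix e :: real assume "e > 0"
    then have "\<forall>\<^sub>F k in sequentially. M * (2 * R) ^ m * (4 * R * shrink R k) < e"
      using lim by (intro order_tendstoD(2)) auto
    then show "\<forall>\<^sub>F k in sequentially. \<forall>w\<in>cball 0 R.
        dist ((f (of_real (shrink R k) *s w) - (\<Sum>j<m. hpart j f w * of_real (shrink R k) ^ j)) / of_real (shrink R k) ^ m) (hpart m f w) < e"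
    proof eventually_elim
      case (elim k)
      show ?case
        using le_less_trans[OF hpart_remainder[OF f M _ shrink_pos[OF R] shrink_le[OF R]] elim]
        by (simp add: dist_norm)
    qed
  qed
qed

text \<open>Strong induction, since the approximants of the \<open>m\<close>-th part involve all
  lower parts; a locally uniform limit of continuous functions is continuous.\<close>

lemma continuous_on_hpart:
  assumes f: "f \<in> holomorphic unit_ball"
  shows "continuous_on UNIV (hpart m f)"
proof (induction m rule: less_induct)
  case (less m)
  have "continuous_on (cball 0 R) (hpart m f)" if R: "R \<ge> 0" for R
  proof (rule uniform_limit_theorem[OF _ hpart_uniform_limit[OF f R]])
    show "\<forall>\<^sub>F k in sequentially. continuous_on (cball 0 R)
      (\<lambda>w. (f (of_real (shrink R k) *s w) -
         (\<Sum>j<m. hpart j f w * of_real (shrink R k) ^ j)) /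
        of_real (shrink R k) ^ m)"
    proof (intro always_eventually allI continuous_on_divide continuous_on_diff continuous_on_sum
        continuous_on_mult continuous_on_const)
      fix k
      show "continuous_on (cball 0 R) (\<lambda>w. f (of_real (shrink R k) *s w))"
        by (rule continuous_on_compose2[OF holomorphic_imp_continuous_on[OF f]])
          (use norm_shrink_less_1[OF R] in \<open>auto intro!: continuous_intros\<close>)
      show "continuous_on (cball 0 R) (hpart j f)" if "j \<in> {..<m}" for j
        using less.IH[of j] that by (auto intro: continuous_on_subset)
    qed (use shrink_pos[OF R] in \<open>auto simp: less_imp_neq[THEN not_sym]\<close>)
  qed auto
  then have "continuous_on (ball 0 R) (hpart m f)" if "R \<ge> 0" for R
    using that by (meson ball_subset_cball continuous_on_subset)
  then have "isCont (hpart m f) w" for w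
    using continuous_on_interior[of "ball 0 (norm w + 1)" "hpart m f" w]
    by (simp add: interior_open add_nonneg_nonneg)
  then show ?case
    by (simp add: continuous_at_imp_continuous_on)
qed

text \<open>The same recursion with Weierstrass' theorem on uniform limits. Lines that miss the
  origin are included because the mean value property will be used around an arbitrary centre
  \<open>z\<close>.\<close>

lemma holomorphic_line_hpart:
  assumes f: "f \<in> holomorphic unit_ball"
  shows "(\<lambda>t. hpart m f (z + t *s v)) holomorphic_on UNIV"
proof (induction m rule: less_induct)
  case (less m)
  have "(\<lambda>t. hpart m f (z + t *s v)) holomorphic_on ball 0 T" if T: "T > 0" for T
  proof -
    define R where "R = norm z + T * norm v"
    have R: "R \<ge> 0"
      using T by (simp add: R_def)
    have zt: "norm (z + t *s v) \<le> R" if "t \<in> ball 0 T" for t :: complex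
    proof -
      have "cmod t * norm v \<le> T * norm v"
        using that by (intro mult_right_mono) auto
      then show ?thesis
        unfolding R_def using norm_triangle_ineq[of z "t *s v"] by (simp add: norm_vector_scalar_mult)
    qed
    let ?g = "\<lambda>k w. (f (of_real (shrink R k) *s w) - (\<Sum>j<m. hpart j f w * of_real (shrink R k) ^ j)) / of_real (shrink R k) ^ m"
    show ?thesis
    proof (rule holomorphic_uniform_sequence[where f = "\<lambda>k t. ?g k (z + t *s v)"])
      show "(\<lambda>t. ?g k (z + t *s v)) holomorphic_on ball 0 T" for k
      proof (intro holomorphic_intros)
        have "(\<lambda>t. f (of_real (shrink R k) *s z + t *s (of_real (shrink R k) *s v))) holomorphic_on ball 0 T"
        proof (rule holomorphic_on_subset[OF holomorphic_line[OF f]])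
          show "ball 0 T \<subseteq> {t. of_real (shrink R k) *s z + t *s (of_real (shrink R k) *s v) \<in> unit_ball}"
          proof
            fix t :: complex assume t: "t \<in> ball 0 T"
            have "of_real (shrink R k) *s z + t *s (of_real (shrink R k) *s v) = of_real (shrink R k) *s (z + t *s v)"
              by (simp add: vec_eq_iff algebra_simps)
            then show "t \<in> {t. of_real (shrink R k) *s z + t *s (of_real (shrink R k) *s v) \<in> unit_ball}"
              using norm_shrink_less_1[OF R zt[OF t], of k] by (simp only: mem_Collect_eq mem_ball_0)
          qed
        qed
        then show "(\<lambda>t. f (of_real (shrink R k) *s (z + t *s v))) holomorphic_on ball 0 T"
          by (rule holomorphic_transform) (simp add: vec_eq_iff algebra_simps)
        show "(\<lambda>t. hpart j f (z + t *s v)) holomorphic_on ball 0 T" if "j \<in> {..<m}" for j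
          using less.IH[of j] that by (auto intro: holomorphic_on_subset)
      qed (use shrink_pos[OF R] in \<open>auto simp: less_imp_neq[THEN not_sym]\<close>)
      fix t :: complex assume t: "t \<in> ball 0 T"
      then obtain d where d: "d > 0" "cball t d \<subseteq> ball 0 T"
        using open_contains_cball[of "ball 0 T"] by blast
      have "uniform_limit (cball t d) (\<lambda>k t. ?g k (z + t *s v)) (\<lambda>t. hpart m f (z + t *s v)) sequentially"
        by (rule uniform_limit_compose'[OF hpart_uniform_limit[OF f R]]) (use d zt in auto)
      with d show "\<exists>d>0. cball t d \<subseteq> ball 0 T \<and>
          uniform_limit (cball t d) (\<lambda>k t. ?g k (z + t *s v)) (\<lambda>t. hpart m f (z + t *s v)) sequentially"
        by blast
    qed simp
  qed
  then have "(\<lambda>t. hpart m f (z + t *s v)) field_differentiable at t" for t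
    by (rule holomorphic_on_imp_differentiable_at[of _ "ball 0 (cmod t + 1)"]) (auto intro: add_nonneg_pos)
  then show ?case
    by (simp add: holomorphic_on_def field_differentiable_at_within)
qed

section \<open>Averages over circles\<close>

text \<open>Cauchy's coefficient formula on the unit circle; the factor \<open>2 pi \<i>\<close> of
  the contour element cancels in the normalized average.\<close>

lemma circle_average_coeff:
  assumes "continuous_on (cball 0 1) F" "F holomorphic_on ball 0 1"
  shows "(\<integral>\<theta>. indicator {0..1} \<theta> *\<^sub>R (F (cis (2 * pi * \<theta>)) * cis (- (2 * pi * \<theta>)) ^ m) \<partial>lborel) =
    (deriv ^^ m) F 0 / fact m"
proof -
  let ?g = "\<lambda>\<theta>. F (cis (2 * pi * \<theta>)) * cis (- (2 * pi * \<theta>)) ^ m"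
  have "((\<lambda>u. F u / (u - 0) ^ Suc m) has_contour_integral (2 * pi * \<i>) / fact m * (deriv ^^ m) F 0) (circlepath 0 1)"
    using assms by (intro Cauchy_has_contour_integral_higher_derivative_circlepath) auto
  then have "((\<lambda>x. F (circlepath 0 1 x) / circlepath 0 1 x ^ Suc m *
      vector_derivative (circlepath 0 1) (at x within {0..1})) has_integral (2 * pi * \<i>) / fact m * (deriv ^^ m) F 0) {0..1}"
    by (simp add: has_contour_integral_def)
  then have "((\<lambda>x. 2 * pi * \<i> * ?g x) has_integral (2 * pi * \<i>) / fact m * (deriv ^^ m) F 0) {0..1}"
  proof (rule has_integral_eq[rotated])
    fix x :: real assume "x \<in> {0..1}"
    then have "vector_derivative (circlepath 0 1) (at x within {0..1}) = 2 * pi * \<i> * cis (2 * pi * x)"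
      using vector_derivative_circlepath01[of x 0 1] by (simp add: cis_conv_exp mult_ac)
    moreover have "circlepath 0 1 x = cis (2 * pi * x)"
      by (simp add: circlepath cis_conv_exp mult_ac)
    moreover have "cis (- (2 * pi * x)) = inverse (cis (2 * pi * x))"
      by (simp add: cis_inverse)
    moreover have "F c / c ^ Suc m * (2 * pi * \<i> * c) = 2 * pi * \<i> * (F c * inverse c ^ m)" if "c \<noteq> 0" for c
      using that by (simp add: field_simps)
    ultimately show "F (circlepath 0 1 x) / circlepath 0 1 x ^ Suc m *
        vector_derivative (circlepath 0 1) (at x within {0..1}) = 2 * pi * \<i> * ?g x"
      by (metis cis_neq_zero)
  qed
  from has_integral_mult_right[OF this, of "inverse (2 * pi * \<i>)"]
  have *: "(?g has_integral (deriv ^^ m) F 0 / fact m) {0..1}"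
    by (simp add: field_simps)
  have "continuous_on {0..1} ?g"
    by (intro continuous_intros continuous_on_compose2[OF assms(1)]) auto
  then have "set_integrable lborel {0..1} ?g"
    by (rule borel_integrable_atLeastAtMost')
  from set_borel_integral_eq_integral(2)[OF this] integral_unique[OF *] show ?thesis
    by (simp add: set_lebesgue_integral_def)
qed

text \<open>Under a rotation by angle \<theta> the factor \<open>hinner z w ^ m\<close> contributes
  frequency \<open>-m\<close>, so averaging extracts the \<open>m\<close>-th Taylor coefficient of
  \<open>F\<close> along the ray. Regularity is demanded only where \<open>W\<close> does not
  vanish, which lets \<open>F\<close> live on the ball alone.\<close>

lemma integral_rotation_coeff:
  fixes F :: "complex ^ 'n \<Rightarrow> complex" and W :: "complex ^ 'n \<Rightarrow> real"
  assumes W: "\<And>c w. cmod c = 1 \<Longrightarrow> W (c *s w) = W w"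
    and F: "\<And>w. W w \<noteq> 0 \<Longrightarrow> continuous_on (cball 0 1) (\<lambda>t. F (t *s w)) \<and> (\<lambda>t. F (t *s w)) holomorphic_on ball 0 1"
    and int: "integrable lborel (\<lambda>w. W w *\<^sub>R (F w * hinner z w ^ m))"
  shows "(\<integral>w. W w *\<^sub>R (F w * hinner z w ^ m) \<partial>lborel) = (\<integral>w. W w *\<^sub>R (hpart m F w * hinner z w ^ m) \<partial>lborel)"
proof -
  have "(\<integral>w. W w *\<^sub>R (F w * hinner z w ^ m) \<partial>lborel) = (\<integral>w. (\<integral>\<theta>. indicator {0..1} \<theta> *\<^sub>R
      (W (cis (2 * pi * \<theta>) *s w) *\<^sub>R (F (cis (2 * pi * \<theta>) *s w) * hinner z (cis (2 * pi * \<theta>) *s w) ^ m)) \<partial>lborel) \<partial>lborel)"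
    by (rule integral_rotation_average[OF int]) (auto intro!: continuous_intros)
  also have "\<dots> = (\<integral>w. W w *\<^sub>R (hpart m F w * hinner z w ^ m) \<partial>lborel)"
  proof (rule Bochner_Integration.integral_cong[OF refl])
    fix w
    have "(\<integral>\<theta>. indicator {0..1} \<theta> *\<^sub>R (W (cis (2 * pi * \<theta>) *s w) *\<^sub>R (F (cis (2 * pi * \<theta>) *s w) *
        hinner z (cis (2 * pi * \<theta>) *s w) ^ m)) \<partial>lborel) =
      (\<integral>\<theta>. W w *\<^sub>R ((indicator {0..1} \<theta> *\<^sub>R (F (cis (2 * pi * \<theta>) *s w) * cis (- (2 * pi * \<theta>)) ^ m)) * hinner z w ^ m) \<partial>lborel)"
      by (rule Bochner_Integration.integral_cong[OF refl])
        (simp add: W hinner_scale_right cis_cnj power_mult_distrib mult_ac)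
    also have "\<dots> = W w *\<^sub>R (hpart m F w * hinner z w ^ m)"
    proof (cases "W w = 0")
      case False
      then have "(\<integral>\<theta>. indicator {0..1} \<theta> *\<^sub>R (F (cis (2 * pi * \<theta>) *s w) * cis (- (2 * pi * \<theta>)) ^ m) \<partial>lborel) = hpart m F w"
        using F[of w] circle_average_coeff[of "\<lambda>t. F (t *s w)" m] by (simp add: hpart_def)
      then show ?thesis
        by (simp only: integral_scaleR_right integral_mult_left_zero)
    qed simp
    finally show "(\<integral>\<theta>. indicator {0..1} \<theta> *\<^sub>R (W (cis (2 * pi * \<theta>) *s w) *\<^sub>R (F (cis (2 * pi * \<theta>) *s w) *
        hinner z (cis (2 * pi * \<theta>) *s w) ^ m)) \<partial>lborel) = W w *\<^sub>R (hpart m F w * hinner z w ^ m)" .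
  qed
  finally show ?thesis .
qed

lemma higher_deriv_exp_linear: "(deriv ^^ m) (\<lambda>t. exp (t * a)) 0 = (a::complex) ^ m"
proof -
  have "(deriv ^^ m) exp = (exp :: complex \<Rightarrow> complex)"
  proof (induction m)
    case (Suc m)
    moreover have "deriv exp = (exp :: complex \<Rightarrow> complex)"
      by (simp add: fun_eq_iff DERIV_imp_deriv[OF DERIV_exp])
    ultimately show ?case
      by simp
  qed simp
  then show ?thesis
    using higher_deriv_compose_linear[where f = exp and S = UNIV and T = UNIV and z = 0 and u = a and n = m] by (simp add: mult.commute holomorphic_on_exp)
qed

text \<open>The mirror image: \<open>h\<close> is homogeneous and the exponential is expanded.
  Rotating in the opposite direction gives \<open>hinner z w\<close> a positive frequency, and the
  average picks the coefficient \<open>hinner z w ^ m / fact m\<close>.\<close>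

lemma integral_rotation_exp:
  fixes h :: "complex ^ 'n \<Rightarrow> complex" and W :: "complex ^ 'n \<Rightarrow> real"
  assumes W: "\<And>c w. cmod c = 1 \<Longrightarrow> W (c *s w) = W w"
    and h: "\<And>c w. h (c *s w) = c ^ m * h w"
    and int: "integrable lborel (\<lambda>w. W w *\<^sub>R (h w * exp (hinner z w)))"
  shows "(\<integral>w. W w *\<^sub>R (h w * exp (hinner z w)) \<partial>lborel) = (\<integral>w. W w *\<^sub>R (h w * hinner z w ^ m) \<partial>lborel) / fact m"
proof -
  have "(\<integral>w. W w *\<^sub>R (h w * exp (hinner z w)) \<partial>lborel) = (\<integral>w. (\<integral>\<theta>. indicator {0..1} \<theta> *\<^sub>R
      (W (cis (- (2 * pi * \<theta>)) *s w) *\<^sub>R (h (cis (- (2 * pi * \<theta>)) *s w) * exp (hinner z (cis (- (2 * pi * \<theta>)) *s w)))) \<partial>lborel) \<partial>lborel)"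
    by (rule integral_rotation_average[OF int]) (auto intro!: continuous_intros)
  also have "\<dots> = (\<integral>w. W w *\<^sub>R (h w * hinner z w ^ m) / fact m \<partial>lborel)"
  proof (rule Bochner_Integration.integral_cong[OF refl])
    fix w
    have "(\<integral>\<theta>. indicator {0..1} \<theta> *\<^sub>R (W (cis (- (2 * pi * \<theta>)) *s w) *\<^sub>R (h (cis (- (2 * pi * \<theta>)) *s w) *
        exp (hinner z (cis (- (2 * pi * \<theta>)) *s w)))) \<partial>lborel) =
      (\<integral>\<theta>. W w *\<^sub>R (h w * (indicator {0..1} \<theta> *\<^sub>R (exp (cis (2 * pi * \<theta>) * hinner z w) * cis (- (2 * pi * \<theta>)) ^ m))) \<partial>lborel)"
      by (rule Bochner_Integration.integral_cong[OF refl])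
        (simp add: W h hinner_scale_right cis_cnj mult_ac)
    also have "\<dots> = W w *\<^sub>R (h w * (hinner z w ^ m / fact m))"
      using circle_average_coeff[of "\<lambda>t. exp (t * hinner z w)" m]
      by (simp only: integral_scaleR_right integral_mult_right_zero higher_deriv_exp_linear)
        (simp add: continuous_intros holomorphic_intros)
    finally show "(\<integral>\<theta>. indicator {0..1} \<theta> *\<^sub>R (W (cis (- (2 * pi * \<theta>)) *s w) *\<^sub>R (h (cis (- (2 * pi * \<theta>)) *s w) *
        exp (hinner z (cis (- (2 * pi * \<theta>)) *s w)))) \<partial>lborel) = W w *\<^sub>R (h w * hinner z w ^ m) / fact m"
      by (simp add: scaleR_conv_of_real)
  qed
  also have "\<dots> = (\<integral>w. W w *\<^sub>R (h w * hinner z w ^ m) \<partial>lborel) / fact m"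
    by simp
  finally show ?thesis .
qed

section \<open>Gaussian and weighted integrals of homogeneous functions\<close>

text \<open>Extended by 0 outside the ball, so that integration over the ball becomes integration
  over the whole space with a rotation-invariant density.\<close>

definition ball_weight :: "real \<Rightarrow> complex ^ 'n \<Rightarrow> real"
  where "ball_weight \<alpha> w = (if norm w < 1 then (1 - (norm w)\<^sup>2) powr \<alpha> else 0)"

lemma ball_weight_nonneg [simp]: "0 \<le> ball_weight \<alpha> w"
  by (simp add: ball_weight_def)

lemma borel_measurable_ball_weight [measurable]: "ball_weight \<alpha> \<in> borel_measurable borel"
  unfolding ball_weight_def by measurable

lemma ball_weight_rotation: "cmod c = 1 \<Longrightarrow> ball_weight \<alpha> (c *s w) = ball_weight \<alpha> w"
  by (simp add: ball_weight_def norm_vector_scalar_mult)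

lemma nn_integral_lborel_scale:
  fixes f :: "complex ^ 'n \<Rightarrow> ennreal"
  assumes [measurable]: "f \<in> borel_measurable borel" and "c > 0"
  shows "(\<integral>\<^sup>+w. f w \<partial>lborel) = ennreal (c ^ (2 * CARD('n))) * (\<integral>\<^sup>+w. f (c *\<^sub>R w) \<partial>lborel)"
proof -
  have eq: "lborel = density (distr lborel borel (\<lambda>w :: complex ^ 'n. 0 + c *\<^sub>R w)) (\<lambda>_. ennreal (c ^ (2 * CARD('n))))"
    using lborel_affine[of c "0 :: complex ^ 'n"] assms(2) by (simp add: mult.commute)
  show ?thesis
    by (subst eq) (simp add: nn_integral_density nn_integral_distr nn_integral_cmult)
qed

text \<open>Euler's integral translated by \<open>t\<close>. For \<open>t = (norm w)\<^sup>2\<close>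
  it exhibits the Gaussian as a superposition over \<open>s\<close>.\<close>

lemma nn_integral_Gamma_shift:
  assumes "\<alpha> > -1"
  shows "(\<integral>\<^sup>+s. ennreal (exp (- s) * (if t < s then (s - t) powr \<alpha> else 0)) \<partial>lborel) = ennreal (exp (- t) * Gamma (\<alpha> + 1))"
proof -
  have "(\<integral>\<^sup>+s. ennreal (exp (- s) * (if t < s then (s - t) powr \<alpha> else 0)) \<partial>lborel) =
    (\<integral>\<^sup>+s. ennreal (exp (- (t + s)) * (if t < t + s then (t + s - t) powr \<alpha> else 0)) \<partial>lborel)"
    by (rule nn_integral_lborel_translate[symmetric]) measurable
  also have "\<dots> = (\<integral>\<^sup>+s. ennreal (exp (- t)) * ennreal (indicator {0..} s * s powr (\<alpha> + 1 - 1) / exp s) \<partial>lborel)"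
    by (rule nn_integral_cong)
      (auto simp: ennreal_mult'[symmetric] exp_minus exp_diff exp_add divide_inverse indicator_def intro!: arg_cong[of _ _ ennreal])
  also have "\<dots> = ennreal (exp (- t)) * ennreal (Gamma (\<alpha> + 1))"
    using assms by (subst nn_integral_cmult) (simp_all add: Gamma_conv_nn_integral_real)
  finally show ?thesis
    by (simp add: ennreal_mult')
qed

text \<open>
  The Gaussian is a superposition of the dilated weights \<open>(s - |w|\<^sup>2)\<^sup>\<alpha>\<close>, so for homogeneous
  integrands the two integrals agree up to a quotient of Gamma values.
\<close>

lemma nn_integral_gauss_homogeneous:
  fixes H :: "complex ^ 'n \<Rightarrow> ennreal"
  assumes [measurable]: "H \<in> borel_measurable borel" and \<alpha>: "\<alpha> > -1"
    and hom: "\<And>r w. r > 0 \<Longrightarrow> H (r *\<^sub>R w) = ennreal (r ^ (2 * m)) * H w"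
  shows "ennreal (Gamma (\<alpha> + 1)) * (\<integral>\<^sup>+w. ennreal (exp (- (norm w)\<^sup>2)) * H w \<partial>lborel) =
    ennreal (Gamma (real CARD('n) + 1 + \<alpha> + real m)) * (\<integral>\<^sup>+w. ennreal (ball_weight \<alpha> w) * H w \<partial>lborel)"
proof -
  let ?k = "\<lambda>s w. exp (- s) * (if (norm w)\<^sup>2 < s then (s - (norm w)\<^sup>2) powr \<alpha> else 0)"
  let ?I = "\<integral>\<^sup>+w. ennreal (ball_weight \<alpha> w) * H w \<partial>lborel"
  have inner: "(\<integral>\<^sup>+w. ennreal (?k s w) * H w \<partial>lborel) =
      ennreal (indicator {0..} s * s powr (real CARD('n) + 1 + \<alpha> + real m - 1) / exp s) * ?I" for s
  proof (cases "s > 0")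
    case True
    \<comment> \<open>Substituting \<open>sqrt s *\<^sub>R w\<close> yields \<open>s ^ n\<close>
      from the real dimension \<open>2 n\<close>, \<open>s powr \<alpha>\<close> from the weight and
      \<open>s ^ m\<close> from \<open>H\<close>. The total exponent \<open>n + \<alpha> + m\<close>
      is that of the Gamma integral at \<open>n + 1 + \<alpha> + m\<close>.\<close>
    have "(\<integral>\<^sup>+w. ennreal (?k s w) * H w \<partial>lborel) =
        ennreal (sqrt s ^ (2 * CARD('n))) * (\<integral>\<^sup>+w. ennreal (?k s (sqrt s *\<^sub>R w)) * H (sqrt s *\<^sub>R w) \<partial>lborel)"
      using True by (intro nn_integral_lborel_scale) simp_all
    also have "(\<integral>\<^sup>+w. ennreal (?k s (sqrt s *\<^sub>R w)) * H (sqrt s *\<^sub>R w) \<partial>lborel) =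
        (\<integral>\<^sup>+w. ennreal (exp (- s) * s powr \<alpha> * s ^ m) * (ennreal (ball_weight \<alpha> w) * H w) \<partial>lborel)"
    proof (rule nn_integral_cong)
      fix w :: "complex ^ 'n"
      have n: "(norm (sqrt s *\<^sub>R w))\<^sup>2 = s * (norm w)\<^sup>2"
        using True by (simp add: power_mult_distrib)
      have lt: "s * (norm w)\<^sup>2 < s \<longleftrightarrow> norm w < 1"
        using True by (simp add: power_less_one_iff abs_square_less_1)
      have "(s - s * (norm w)\<^sup>2) powr \<alpha> = s powr \<alpha> * (1 - (norm w)\<^sup>2) powr \<alpha>" if "norm w < 1"
      proof -
        have "s - s * (norm w)\<^sup>2 = s * (1 - (norm w)\<^sup>2)"
          by (simp add: algebra_simps)
        then show ?thesis
          using True that by (simp add: powr_mult abs_square_le_1 less_imp_le)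
      qed
      then have "?k s (sqrt s *\<^sub>R w) = exp (- s) * s powr \<alpha> * ball_weight \<alpha> w"
        unfolding n lt by (simp add: ball_weight_def)
      moreover have "H (sqrt s *\<^sub>R w) = ennreal (s ^ m) * H w"
        using True hom[of "sqrt s" w] by (simp add: power_mult)
      ultimately show "ennreal (?k s (sqrt s *\<^sub>R w)) * H (sqrt s *\<^sub>R w) =
          ennreal (exp (- s) * s powr \<alpha> * s ^ m) * (ennreal (ball_weight \<alpha> w) * H w)"
        using True by (simp add: ennreal_mult' mult_ac)
    qed
    also have "\<dots> = ennreal (exp (- s) * s powr \<alpha> * s ^ m) * ?I"
      by (rule nn_integral_cmult) measurable
    also have "ennreal (sqrt s ^ (2 * CARD('n))) * (ennreal (exp (- s) * s powr \<alpha> * s ^ m) * ?I) =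
        ennreal (s ^ CARD('n) * (exp (- s) * s powr \<alpha> * s ^ m)) * ?I"
      using True by (simp add: power_mult ennreal_mult' mult.assoc)
    also have "s ^ CARD('n) * (exp (- s) * s powr \<alpha> * s ^ m) =
        indicator {0..} s * s powr (real CARD('n) + 1 + \<alpha> + real m - 1) / exp s"
      using True by (simp add: powr_add powr_realpow exp_minus field_simps)
    finally show ?thesis .
  next
    case False
    have "\<not> (norm w)\<^sup>2 < s" for w :: "complex ^ 'n"
      using False zero_le_power2[of "norm w"] by linarith
    then have "?k s w = 0" for w :: "complex ^ 'n"
      by simp
    then show ?thesis
      using False by (cases "s = 0") (auto simp: indicator_def)
  qed
  have "ennreal (Gamma (\<alpha> + 1)) * (\<integral>\<^sup>+w. ennreal (exp (- (norm w)\<^sup>2)) * H w \<partial>lborel) =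
      (\<integral>\<^sup>+w. (\<integral>\<^sup>+s. ennreal (?k s w) \<partial>lborel) * H w \<partial>lborel)"
    unfolding nn_integral_Gamma_shift[OF \<alpha>] using \<alpha>
    by (subst nn_integral_cmult[symmetric]) (simp_all add: ennreal_mult' ennreal_mult'' mult_ac)
  also have "\<dots> = (\<integral>\<^sup>+w. (\<integral>\<^sup>+s. ennreal (?k s w) * H w \<partial>lborel) \<partial>lborel)"
    by (intro nn_integral_cong nn_integral_multc[symmetric]) measurable
  also have "\<dots> = (\<integral>\<^sup>+s. (\<integral>\<^sup>+w. ennreal (?k s w) * H w \<partial>lborel) \<partial>lborel)"
    by (rule lborel_pair.Fubini') measurable
  also have "\<dots> = (\<integral>\<^sup>+s. ennreal (indicator {0..} s * s powr (real CARD('n) + 1 + \<alpha> + real m - 1) / exp s) * ?I \<partial>lborel)"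
    by (simp only: inner)
  also have "\<dots> = ennreal (Gamma (real CARD('n) + 1 + \<alpha> + real m)) * ?I"
    using \<alpha> by (subst nn_integral_multc) (simp_all add: Gamma_conv_nn_integral_real)
  finally show ?thesis .
qed

text \<open>The superposition identity with \<alpha> = 0 and \<open>H = 1\<close> compares the
  Gaussian with the finite volume of the ball. For general \<alpha> the same identity, read
  backwards, then bounds the weighted volume.\<close>

lemma nn_integral_gauss_finite: "(\<integral>\<^sup>+w. ennreal (exp (- (norm (w :: complex ^ 'n))\<^sup>2)) \<partial>lborel) < \<infinity>"
proof -
  have "ennreal (Gamma (0 + 1)) * (\<integral>\<^sup>+w. ennreal (exp (- (norm (w :: complex ^ 'n))\<^sup>2)) * 1 \<partial>lborel) =
    ennreal (Gamma (real CARD('n) + 1 + 0 + real 0)) * (\<integral>\<^sup>+w. ennreal (ball_weight 0 (w :: complex ^ 'n)) * 1 \<partial>lborel)"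
    by (rule nn_integral_gauss_homogeneous) auto
  also have "(\<integral>\<^sup>+w. ennreal (ball_weight 0 (w :: complex ^ 'n)) * 1 \<partial>lborel) \<le> (\<integral>\<^sup>+w. indicator (ball 0 1) (w :: complex ^ 'n) \<partial>lborel)"
    by (intro nn_integral_mono) (auto simp: ball_weight_def indicator_def)
  also have "(\<integral>\<^sup>+w. indicator (ball 0 1) (w :: complex ^ 'n) \<partial>lborel) = emeasure lborel (ball 0 1 :: (complex ^ 'n) set)"
    by simp
  also have "ennreal (Gamma (real CARD('n) + 1 + 0 + real 0)) * emeasure lborel (ball 0 1 :: (complex ^ 'n) set) < \<infinity>"
    using emeasure_bounded_finite[of "ball 0 1 :: (complex ^ 'n) set"] by (simp add: ennreal_mult_less_top)
  finally show ?thesis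
    by (auto simp: mult_left_mono ennreal_mult_less_top)
qed

lemma nn_integral_ball_weight_finite:
  assumes "\<alpha> > -1"
  shows "(\<integral>\<^sup>+w. ennreal (ball_weight \<alpha> (w :: complex ^ 'n)) \<partial>lborel) < \<infinity>"
proof -
  have eq: "ennreal (Gamma (\<alpha> + 1)) * (\<integral>\<^sup>+w. ennreal (exp (- (norm (w :: complex ^ 'n))\<^sup>2)) * 1 \<partial>lborel) =
    ennreal (Gamma (real CARD('n) + 1 + \<alpha> + real 0)) * (\<integral>\<^sup>+w. ennreal (ball_weight \<alpha> (w :: complex ^ 'n)) * 1 \<partial>lborel)"
    by (rule nn_integral_gauss_homogeneous) (use assms in auto)
  have "ennreal (Gamma (\<alpha> + 1)) * (\<integral>\<^sup>+w. ennreal (exp (- (norm (w :: complex ^ 'n))\<^sup>2)) * 1 \<partial>lborel) < \<infinity>"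
    using nn_integral_gauss_finite[where 'n = 'n] by (simp add: ennreal_mult_less_top)
  moreover have "Gamma (real CARD('n) + 1 + \<alpha> + real 0) > 0"
    using assms by (intro Gamma_real_pos) (simp add: add_pos_nonneg)
  ultimately show ?thesis
    unfolding eq by (auto simp: ennreal_mult_less_top)
qed

lemma integrable_gauss: "integrable lborel (\<lambda>w :: complex ^ 'n. exp (- (norm w)\<^sup>2))"
  using nn_integral_gauss_finite by (intro integrableI_bounded) simp_all

lemma integrable_ball_weight: "\<alpha> > -1 \<Longrightarrow> integrable lborel (ball_weight \<alpha> :: complex ^ 'n \<Rightarrow> real)"
  using nn_integral_ball_weight_finite by (intro integrableI_bounded) (simp_all add: abs_of_nonneg)

lemma integrable_gauss_half: "integrable lborel (\<lambda>w :: complex ^ 'n. exp (- ((norm w)\<^sup>2 / 2)))"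
proof (rule integrableI_bounded)
  have "(\<integral>\<^sup>+w. ennreal (exp (- ((norm (w :: complex ^ 'n))\<^sup>2 / 2))) \<partial>lborel) =
    ennreal (sqrt 2 ^ (2 * CARD('n))) * (\<integral>\<^sup>+w. ennreal (exp (- ((norm (sqrt 2 *\<^sub>R (w :: complex ^ 'n)))\<^sup>2 / 2))) \<partial>lborel)"
    by (rule nn_integral_lborel_scale) simp_all
  also have "\<dots> < \<infinity>"
    using nn_integral_gauss_finite[where 'n = 'n] by (simp add: power_mult_distrib ennreal_mult_less_top)
  finally show "(\<integral>\<^sup>+w. ennreal (norm (exp (- ((norm (w :: complex ^ 'n))\<^sup>2 / 2)))) \<partial>lborel) < \<infinity>"
    by simp
qed simp

lemma integral_gauss_homogeneous_real:
  fixes h :: "complex ^ 'n \<Rightarrow> real"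
  assumes [measurable]: "h \<in> borel_measurable borel" and \<alpha>: "\<alpha> > -1"
    and hom: "\<And>r w. r > 0 \<Longrightarrow> h (r *\<^sub>R w) = r ^ (2 * m) * h w"
    and int: "integrable lborel (\<lambda>w. ball_weight \<alpha> w * h w)"
  shows "integrable lborel (\<lambda>w. exp (- (norm w)\<^sup>2) * h w)"
    and "Gamma (\<alpha> + 1) * (\<integral>w. exp (- (norm w)\<^sup>2) * h w \<partial>lborel) =
      Gamma (real CARD('n) + 1 + \<alpha> + real m) * (\<integral>w. ball_weight \<alpha> w * h w \<partial>lborel)"
proof -
  have G: "Gamma (\<alpha> + 1) > 0" "Gamma (real CARD('n) + 1 + \<alpha> + real m) > 0"
    using \<alpha> by (auto intro!: Gamma_real_pos simp: add_pos_nonneg)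
  have eq: "ennreal (Gamma (\<alpha> + 1)) * (\<integral>\<^sup>+w. ennreal (exp (- (norm w)\<^sup>2) * k w) \<partial>lborel) =
      ennreal (Gamma (real CARD('n) + 1 + \<alpha> + real m)) * (\<integral>\<^sup>+w. ennreal (ball_weight \<alpha> w * k w) \<partial>lborel)"
    if "\<And>r w. r > 0 \<Longrightarrow> k (r *\<^sub>R w) = r ^ (2 * m) * k w" "k \<in> borel_measurable borel" for k :: "complex ^ 'n \<Rightarrow> real"
    using nn_integral_gauss_homogeneous[of "\<lambda>w. ennreal (k w)" \<alpha> m] that \<alpha> by (simp add: ennreal_mult')
  have "(\<integral>\<^sup>+w. ennreal (norm (ball_weight \<alpha> w * h w)) \<partial>lborel) < \<infinity>"
    using int by (simp add: integrable_iff_bounded)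
  then have "ennreal (Gamma (real CARD('n) + 1 + \<alpha> + real m)) * (\<integral>\<^sup>+w. ennreal (ball_weight \<alpha> w * \<bar>h w\<bar>) \<partial>lborel) < \<infinity>"
    by (simp add: abs_mult ennreal_mult_less_top)
  also have "ennreal (Gamma (real CARD('n) + 1 + \<alpha> + real m)) * (\<integral>\<^sup>+w. ennreal (ball_weight \<alpha> w * \<bar>h w\<bar>) \<partial>lborel) =
      ennreal (Gamma (\<alpha> + 1)) * (\<integral>\<^sup>+w. ennreal (exp (- (norm w)\<^sup>2) * \<bar>h w\<bar>) \<partial>lborel)"
    by (rule eq[symmetric]) (simp_all add: hom abs_mult)
  finally have "(\<integral>\<^sup>+w. ennreal (exp (- (norm w)\<^sup>2) * \<bar>h w\<bar>) \<partial>lborel) < \<infinity>"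
    using G by (auto simp: ennreal_mult_less_top)
  then show int': "integrable lborel (\<lambda>w. exp (- (norm w)\<^sup>2) * h w)"
    by (intro integrableI_bounded) (simp_all add: abs_mult)
  have "Gamma (\<alpha> + 1) * enn2real (\<integral>\<^sup>+w. ennreal (exp (- (norm w)\<^sup>2) * k w) \<partial>lborel) =
      Gamma (real CARD('n) + 1 + \<alpha> + real m) * enn2real (\<integral>\<^sup>+w. ennreal (ball_weight \<alpha> w * k w) \<partial>lborel)"
    if "\<And>r w. r > 0 \<Longrightarrow> k (r *\<^sub>R w) = r ^ (2 * m) * k w" "k \<in> borel_measurable borel" for k :: "complex ^ 'n \<Rightarrow> real"
    using arg_cong[OF eq[OF that], of enn2real] G by (simp add: enn2real_mult)
  \<comment> \<open>\<open>ennreal\<close> cuts off negative values, so \<open>h\<close> and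
    \<open>- h\<close> stand for the positive and the negative part.\<close>
  from this[of h] this[of "\<lambda>w. - h w"] hom
  show "Gamma (\<alpha> + 1) * (\<integral>w. exp (- (norm w)\<^sup>2) * h w \<partial>lborel) =
      Gamma (real CARD('n) + 1 + \<alpha> + real m) * (\<integral>w. ball_weight \<alpha> w * h w \<partial>lborel)"
    by (simp add: real_lebesgue_integral_def[OF int] real_lebesgue_integral_def[OF int'] right_diff_distrib)
qed

lemma integral_gauss_homogeneous:
  fixes g :: "complex ^ 'n \<Rightarrow> complex"
  assumes [measurable]: "g \<in> borel_measurable borel" and \<alpha>: "\<alpha> > -1"
    and hom: "\<And>r w. r > 0 \<Longrightarrow> g (r *\<^sub>R w) = of_real (r ^ (2 * m)) * g w"
    and int: "integrable lborel (\<lambda>w. ball_weight \<alpha> w *\<^sub>R g w)"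
  shows "Gamma (\<alpha> + 1) *\<^sub>R (\<integral>w. exp (- (norm w)\<^sup>2) *\<^sub>R g w \<partial>lborel) =
      Gamma (real CARD('n) + 1 + \<alpha> + real m) *\<^sub>R (\<integral>w. ball_weight \<alpha> w *\<^sub>R g w \<partial>lborel)"
proof -
  have intR: "integrable lborel (\<lambda>w. ball_weight \<alpha> w * Re (g w))" and intI: "integrable lborel (\<lambda>w. ball_weight \<alpha> w * Im (g w))"
    using int[THEN integrable_Re] int[THEN integrable_Im] by simp_all
  have [measurable]: "(\<lambda>w. Re (g w)) \<in> borel_measurable borel" "(\<lambda>w. Im (g w)) \<in> borel_measurable borel"
    by measurable
  have homR: "r > 0 \<Longrightarrow> Re (g (r *\<^sub>R w)) = r ^ (2 * m) * Re (g w)" and homI: "r > 0 \<Longrightarrow> Im (g (r *\<^sub>R w)) = r ^ (2 * m) * Im (g w)" for r w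
    by (simp_all add: hom flip: of_real_power)
  note R = integral_gauss_homogeneous_real[OF _ \<alpha> homR intR, simplified]
  note I = integral_gauss_homogeneous_real[OF _ \<alpha> homI intI, simplified]
  have int': "integrable lborel (\<lambda>w. exp (- (norm w)\<^sup>2) *\<^sub>R g w)"
  proof (rule integrable_norm_cancel)
    have "integrable lborel (\<lambda>w. exp (- (norm w)\<^sup>2) * cmod (g w))"
      by (rule integral_gauss_homogeneous_real(1)[OF _ \<alpha>, of _ m])
        (use integrable_norm[OF int] in \<open>simp_all add: hom norm_mult norm_power\<close>)
    then show "integrable lborel (\<lambda>w. norm (exp (- (norm w)\<^sup>2) *\<^sub>R g w))"
      by simp
  qed measurable
  show ?thesis
  proof (rule complex_eqI)
    show "Re (Gamma (\<alpha> + 1) *\<^sub>R (\<integral>w. exp (- (norm w)\<^sup>2) *\<^sub>R g w \<partial>lborel)) =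
      Re (Gamma (real CARD('n) + 1 + \<alpha> + real m) *\<^sub>R (\<integral>w. ball_weight \<alpha> w *\<^sub>R g w \<partial>lborel))"
      using R(2) integral_Re[OF int] integral_Re[OF int'] by simp
    show "Im (Gamma (\<alpha> + 1) *\<^sub>R (\<integral>w. exp (- (norm w)\<^sup>2) *\<^sub>R g w \<partial>lborel)) =
      Im (Gamma (real CARD('n) + 1 + \<alpha> + real m) *\<^sub>R (\<integral>w. ball_weight \<alpha> w *\<^sub>R g w \<partial>lborel))"
      using I(2) integral_Im[OF int] integral_Im[OF int'] by simp
  qed
qed

section \<open>The Gaussian reproducing formula and its transfer to the ball\<close>

lemma norm_hpart_bound:
  assumes f: "f \<in> holomorphic unit_ball"
  obtains M where "M \<ge> 0" "\<And>w. cmod (hpart m f w) \<le> M * norm w ^ m"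
proof -
  obtain M where M: "\<And>v. norm v \<le> 1 / 2 \<Longrightarrow> cmod (f v) \<le> M"
    using holomorphic_bounded_half_ball[OF f] by blast
  have "0 \<le> M"
    using M[of 0] norm_ge_zero[of "f 0"] by (simp del: norm_ge_zero)
  then show ?thesis
    using that[of "M * 2 ^ m"] norm_hpart_le[OF f M, of m] by (simp add: power_mult_distrib mult.assoc)
qed

lemma power_le_fact_exp: "x \<ge> 0 \<Longrightarrow> x ^ m \<le> fact m * exp (x::real)"
proof -
  assume x: "x \<ge> 0"
  have "(\<Sum>n\<in>{m}. x ^ n /\<^sub>R fact n) \<le> (\<Sum>n. x ^ n /\<^sub>R fact n)"
    using x summable_exp_generic[of x] by (intro sum_le_suminf) auto
  then show ?thesis
    by (simp add: exp_def field_simps)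
qed

lemma integral_gauss_hpart_exp:
  fixes f :: "complex ^ 'n \<Rightarrow> complex"
  assumes f: "f \<in> holomorphic unit_ball"
  shows "integrable lborel (\<lambda>w. exp (- (norm w)\<^sup>2) *\<^sub>R (hpart m f w * exp (hinner z w)))"
    and "(\<integral>w. exp (- (norm w)\<^sup>2) *\<^sub>R (hpart m f w * exp (hinner z w)) \<partial>lborel) =
      (\<integral>w. exp (- (norm w)\<^sup>2) \<partial>(lborel :: (complex ^ 'n) measure)) *\<^sub>R hpart m f z"
proof -
  let ?g = "\<lambda>w. exp (- (norm w)\<^sup>2) *\<^sub>R (hpart m f w * exp (hinner z w))"
  have [measurable]: "hpart m f \<in> borel_measurable borel"
    by (rule borel_measurable_continuous_onI[OF continuous_on_hpart[OF f]])
  obtain M where M: "M \<ge> 0" "\<And>w. cmod (hpart m f w) \<le> M * norm w ^ m"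
    using norm_hpart_bound[OF f] by blast
  have bound: "norm (?g w) \<le> (M * fact m * exp ((1 + norm z)\<^sup>2 / 2)) * exp (- ((norm w)\<^sup>2 / 2))" for w
  proof -
    have "norm (?g w) = exp (- (norm w)\<^sup>2) * (cmod (hpart m f w) * exp (Re (hinner z w)))"
      by (simp add: norm_mult)
    also have "\<dots> \<le> exp (- (norm w)\<^sup>2) * ((M * (fact m * exp (norm w))) * exp (norm z * norm w))"
      using M power_le_fact_exp[of "norm w" m] complex_Re_le_cmod[of "hinner z w"] norm_hinner_le[of z w]
      by (intro mult_left_mono mult_mono order_trans[OF M(2)]) auto
    also have "\<dots> = (M * fact m) * exp ((1 + norm z) * norm w - (norm w)\<^sup>2)"
      by (simp add: exp_add exp_diff exp_minus field_simps)
    \<comment> \<open>Completing the square sacrifices half of the Gaussian decay; the other half is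
      the integrable majorant.\<close>
    also have "\<dots> \<le> (M * fact m) * exp ((1 + norm z)\<^sup>2 / 2 + - ((norm w)\<^sup>2 / 2))"
    proof -
      have "0 \<le> ((1 + norm z) - norm w)\<^sup>2"
        by simp
      then have "(1 + norm z) * norm w - (norm w)\<^sup>2 \<le> (1 + norm z)\<^sup>2 / 2 + - ((norm w)\<^sup>2 / 2)"
        by (simp add: power2_eq_square algebra_simps)
      then show ?thesis
        using M(1) by (intro mult_left_mono) auto
    qed
    finally show ?thesis
      unfolding exp_add by (simp add: mult.assoc)
  qed
  show int: "integrable lborel ?g"
    by (rule Bochner_Integration.integrable_bound[OF integrable_mult_right[OF integrable_gauss_half, of "M * fact m * exp ((1 + norm z)\<^sup>2 / 2)"]])
      (measurable, use bound M(1) in \<open>simp add: abs_mult\<close>)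
  let ?F = "\<lambda>w. hpart m f (z + w) * exp (- hinner w z)"
  \<comment> \<open>The translated exponent \<open>- |z + w|^2 + <z, z + w>\<close> collapses to
    \<open>- |w|^2 - <w, z>\<close>: a radial Gaussian times a function holomorphic in
    \<open>w\<close>.\<close>
  have shift: "?g (z + w) = exp (- (norm w)\<^sup>2) *\<^sub>R ?F w" for w
  proof -
    have "complex_of_real ((norm (z + w))\<^sup>2) = hinner (z + w) (z + w)"
      by (rule hinner_self[symmetric])
    also have "\<dots> = hinner z (z + w) + hinner w z + of_real ((norm w)\<^sup>2)"
      by (simp only: hinner_add_left hinner_add_right[of w] hinner_self[of w] add.assoc)
    finally have "complex_of_real (- (norm (z + w))\<^sup>2) + hinner z (z + w) = of_real (- (norm w)\<^sup>2) + - hinner w z"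
      by simp
    then have "exp (complex_of_real (- (norm (z + w))\<^sup>2) + hinner z (z + w)) = exp (of_real (- (norm w)\<^sup>2) + - hinner w z)"
      by (rule arg_cong)
    then have "complex_of_real (exp (- (norm (z + w))\<^sup>2)) * exp (hinner z (z + w)) = of_real (exp (- (norm w)\<^sup>2)) * exp (- hinner w z)"
      unfolding exp_add exp_of_real .
    then show ?thesis
      by (simp add: scaleR_conv_of_real mult_ac)
  qed
  have tr: "integrable (distr lborel borel ((+) z)) ?g"
    using int by (simp add: lborel_distr_plus)
  have "(\<integral>w. ?g w \<partial>lborel) = (\<integral>w. ?g w \<partial>distr lborel borel ((+) z))"
    by (simp add: lborel_distr_plus)
  also have "\<dots> = (\<integral>w. ?g (z + w) \<partial>lborel)"
    by (rule integral_distr) measurable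
  \<comment> \<open>The dummy zeroth power fits the coefficient extraction with
    \<open>m = 0\<close>, which is the mean value property: \<open>hpart 0\<close> is the value at
    the centre.\<close>
  also have "\<dots> = (\<integral>w. exp (- (norm w)\<^sup>2) *\<^sub>R (?F w * hinner z w ^ 0) \<partial>lborel)"
    by (simp add: shift)
  also have "\<dots> = (\<integral>w. exp (- (norm w)\<^sup>2) *\<^sub>R (hpart 0 ?F w * hinner z w ^ 0) \<partial>lborel)"
  proof (rule integral_rotation_coeff)
    show "integrable lborel (\<lambda>w. exp (- (norm w)\<^sup>2) *\<^sub>R (?F w * hinner z w ^ 0))"
      using integrable_distr[OF _ tr] by (simp add: shift)
    fix w
    have "(\<lambda>t. ?F (t *s w)) holomorphic_on UNIV"
      unfolding hinner_scale_left by (intro holomorphic_intros holomorphic_line_hpart f)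
    then show "continuous_on (cball 0 1) (\<lambda>t. ?F (t *s w)) \<and> (\<lambda>t. ?F (t *s w)) holomorphic_on ball 0 1"
      by (meson continuous_on_subset holomorphic_on_imp_continuous_on holomorphic_on_subset subset_UNIV)
  qed (simp add: norm_vector_scalar_mult)
  also have "\<dots> = (\<integral>w. exp (- (norm w)\<^sup>2) *\<^sub>R hpart m f z \<partial>(lborel :: (complex ^ 'n) measure))"
    by simp
  also have "\<dots> = (\<integral>w. exp (- (norm w)\<^sup>2) \<partial>(lborel :: (complex ^ 'n) measure)) *\<^sub>R hpart m f z"
    by (rule integral_scaleR_left) (rule integrable_gauss)
  finally show "(\<integral>w. ?g w \<partial>lborel) = (\<integral>w. exp (- (norm w)\<^sup>2) \<partial>(lborel :: (complex ^ 'n) measure)) *\<^sub>R hpart m f z" .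
qed

definition ball_mass :: "'n::finite itself \<Rightarrow> real \<Rightarrow> real"
  where "ball_mass _ \<alpha> = (\<integral>w. ball_weight \<alpha> (w :: complex ^ 'n) \<partial>lborel)"

lemma ball_mass_gauss:
  assumes "\<alpha> > -1"
  shows "Gamma (real CARD('n) + 1 + \<alpha>) * ball_mass TYPE('n) \<alpha> =
    Gamma (\<alpha> + 1) * (\<integral>w. exp (- (norm w)\<^sup>2) \<partial>(lborel :: (complex ^ 'n) measure))"
  using integral_gauss_homogeneous_real(2)[of "\<lambda>w::complex ^ 'n. 1" \<alpha> 0] assms integrable_ball_weight[OF assms, where 'n = 'n]
  by (simp add: ball_mass_def)

lemma ball_mass_pos: "\<alpha> > -1 \<Longrightarrow> ball_mass TYPE('n::finite) \<alpha> > 0"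
proof -
  assume \<alpha>: "\<alpha> > -1"
  have "(\<integral>w. ball_weight \<alpha> w \<partial>(lborel :: (complex ^ 'n) measure)) \<noteq> 0"
  proof
    assume "(\<integral>w. ball_weight \<alpha> w \<partial>(lborel :: (complex ^ 'n) measure)) = 0"
    then have "AE w in lborel. ball_weight \<alpha> (w :: complex ^ 'n) = 0"
      using integrable_ball_weight[OF \<alpha>] by (subst (asm) integral_nonneg_eq_0_iff_AE) auto
    then have "AE w in lborel. (w :: complex ^ 'n) \<notin> ball 0 1"
    proof eventually_elim
      case (elim w)
      then show ?case
        using power_strict_mono[of "norm w" 1 2] by (auto simp: ball_weight_def split: if_splits)
    qed
    then have "emeasure lborel (ball 0 1 :: (complex ^ 'n) set) = 0"
      by (subst (asm) AE_iff_measurable[where N = "ball 0 1"]) auto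
    then show False
      using unit_ball_vol_pos[of "real CARD('n) * 2"] by (simp add: emeasure_ball)
  qed
  then show ?thesis
    unfolding ball_mass_def by (simp add: less_le)
qed

text \<open>The integrand has real degree \<open>2 m\<close>, so the ball moment is a Gamma quotient
  times a Gaussian moment. The latter is \<open>fact m\<close> times the integral against
  \<open>exp (hinner z w)\<close>, which reproduces \<open>hpart m f z\<close>. The resulting
  constant is the mass times the inverse of the \<open>m\<close>-th coefficient of the Bergman
  kernel.\<close>

lemma integral_hpart_moment:
  fixes f :: "complex ^ 'n \<Rightarrow> complex"
  assumes f: "f \<in> holomorphic unit_ball" and \<alpha>: "\<alpha> > -1"
  shows "(\<integral>w. ball_weight \<alpha> w *\<^sub>R (hpart m f w * hinner z w ^ m) \<partial>lborel) =
    of_real (fact m * ball_mass TYPE('n) \<alpha> / pochhammer (real CARD('n) + 1 + \<alpha>) m) * hpart m f z"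
proof -
  let ?N = "real CARD('n) + 1 + \<alpha>"
  have N: "?N > 0"
    using \<alpha> by (simp add: add_pos_nonneg)
  have [measurable]: "hpart m f \<in> borel_measurable borel"
    by (rule borel_measurable_continuous_onI[OF continuous_on_hpart[OF f]])
  obtain M where M: "M \<ge> 0" "\<And>w. cmod (hpart m f w) \<le> M * norm w ^ m"
    using norm_hpart_bound[OF f] by blast
  have int: "integrable lborel (\<lambda>w. ball_weight \<alpha> w *\<^sub>R (hpart m f w * hinner z w ^ m))"
  proof (rule Bochner_Integration.integrable_bound[OF integrable_mult_right[OF integrable_ball_weight[OF \<alpha>], of "M * norm z ^ m"]])
    show "AE w in lborel. norm (ball_weight \<alpha> w *\<^sub>R (hpart m f w * hinner z w ^ m)) \<le> norm (M * norm z ^ m * ball_weight \<alpha> w)"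
    proof (intro AE_I2)
      fix w :: "complex ^ 'n"
      show "norm (ball_weight \<alpha> w *\<^sub>R (hpart m f w * hinner z w ^ m)) \<le> norm (M * norm z ^ m * ball_weight \<alpha> w)"
      proof (cases "norm w < 1")
        case True
        have "norm w ^ m \<le> 1"
          using True by (intro power_le_one) auto
        then have "M * norm w ^ m \<le> M * 1"
          using M by (intro mult_left_mono) auto
        then have "cmod (hpart m f w) \<le> M"
          using M(2)[of w] by simp
        moreover have "cmod (hinner z w) \<le> norm z"
          using norm_hinner_le_left[of w z] True by simp
        ultimately have "cmod (hpart m f w) * cmod (hinner z w) ^ m \<le> M * norm z ^ m"
          using M by (intro mult_mono power_mono) auto
        then have "ball_weight \<alpha> w * (cmod (hpart m f w) * cmod (hinner z w) ^ m) \<le> ball_weight \<alpha> w * (M * norm z ^ m)"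
          by (intro mult_left_mono) auto
        then show ?thesis
          using M(1) by (simp add: norm_mult norm_power abs_mult mult_ac)
      qed (simp add: ball_weight_def)
    qed
  qed measurable
  have "Gamma (\<alpha> + 1) *\<^sub>R (\<integral>w. exp (- (norm w)\<^sup>2) *\<^sub>R (hpart m f w * hinner z w ^ m) \<partial>lborel) =
      Gamma (?N + real m) *\<^sub>R (\<integral>w. ball_weight \<alpha> w *\<^sub>R (hpart m f w * hinner z w ^ m) \<partial>lborel)"
  proof (rule integral_gauss_homogeneous[OF _ \<alpha> _ int])
    fix r :: real and w :: "complex ^ 'n"
    have "r *\<^sub>R w = complex_of_real r *s w"
      unfolding vec_eq_iff vector_scaleR_component vector_smult_component by (simp add: scaleR_conv_of_real)
    then show "hpart m f (r *\<^sub>R w) * hinner z (r *\<^sub>R w) ^ m = of_real (r ^ (2 * m)) * (hpart m f w * hinner z w ^ m)"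
      by (simp add: hpart_scale[OF f] hinner_scale_right power_mult_distrib power_mult power2_eq_square)
  qed measurable
  also have "(\<integral>w. exp (- (norm w)\<^sup>2) *\<^sub>R (hpart m f w * hinner z w ^ m) \<partial>lborel) =
      fact m * (\<integral>w. exp (- (norm w)\<^sup>2) *\<^sub>R (hpart m f w * exp (hinner z w)) \<partial>lborel)"
    by (subst integral_rotation_exp[OF _ hpart_scale[OF f] integral_gauss_hpart_exp(1)[OF f]])
      (simp_all add: norm_vector_scalar_mult)
  also have "\<dots> = fact m * ((\<integral>w. exp (- (norm w)\<^sup>2) \<partial>(lborel :: (complex ^ 'n) measure)) *\<^sub>R hpart m f z)"
    by (simp only: integral_gauss_hpart_exp(2)[OF f])
  finally have "Gamma (?N + real m) *\<^sub>R (\<integral>w. ball_weight \<alpha> w *\<^sub>R (hpart m f w * hinner z w ^ m) \<partial>lborel) =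
      (fact m * (Gamma (\<alpha> + 1) * (\<integral>w. exp (- (norm w)\<^sup>2) \<partial>(lborel :: (complex ^ 'n) measure)))) *\<^sub>R hpart m f z"
    by (simp add: scaleR_conv_of_real mult_ac)
  also have "Gamma (\<alpha> + 1) * (\<integral>w. exp (- (norm w)\<^sup>2) \<partial>(lborel :: (complex ^ 'n) measure)) = Gamma ?N * ball_mass TYPE('n) \<alpha>"
    by (rule ball_mass_gauss[OF \<alpha>, symmetric])
  finally have eq: "Gamma (?N + real m) *\<^sub>R (\<integral>w. ball_weight \<alpha> w *\<^sub>R (hpart m f w * hinner z w ^ m) \<partial>lborel) =
      (fact m * (Gamma ?N * ball_mass TYPE('n) \<alpha>)) *\<^sub>R hpart m f z" .
  have G: "Gamma (?N + real m) > 0" "Gamma ?N > 0"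
    using N by (auto intro!: Gamma_real_pos add_pos_nonneg)
  have poch: "pochhammer ?N m = Gamma (?N + real m) / Gamma ?N"
    using N by (intro pochhammer_Gamma) (auto elim!: nonpos_Ints_cases')
  have "(\<integral>w. ball_weight \<alpha> w *\<^sub>R (hpart m f w * hinner z w ^ m) \<partial>lborel) =
      inverse (Gamma (?N + real m)) *\<^sub>R (Gamma (?N + real m) *\<^sub>R (\<integral>w. ball_weight \<alpha> w *\<^sub>R (hpart m f w * hinner z w ^ m) \<partial>lborel))"
    using G by simp
  also have "\<dots> = of_real (fact m * ball_mass TYPE('n) \<alpha> / pochhammer ?N m) * hpart m f z"
    unfolding eq poch using G by (simp add: scaleR_conv_of_real field_simps)
  finally show ?thesis .
qed

section \<open>The Bergman kernel and its reproducing property\<close>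

text \<open>The exponent is free because the orders \<open>N + j\<close> occur for every
  \<open>j\<close>. The form as an inverse agrees literally with the kernel in
  \<open>little_hankel\<close>.\<close>

definition bergman_kernel :: "real \<Rightarrow> complex ^ 'n \<Rightarrow> complex ^ 'n \<Rightarrow> complex"
  where "bergman_kernel s z w = inverse ((1 - hinner z w) powr complex_of_real s)"

lemma norm_bergman_kernel: "cmod (bergman_kernel s z w) = cmod (1 - hinner z w) powr (- s)"
  by (simp add: bergman_kernel_def norm_inverse norm_powr_real_powr' powr_minus)

lemma one_minus_hinner_bounds:
  assumes "norm z < 1" "norm w \<le> 1"
  shows "1 - norm z \<le> cmod (1 - hinner z w)" "cmod (1 - hinner z w) \<le> 2" "Re (1 - hinner z w) > 0" "1 - hinner z w \<noteq> 0"
proof -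
  have h: "cmod (hinner z w) \<le> norm z"
    using norm_hinner_le_left[of w z] assms by simp
  show "1 - norm z \<le> cmod (1 - hinner z w)"
    using norm_triangle_ineq2[of 1 "hinner z w"] h by simp
  show "cmod (1 - hinner z w) \<le> 2"
    using norm_triangle_ineq4[of 1 "hinner z w"] h assms by simp
  show "Re (1 - hinner z w) > 0"
    using complex_Re_le_cmod[of "hinner z w"] h assms by simp
  then show "1 - hinner z w \<noteq> 0"
    by auto
qed

lemma norm_bergman_kernel_le:
  assumes "norm z < 1" "norm w \<le> 1" "s \<ge> 0"
  shows "cmod (bergman_kernel s z w) \<le> (1 - norm z) powr (- s)"
  unfolding norm_bergman_kernel
  using one_minus_hinner_bounds[OF assms(1,2)] assms by (intro powr_mono2') auto

text \<open>\<open>1 - hinner z w\<close> has positive real part, and off the negative axis the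
  principal power commutes with conjugation.\<close>

lemma cnj_bergman_kernel:
  assumes "norm z < 1" "norm w \<le> 1"
  shows "cnj (bergman_kernel s z w) = bergman_kernel s w z"
proof -
  have "cnj ((1 - hinner z w) powr complex_of_real s) = cnj (1 - hinner z w) powr cnj (complex_of_real s)"
    using one_minus_hinner_bounds(3)[OF assms] by (intro cnj_powr) simp
  then show ?thesis
    by (simp add: bergman_kernel_def cnj_hinner)
qed

lemma bergman_kernel_Suc:
  assumes "norm z < 1" "norm w \<le> 1"
  shows "bergman_kernel (s + 1) z w = bergman_kernel s z w / (1 - hinner z w)"
  using one_minus_hinner_bounds(4)[OF assms] by (simp add: bergman_kernel_def powr_add field_simps)

text \<open>Binomial series with exponent \<open>- s\<close>; the signs of the generalized binomial
  coefficient and of \<open>(- hinner z w) ^ m\<close> cancel.\<close>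

lemma bergman_kernel_sums:
  assumes "norm z < 1" "norm w \<le> 1"
  shows "(\<lambda>m. of_real (pochhammer s m / fact m) * hinner z w ^ m) sums bergman_kernel s z w"
proof -
  have "(\<lambda>m. ((- complex_of_real s) gchoose m) * (- hinner z w) ^ m) sums (1 + (- hinner z w)) powr (- complex_of_real s)"
    using norm_hinner_less_1[OF assms] by (intro gen_binomial_complex) simp
  moreover have "((- complex_of_real s) gchoose m) * (- hinner z w) ^ m = of_real (pochhammer s m / fact m) * hinner z w ^ m" for m
  proof -
    have "((- complex_of_real s) gchoose m) * (- hinner z w) ^ m =
        ((-1) ^ m * (-1) ^ m) * (pochhammer (complex_of_real s) m / fact m) * hinner z w ^ m"
      by (simp add: gbinomial_pochhammer power_minus[of "hinner z w"] mult_ac)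
    also have "(-1) ^ m * (-1) ^ m = (1 :: complex)"
      by (simp flip: power_mult_distrib)
    finally show ?thesis
      by (simp add: pochhammer_of_real)
  qed
  ultimately show ?thesis
    by (simp add: bergman_kernel_def powr_minus)
qed

lemma binomial_series_summable:
  assumes "0 \<le> (x::real)" "x < 1"
  shows "summable (\<lambda>m. pochhammer s m / fact m * x ^ m)"
proof -
  have "(\<lambda>m. ((- s) gchoose m) * (- x) ^ m) sums (1 + (- x)) powr (- s)"
    using assms by (intro gen_binomial_real) simp
  moreover have "((- s) gchoose m) * (- x) ^ m = pochhammer s m / fact m * x ^ m" for m
  proof -
    have "((- s) gchoose m) * (- x) ^ m = ((-1) ^ m * (-1) ^ m) * (pochhammer s m / fact m) * x ^ m"
      by (simp add: gbinomial_pochhammer power_minus[of x] mult_ac)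
    then show ?thesis
      by (simp flip: power_mult_distrib)
  qed
  ultimately show ?thesis
    by (auto simp: sums_iff)
qed

lemma continuous_on_bergman_kernel [continuous_intros]:
  fixes f g :: "'a::topological_space \<Rightarrow> complex ^ 'n"
  assumes "continuous_on S f" "continuous_on S g" "\<And>x. x \<in> S \<Longrightarrow> norm (f x) < 1 \<and> norm (g x) \<le> 1"
  shows "continuous_on S (\<lambda>x. bergman_kernel s (f x) (g x))"
  unfolding bergman_kernel_def
proof (rule continuous_on_inverse)
  show "\<forall>x\<in>S. (1 - hinner (f x) (g x)) powr complex_of_real s \<noteq> 0"
    using one_minus_hinner_bounds(4) assms(3) by auto
  show "continuous_on S (\<lambda>x. (1 - hinner (f x) (g x)) powr complex_of_real s)"
  proof (rule continuous_on_powr_complex)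
    show "S \<subseteq> {x. 0 \<le> Re (1 - hinner (f x) (g x)) \<or> Im (1 - hinner (f x) (g x)) \<noteq> 0}"
      using one_minus_hinner_bounds(3) assms(3) by (force intro: less_imp_le)
    show "0 < Re (complex_of_real s)" if "x \<in> S" "1 - hinner (f x) (g x) = 0" for x
      using one_minus_hinner_bounds(4)[of "f x" "g x"] assms(3)[OF that(1)] that(2) by auto
  qed (intro continuous_intros assms)+
qed

text \<open>Against \<open>hinner z w ^ m\<close> only the \<open>m\<close>-th homogeneous part of
  \<open>f\<close> survives rotation. The geometric decay in the third claim supplies the
  summability for exchanging series and integral.\<close>

lemma integral_moment:
  fixes f :: "complex ^ 'n \<Rightarrow> complex"
  assumes f: "f \<in> holomorphic unit_ball" and \<alpha>: "\<alpha> > -1"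
    and int: "integrable lborel (\<lambda>w. ball_weight \<alpha> w *\<^sub>R f w)" and z: "norm z < 1"
  shows "integrable lborel (\<lambda>w. ball_weight \<alpha> w *\<^sub>R (f w * hinner z w ^ m))"
    and "(\<integral>w. ball_weight \<alpha> w *\<^sub>R (f w * hinner z w ^ m) \<partial>lborel) =
      of_real (fact m * ball_mass TYPE('n) \<alpha> / pochhammer (real CARD('n) + 1 + \<alpha>) m) * hpart m f z"
    and "(\<integral>w. norm (ball_weight \<alpha> w *\<^sub>R (f w * hinner z w ^ m)) \<partial>lborel) \<le>
      norm z ^ m * (\<integral>w. norm (ball_weight \<alpha> w *\<^sub>R f w) \<partial>lborel)"
proof -
  have [measurable]: "(\<lambda>w. ball_weight \<alpha> w *\<^sub>R f w) \<in> borel_measurable borel"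
    using int by (simp add: borel_measurable_integrable)
  have bound: "norm (ball_weight \<alpha> w *\<^sub>R (f w * hinner z w ^ m)) \<le> norm z ^ m * norm (ball_weight \<alpha> w *\<^sub>R f w)" for w
  proof (cases "norm w < 1")
    case True
    then have "cmod (hinner z w) \<le> norm z"
      using norm_hinner_le_left[of w z] by simp
    then have "cmod (hinner z w) ^ m \<le> norm z ^ m"
      by (intro power_mono) auto
    then have "(ball_weight \<alpha> w * cmod (f w)) * cmod (hinner z w) ^ m \<le> (ball_weight \<alpha> w * cmod (f w)) * norm z ^ m"
      by (intro mult_left_mono) auto
    then show ?thesis
      by (simp add: norm_mult norm_power mult_ac)
  qed (simp add: ball_weight_def)
  have eq: "(\<lambda>w. ball_weight \<alpha> w *\<^sub>R (f w * hinner z w ^ m)) = (\<lambda>w. (ball_weight \<alpha> w *\<^sub>R f w) * hinner z w ^ m)"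
    by simp
  have int2: "integrable lborel (\<lambda>w. norm z ^ m * norm (ball_weight \<alpha> w *\<^sub>R f w))"
    by (rule integrable_mult_right) (rule integrable_norm[OF int])
  show int3: "integrable lborel (\<lambda>w. ball_weight \<alpha> w *\<^sub>R (f w * hinner z w ^ m))"
  proof (rule Bochner_Integration.integrable_bound[OF int2])
    show "(\<lambda>w. ball_weight \<alpha> w *\<^sub>R (f w * hinner z w ^ m)) \<in> borel_measurable lborel"
      unfolding eq by measurable
    show "AE w in lborel. norm (ball_weight \<alpha> w *\<^sub>R (f w * hinner z w ^ m)) \<le> norm (norm z ^ m * norm (ball_weight \<alpha> w *\<^sub>R f w))"
      using bound by (intro AE_I2) (simp add: abs_mult)
  qed
  have "(\<integral>w. ball_weight \<alpha> w *\<^sub>R (f w * hinner z w ^ m) \<partial>lborel) = (\<integral>w. ball_weight \<alpha> w *\<^sub>R (hpart m f w * hinner z w ^ m) \<partial>lborel)"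
  proof (rule integral_rotation_coeff[OF ball_weight_rotation _ int3])
    fix w :: "complex ^ 'n"
    assume "ball_weight \<alpha> w \<noteq> 0"
    then have w: "norm w < 1"
      by (simp add: ball_weight_def split: if_splits)
    define r where "r = 2 / (1 + norm w)"
    have r: "r > 1" "r * norm w \<le> 1"
      using w by (simp_all add: r_def field_simps add_pos_nonneg)
    have hol: "(\<lambda>t. f (t *s w)) holomorphic_on ball 0 r"
      using holomorphic_ray[OF f r(2)] .
    show "continuous_on (cball 0 1) (\<lambda>t. f (t *s w)) \<and> (\<lambda>t. f (t *s w)) holomorphic_on ball 0 1"
      using r by (auto intro!: holomorphic_on_subset[OF hol] continuous_on_subset[OF holomorphic_on_imp_continuous_on[OF hol]])
  qed
  also have "\<dots> = of_real (fact m * ball_mass TYPE('n) \<alpha> / pochhammer (real CARD('n) + 1 + \<alpha>) m) * hpart m f z"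
    by (rule integral_hpart_moment[OF f \<alpha>])
  finally show "(\<integral>w. ball_weight \<alpha> w *\<^sub>R (f w * hinner z w ^ m) \<partial>lborel) =
      of_real (fact m * ball_mass TYPE('n) \<alpha> / pochhammer (real CARD('n) + 1 + \<alpha>) m) * hpart m f z" .
  have "(\<integral>w. norm (ball_weight \<alpha> w *\<^sub>R (f w * hinner z w ^ m)) \<partial>lborel) \<le> (\<integral>w. norm z ^ m * norm (ball_weight \<alpha> w *\<^sub>R f w) \<partial>lborel)"
    by (rule integral_mono[OF integrable_norm[OF int3] int2 bound])
  then show "(\<integral>w. norm (ball_weight \<alpha> w *\<^sub>R (f w * hinner z w ^ m)) \<partial>lborel) \<le>
      norm z ^ m * (\<integral>w. norm (ball_weight \<alpha> w *\<^sub>R f w) \<partial>lborel)"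
    by simp
qed

text \<open>Expanding the kernel, each coefficient cancels the constant of the corresponding moment,
  which leaves the homogeneous expansion of \<open>f\<close> at \<open>z\<close> times the
  mass.\<close>

lemma bergman_reproducing_lborel:
  fixes f :: "complex ^ 'n \<Rightarrow> complex"
  assumes f: "f \<in> holomorphic unit_ball" and \<alpha>: "\<alpha> > -1"
    and int: "integrable lborel (\<lambda>w. ball_weight \<alpha> w *\<^sub>R f w)" and z: "norm z < 1"
  shows "(\<integral>w. ball_weight \<alpha> w *\<^sub>R (f w * bergman_kernel (real CARD('n) + 1 + \<alpha>) z w) \<partial>lborel) =
    ball_mass TYPE('n) \<alpha> *\<^sub>R f z"
proof -
  let ?N = "real CARD('n) + 1 + \<alpha>"
  let ?a = "\<lambda>m. pochhammer ?N m / fact m"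
  have N: "?N > 0"
    using \<alpha> by (simp add: add_pos_nonneg)
  have poch: "pochhammer ?N m > 0" for m
    using N by (rule pochhammer_pos)
  define h where "h m w = ?a m *\<^sub>R (ball_weight \<alpha> w *\<^sub>R (f w * hinner z w ^ m))" for m w
  let ?A = "\<integral>w. norm (ball_weight \<alpha> w *\<^sub>R f w) \<partial>lborel"
  have sums: "(\<lambda>m. h m w) sums (ball_weight \<alpha> w *\<^sub>R (f w * bergman_kernel ?N z w))" for w
  proof (cases "norm w < 1")
    case True
    have "(\<lambda>m. h m w) = (\<lambda>m. (ball_weight \<alpha> w *\<^sub>R f w) * (of_real (?a m) * hinner z w ^ m))"
      unfolding h_def by (simp add: scaleR_conv_of_real mult_ac)
    then show ?thesis
      using sums_mult[OF bergman_kernel_sums[OF z less_imp_le[OF True], of ?N], of "ball_weight \<alpha> w *\<^sub>R f w"] by simp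
  qed (simp add: h_def ball_weight_def)
  have hint: "integrable lborel (h m)" for m
    unfolding h_def by (rule integrable_scaleR_right) (rule integral_moment(1)[OF f \<alpha> int z])
  have norm_int: "(\<integral>w. norm (h m w) \<partial>lborel) \<le> ?a m * norm z ^ m * ?A" for m
  proof -
    have "(\<integral>w. norm (h m w) \<partial>lborel) = ?a m * (\<integral>w. norm (ball_weight \<alpha> w *\<^sub>R (f w * hinner z w ^ m)) \<partial>lborel)"
      unfolding h_def using poch[of m] by (simp add: abs_mult mult.assoc)
    also have "\<dots> \<le> ?a m * (norm z ^ m * ?A)"
      using poch[of m] by (intro mult_left_mono integral_moment(3)[OF f \<alpha> int z]) (simp add: less_imp_le)
    finally show ?thesis
      by simp
  qed
  have sum_a: "summable (\<lambda>m. ?a m * norm z ^ m)"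
    using z by (intro binomial_series_summable) auto
  have summ_norm: "summable (\<lambda>m. norm (h m w))" for w
  proof (rule summable_comparison_test')
    show "summable (\<lambda>m. norm (ball_weight \<alpha> w *\<^sub>R f w) * (?a m * norm z ^ m))"
      by (rule summable_mult[OF sum_a])
    show "norm (norm (h m w)) \<le> norm (ball_weight \<alpha> w *\<^sub>R f w) * (?a m * norm z ^ m)" if "m \<ge> 0" for m
    proof (cases "norm w < 1")
      case True
      then have "cmod (hinner z w) \<le> norm z"
        using norm_hinner_le_left[of w z] by simp
      then have "cmod (hinner z w) ^ m \<le> norm z ^ m"
        by (intro power_mono) auto
      then have "(?a m * (ball_weight \<alpha> w * cmod (f w))) * cmod (hinner z w) ^ m \<le> (?a m * (ball_weight \<alpha> w * cmod (f w))) * norm z ^ m"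
        using poch[of m] by (intro mult_left_mono) (auto intro!: mult_nonneg_nonneg divide_nonneg_nonneg less_imp_le)
      then show ?thesis
        using poch[of m] by (simp add: h_def norm_mult norm_power mult_ac)
    qed (simp add: h_def ball_weight_def)
  qed
  have summ_int: "summable (\<lambda>m. \<integral>w. norm (h m w) \<partial>lborel)"
  proof (rule summable_comparison_test')
    show "summable (\<lambda>m. ?a m * norm z ^ m * ?A)"
      by (rule summable_mult2[OF sum_a])
    show "norm (\<integral>w. norm (h m w) \<partial>lborel) \<le> ?a m * norm z ^ m * ?A" if "m \<ge> 0" for m
      using norm_int[of m] by simp
  qed
  have "(\<integral>w. ball_weight \<alpha> w *\<^sub>R (f w * bergman_kernel ?N z w) \<partial>lborel) = (\<integral>w. (\<Sum>m. h m w) \<partial>lborel)"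
    using sums by (simp add: sums_iff)
  also have "\<dots> = (\<Sum>m. \<integral>w. h m w \<partial>lborel)"
    by (rule integral_suminf[OF hint _ summ_int]) (simp add: summ_norm)
  also have "\<dots> = (\<Sum>m. of_real (ball_mass TYPE('n) \<alpha>) * hpart m f z)"
  proof (rule suminf_cong)
    fix m
    show "(\<integral>w. h m w \<partial>lborel) = of_real (ball_mass TYPE('n) \<alpha>) * hpart m f z"
      unfolding h_def using poch[of m]
      by (simp only: integral_scaleR_right integral_moment(2)[OF f \<alpha> int z]) (simp add: scaleR_conv_of_real flip: of_real_mult of_real_divide mult.assoc)
  qed
  also have "\<dots> = of_real (ball_mass TYPE('n) \<alpha>) * f z"
    using sums_mult[OF hpart_sums[OF f z], of "of_real (ball_mass TYPE('n) \<alpha>)"] by (simp add: sums_iff)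
  finally show ?thesis
    by (simp add: scaleR_conv_of_real)
qed

section \<open>The measures \<open>\<nu>\<^sub>\<alpha>\<close>\<close>

definition nu_factor :: "'n::finite itself \<Rightarrow> real \<Rightarrow> real"
  where "nu_factor _ \<alpha> = nu_weight TYPE('n) \<alpha> / measure lborel (unit_ball :: (complex ^ 'n) set)"

lemma nu_weight_pos: "\<alpha> > -1 \<Longrightarrow> nu_weight TYPE('n::finite) \<alpha> > 0"
  unfolding nu_weight_def by (intro divide_pos_pos mult_pos_pos Gamma_real_pos) (auto simp: add_pos_nonneg)

lemma measure_unit_ball_pos: "measure lborel (unit_ball :: (complex ^ 'n) set) > 0"
  using unit_ball_vol_pos[of "real CARD('n) * 2"] by (simp add: content_ball)

lemma nu_factor_pos: "\<alpha> > -1 \<Longrightarrow> nu_factor TYPE('n::finite) \<alpha> > 0"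
  unfolding nu_factor_def using measure_unit_ball_pos by (intro divide_pos_pos nu_weight_pos)

lemma space_nu [simp]: "space (nu \<alpha>) = unit_ball"
  by (simp add: nu_def normalized_lebesgue_def space_restrict_space)

lemma sets_nu [simp, measurable_cong]: "sets (nu \<alpha>) = sets (restrict_space borel unit_ball)"
  by (simp add: nu_def normalized_lebesgue_def sets_restrict_space)

text \<open>Restriction, normalization and density of the definition collapse into one density, with
  both normalizing constants collected in \<open>nu_factor\<close>.\<close>

lemma nu_conv_density:
  assumes "\<alpha> > -1"
  shows "(nu \<alpha> :: (complex ^ 'n) measure) = density (restrict_space lborel unit_ball)
    (\<lambda>w. ennreal (nu_factor TYPE('n) \<alpha> * ball_weight \<alpha> w))"
proof -
  let ?R = "restrict_space lborel (unit_ball :: (complex ^ 'n) set)"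
  have em: "emeasure ?R unit_ball = ennreal (measure lborel (unit_ball :: (complex ^ 'n) set))"
  proof -
    have "emeasure ?R unit_ball = emeasure lborel (unit_ball :: (complex ^ 'n) set)"
      by (simp add: emeasure_restrict_space)
    also have "\<dots> = ennreal (measure lborel (unit_ball :: (complex ^ 'n) set))"
      using emeasure_bounded_finite[of "unit_ball :: (complex ^ 'n) set"]
      by (intro emeasure_eq_ennreal_measure) simp
    finally show ?thesis .
  qed
  have [measurable]: "(\<lambda>z. ennreal (nu_weight TYPE('n) \<alpha> * (1 - (norm z)\<^sup>2) powr \<alpha>)) \<in> borel_measurable ?R"
    by (rule measurable_restrict_space1) simp
  have S[measurable]: "unit_ball \<in> sets ?R"
    using sets.top[of ?R] by (simp add: space_restrict_space)
  have "(nu \<alpha> :: (complex ^ 'n) measure) = density ?R (\<lambda>w. indicator unit_ball w / emeasure ?R unit_ball *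
      ennreal (nu_weight TYPE('n) \<alpha> * (1 - (norm w)\<^sup>2) powr \<alpha>))"
    unfolding nu_def normalized_lebesgue_def uniform_measure_def
    by (intro density_density_eq) measurable
  also have "\<dots> = density ?R (\<lambda>w. ennreal (nu_factor TYPE('n) \<alpha> * ball_weight \<alpha> w))"
  proof (rule density_cong)
    show "AE w in ?R. indicator unit_ball w / emeasure ?R unit_ball * ennreal (nu_weight TYPE('n) \<alpha> * (1 - (norm w)\<^sup>2) powr \<alpha>) =
        ennreal (nu_factor TYPE('n) \<alpha> * ball_weight \<alpha> w)"
    proof (rule AE_I2)
      fix w assume "w \<in> space ?R"
      then have w: "norm w < 1"
        by (simp add: space_restrict_space)
      have "indicator unit_ball w / emeasure ?R unit_ball = ennreal (1 / measure lborel (unit_ball :: (complex ^ 'n) set))"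
        using w measure_unit_ball_pos[where 'n = 'n] divide_ennreal[of 1] by (simp add: em)
      then show "indicator unit_ball w / emeasure ?R unit_ball * ennreal (nu_weight TYPE('n) \<alpha> * (1 - (norm w)\<^sup>2) powr \<alpha>) =
          ennreal (nu_factor TYPE('n) \<alpha> * ball_weight \<alpha> w)"
        using w measure_unit_ball_pos[where 'n = 'n] by (simp add: ennreal_mult'[symmetric] nu_factor_def ball_weight_def)
    qed
    show "(\<lambda>w. indicator unit_ball w / emeasure ?R unit_ball * ennreal (nu_weight TYPE('n) \<alpha> * (1 - (norm w)\<^sup>2) powr \<alpha>)) \<in> borel_measurable ?R"
      by measurable
    show "(\<lambda>w. ennreal (nu_factor TYPE('n) \<alpha> * ball_weight \<alpha> w)) \<in> borel_measurable ?R"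
      by (rule measurable_restrict_space1) simp
  qed
  finally show ?thesis .
qed

lemma borel_measurable_nu_iff: "f \<in> measurable (nu \<alpha>) M \<longleftrightarrow> f \<in> measurable (restrict_space lborel unit_ball) M"
  by (rule arg_cong2[where f = "(\<in>)", OF refl], rule measurable_cong_sets) (simp_all add: sets_restrict_space)

lemma borel_measurable_nu_continuous_on:
  "continuous_on unit_ball f \<Longrightarrow> f \<in> borel_measurable (nu \<alpha>)"
  using borel_measurable_continuous_on_restrict[of unit_ball f] by (simp cong: measurable_cong_sets)

lemma nn_integral_nu:
  fixes f :: "complex ^ 'n \<Rightarrow> ennreal"
  assumes \<alpha>: "\<alpha> > -1" and f: "f \<in> borel_measurable (nu \<alpha>)"
  shows "(\<integral>\<^sup>+w. f w \<partial>nu \<alpha>) = ennreal (nu_factor TYPE('n) \<alpha>) * (\<integral>\<^sup>+w. ennreal (ball_weight \<alpha> w) * f w \<partial>lborel)"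
proof -
  have f': "f \<in> borel_measurable (restrict_space lborel unit_ball)"
    using f by (simp add: borel_measurable_nu_iff)
  have bw: "(\<lambda>w :: complex ^ 'n. ennreal (ball_weight \<alpha> w)) \<in> borel_measurable (restrict_space lborel unit_ball)"
    by (rule measurable_restrict_space1) simp
  have "(\<integral>\<^sup>+w. f w \<partial>nu \<alpha>) = (\<integral>\<^sup>+w. ennreal (nu_factor TYPE('n) \<alpha>) * (ennreal (ball_weight \<alpha> w) * f w) \<partial>restrict_space lborel unit_ball)"
    unfolding nu_conv_density[OF \<alpha>] using f' bw nu_factor_pos[OF \<alpha>, where 'n = 'n]
    by (subst nn_integral_density) (auto simp: ennreal_mult' mult.assoc measurable_restrict_space1)
  also have "\<dots> = ennreal (nu_factor TYPE('n) \<alpha>) * (\<integral>\<^sup>+w. ennreal (ball_weight \<alpha> w) * f w \<partial>restrict_space lborel unit_ball)"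
    using f' bw by (intro nn_integral_cmult borel_measurable_times_ennreal)
  also have "(\<integral>\<^sup>+w. ennreal (ball_weight \<alpha> w) * f w \<partial>restrict_space lborel unit_ball) = (\<integral>\<^sup>+w. ennreal (ball_weight \<alpha> w) * f w \<partial>lborel)"
    by (subst nn_integral_restrict_space) (auto intro!: nn_integral_cong simp: indicator_def ball_weight_def)
  finally show ?thesis .
qed

lemma integral_nu:
  fixes f :: "complex ^ 'n \<Rightarrow> complex"
  assumes \<alpha>: "\<alpha> > -1" and f: "f \<in> borel_measurable (nu \<alpha>)"
  shows "integrable (nu \<alpha>) f \<longleftrightarrow> integrable lborel (\<lambda>w. ball_weight \<alpha> w *\<^sub>R f w)"
    and "(\<integral>w. f w \<partial>nu \<alpha>) = nu_factor TYPE('n) \<alpha> *\<^sub>R (\<integral>w. ball_weight \<alpha> w *\<^sub>R f w \<partial>lborel)"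
proof -
  let ?c = "nu_factor TYPE('n) \<alpha>"
  have f': "f \<in> borel_measurable (restrict_space lborel unit_ball)"
    using f by (simp add: borel_measurable_nu_iff)
  have bw: "(\<lambda>w :: complex ^ 'n. ?c * ball_weight \<alpha> w) \<in> borel_measurable (restrict_space lborel unit_ball)"
    by (rule measurable_restrict_space1) simp
  have c: "?c > 0"
    by (rule nu_factor_pos[OF \<alpha>])
  have eq: "(\<lambda>w. indicator unit_ball w *\<^sub>R (?c * ball_weight \<alpha> w) *\<^sub>R f w) = (\<lambda>w. ?c *\<^sub>R (ball_weight \<alpha> w *\<^sub>R f w))"
    by (auto simp: fun_eq_iff ball_weight_def indicator_def)
  have "integrable (nu \<alpha>) f \<longleftrightarrow> integrable (restrict_space lborel unit_ball) (\<lambda>w. (?c * ball_weight \<alpha> w) *\<^sub>R f w)"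
    unfolding nu_conv_density[OF \<alpha>] using c by (intro integrable_density f' bw) auto
  also have "\<dots> \<longleftrightarrow> integrable lborel (\<lambda>w. ?c *\<^sub>R (ball_weight \<alpha> w *\<^sub>R f w))"
    unfolding eq[symmetric] by (rule integrable_restrict_space) simp
  also have "\<dots> \<longleftrightarrow> integrable lborel (\<lambda>w. ball_weight \<alpha> w *\<^sub>R f w)"
  proof
    assume "integrable lborel (\<lambda>w. ?c *\<^sub>R (ball_weight \<alpha> w *\<^sub>R f w))"
    from integrable_scaleR_right[OF this, of "inverse ?c"]
    show "integrable lborel (\<lambda>w. ball_weight \<alpha> w *\<^sub>R f w)"
      using c by (simp add: mult.assoc[symmetric])
  qed (rule integrable_scaleR_right)
  finally show "integrable (nu \<alpha>) f \<longleftrightarrow> integrable lborel (\<lambda>w. ball_weight \<alpha> w *\<^sub>R f w)" .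
  have "(\<integral>w. f w \<partial>nu \<alpha>) = (\<integral>w. (?c * ball_weight \<alpha> w) *\<^sub>R f w \<partial>restrict_space lborel unit_ball)"
    unfolding nu_conv_density[OF \<alpha>] using c by (intro integral_density f' bw) auto
  also have "\<dots> = (\<integral>w. ?c *\<^sub>R (ball_weight \<alpha> w *\<^sub>R f w) \<partial>lborel)"
    unfolding eq[symmetric] by (rule integral_restrict_space) simp
  finally show "(\<integral>w. f w \<partial>nu \<alpha>) = ?c *\<^sub>R (\<integral>w. ball_weight \<alpha> w *\<^sub>R f w \<partial>lborel)"
    by (simp only: integral_scaleR_right)
qed

text \<open>The total mass of \<open>nu \<alpha>\<close>, carried along as a positive
  constant.\<close>

definition nu_mass :: "'n::finite itself \<Rightarrow> real \<Rightarrow> real"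
  where "nu_mass _ \<alpha> = nu_factor TYPE('n) \<alpha> * ball_mass TYPE('n) \<alpha>"

lemma nu_mass_pos: "\<alpha> > -1 \<Longrightarrow> nu_mass TYPE('n::finite) \<alpha> > 0"
  unfolding nu_mass_def by (intro mult_pos_pos nu_factor_pos ball_mass_pos)

lemma finite_measure_nu: "\<alpha> > -1 \<Longrightarrow> finite_measure (nu \<alpha> :: (complex ^ 'n) measure)"
proof
  assume \<alpha>: "\<alpha> > -1"
  have "emeasure (nu \<alpha>) (space (nu \<alpha> :: (complex ^ 'n) measure)) = (\<integral>\<^sup>+w. 1 \<partial>(nu \<alpha> :: (complex ^ 'n) measure))"
    by simp
  also have "\<dots> = ennreal (nu_factor TYPE('n) \<alpha>) * (\<integral>\<^sup>+w. ennreal (ball_weight \<alpha> (w :: complex ^ 'n)) * 1 \<partial>lborel)"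
    by (rule nn_integral_nu[OF \<alpha>]) simp
  also have "\<dots> < \<infinity>"
    using nn_integral_ball_weight_finite[OF \<alpha>, where 'n = 'n] by (simp add: ennreal_mult_less_top)
  finally show "emeasure (nu \<alpha>) (space (nu \<alpha> :: (complex ^ 'n) measure)) \<noteq> \<infinity>"
    by simp
qed

theorem bergman_reproducing:
  fixes f :: "complex ^ 'n \<Rightarrow> complex"
  assumes f: "f \<in> holomorphic unit_ball" and \<alpha>: "\<alpha> > -1"
    and int: "integrable (nu \<alpha>) f" and z: "norm z < 1"
  shows "(\<integral>w. f w * bergman_kernel (real CARD('n) + 1 + \<alpha>) z w \<partial>nu \<alpha>) = nu_mass TYPE('n) \<alpha> *\<^sub>R f z"
proof -
  have cont: "continuous_on unit_ball f"
    by (rule holomorphic_imp_continuous_on[OF f])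
  then have "f \<in> borel_measurable (nu \<alpha>)"
    by (rule borel_measurable_nu_continuous_on)
  from integral_nu(1)[OF \<alpha> this] have "integrable lborel (\<lambda>w. ball_weight \<alpha> w *\<^sub>R f w)"
    using int by (rule iffD1)
  moreover have "(\<lambda>w. f w * bergman_kernel (real CARD('n) + 1 + \<alpha>) z w) \<in> borel_measurable (nu \<alpha>)"
    using z by (intro borel_measurable_nu_continuous_on continuous_intros cont) auto
  ultimately show ?thesis
    using bergman_reproducing_lborel[OF f \<alpha> _ z] by (simp add: integral_nu(2)[OF \<alpha>] nu_mass_def)
qed

section \<open>Vector-valued integrals of continuous functions over the ball\<close>

text \<open>Each point receives the most recently added centre within distance \<open>e\<close>, so
  the choice depends only on preimages of balls and is measurable.\<close>

lemma simple_approx_finite_net: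
  assumes F: "F \<in> borel_measurable M" and Y: "finite Y"
  shows "\<exists>s. simple_function M s \<and> (\<forall>x\<in>space M. (\<exists>y\<in>Y. dist (F x) y < e) \<longrightarrow> dist (F x) (s x) < e)"
  using Y
proof (induction Y)
  case empty
  show ?case
    by (intro exI[of _ "\<lambda>_. undefined"]) simp
next
  case (insert y Y)
  then obtain s where s: "simple_function M s" "\<forall>x\<in>space M. (\<exists>y\<in>Y. dist (F x) y < e) \<longrightarrow> dist (F x) (s x) < e"
    by blast
  have "{x \<in> space M. dist (F x) y < e} = F -` ball y e \<inter> space M"
    by (auto simp: dist_commute)
  also have "\<dots> \<in> sets M"
    by (rule measurable_sets[OF F]) simp
  finally have "simple_function M (\<lambda>x. if dist (F x) y < e then y else s x)"
    by (intro simple_function_If s) auto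
  then show ?case
    using s(2) by (intro exI[of _ "\<lambda>x. if dist (F x) y < e then y else s x"]) auto
qed

text \<open>Continuity plays the part of strong measurability: the ball is a countable union of
  compact sets, so the range of \<open>F\<close> is separable.\<close>

definition ball_integrable :: "real \<Rightarrow> (complex ^ 'n \<Rightarrow> 'a::real_normed_vector) \<Rightarrow> bool"
  where "ball_integrable \<alpha> F \<longleftrightarrow> continuous_on unit_ball F \<and> (\<integral>\<^sup>+w. ennreal (norm (F w)) \<partial>nu \<alpha>) < \<infinity>"

text \<open>On a smaller closed ball the image of \<open>F\<close> is totally bounded, so a finite
  net gives a uniformly close simple function, set to 0 elsewhere. The error is at most 1 inside and
  \<open>norm (F w)\<close> outside, hence dominated by \<open>1 + norm (F w)\<close>.\<close>

lemma has_bochner_int_bochner_int: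
  fixes F :: "complex ^ 'n \<Rightarrow> 'a::cbanach"
  assumes \<alpha>: "\<alpha> > -1" and F: "ball_integrable \<alpha> F"
  shows "has_bochner_int (nu \<alpha>) F (bochner_int (nu \<alpha>) F)"
proof -
  let ?M = "nu \<alpha> :: (complex ^ 'n) measure"
  have cont: "continuous_on unit_ball F" and fin: "(\<integral>\<^sup>+w. ennreal (norm (F w)) \<partial>nu \<alpha>) < \<infinity>"
    using F by (auto simp: ball_integrable_def)
  interpret finite_measure ?M
    by (rule finite_measure_nu[OF \<alpha>])
  have meas: "F \<in> borel_measurable ?M"
    by (rule borel_measurable_nu_continuous_on[OF cont])
  have measn: "(\<lambda>w. ennreal (norm (F w))) \<in> borel_measurable ?M"
    by (intro measurable_compose[OF borel_measurable_nu_continuous_on[OF continuous_on_norm[OF cont]]]) simp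
  define r where "r i = 1 - 1 / (real i + 2)" for i
  have r: "r i < 1" for i
    by (simp add: r_def)
  have "\<exists>s. simple_function ?M s \<and> (\<forall>w\<in>cball 0 (r i). dist (F w) (s w) < 1 / Suc i) \<and> (\<forall>w. w \<notin> cball 0 (r i) \<longrightarrow> s w = 0)" for i
  proof -
    have sub: "cball 0 (r i) \<subseteq> unit_ball"
      using r[of i] by auto
    have "compact (F ` cball 0 (r i))"
      by (intro compact_continuous_image continuous_on_subset[OF cont sub]) auto
    then have "\<exists>Y. finite Y \<and> F ` cball 0 (r i) \<subseteq> (\<Union>y\<in>Y. ball y (1 / Suc i))"
      unfolding compact_eq_totally_bounded by (meson divide_pos_pos of_nat_0_less_iff zero_less_Suc zero_less_one)
    then obtain Y where Y: "finite Y" "F ` cball 0 (r i) \<subseteq> (\<Union>y\<in>Y. ball y (1 / Suc i))"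
      by blast
    obtain t where t: "simple_function ?M t"
      "\<forall>x\<in>space ?M. (\<exists>y\<in>Y. dist (F x) y < 1 / Suc i) \<longrightarrow> dist (F x) (t x) < 1 / Suc i"
      using simple_approx_finite_net[OF meas Y(1)] by blast
    have "{w \<in> space ?M. w \<in> cball 0 (r i)} = cball 0 (r i)"
      using sub by auto
    moreover have "cball 0 (r i) \<in> sets ?M"
      using sub by (auto simp: sets_restrict_space intro!: image_eqI[of _ _ "cball 0 (r i)"])
    ultimately have "simple_function ?M (\<lambda>w. if w \<in> cball 0 (r i) then t w else 0)"
      by (intro simple_function_If t) auto
    moreover have "dist (F w) (t w) < 1 / Suc i" if "w \<in> cball 0 (r i)" for w
      using t(2) Y(2) that sub by (force simp: dist_commute)
    ultimately show ?thesis
      by (intro exI[of _ "\<lambda>w. if w \<in> cball 0 (r i) then t w else 0"]) auto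
  qed
  then obtain s where s: "\<And>i. simple_function ?M (s i)"
    "\<And>i w. w \<in> cball 0 (r i) \<Longrightarrow> dist (F w) (s i w) < 1 / Suc i"
    "\<And>i w. w \<notin> cball 0 (r i) \<Longrightarrow> s i w = 0"
    by metis
  have sb: "Bochner_Integration.simple_bochner_integrable ?M (s i)" for i
    by (rule simple_bochner_integrable.intros[OF s(1)]) (simp add: emeasure_finite)
  have "(\<lambda>i. \<integral>\<^sup>+w. ennreal (norm (F w - s i w)) \<partial>?M) \<longlonglongrightarrow> (\<integral>\<^sup>+w. 0 \<partial>?M)"
  proof (rule nn_integral_dominated_convergence)
    show "(\<lambda>w. ennreal (norm (F w - s i w))) \<in> borel_measurable ?M" for i
      by (intro measurable_compose[OF borel_measurable_norm_diff_simple[OF meas s(1)]]) simp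
    show "(\<lambda>w. 1 + ennreal (norm (F w))) \<in> borel_measurable ?M"
      by (intro borel_measurable_add measn) simp
    show "AE w in ?M. ennreal (norm (F w - s i w)) \<le> 1 + ennreal (norm (F w))" for i
    proof (rule AE_I2)
      fix w
      have "norm (F w - s i w) \<le> 1 + norm (F w)"
      proof (cases "w \<in> cball 0 (r i)")
        case True
        have "1 / real (Suc i) \<le> 1"
          by simp
        then have "norm (F w - s i w) < 1"
          using s(2)[OF True] unfolding dist_norm by linarith
        then show ?thesis
          using norm_ge_zero[of "F w"] by linarith
      qed (simp add: s(3))
      then show "ennreal (norm (F w - s i w)) \<le> 1 + ennreal (norm (F w))"
        by (metis ennreal_1 ennreal_leI ennreal_plus norm_ge_zero zero_le_one)
    qed
    show "(\<integral>\<^sup>+w. 1 + ennreal (norm (F w)) \<partial>?M) < \<infinity>"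
      using fin by (subst nn_integral_add) (auto simp: measn emeasure_finite less_top[symmetric])
    show "AE w in ?M. (\<lambda>i. ennreal (norm (F w - s i w))) \<longlonglongrightarrow> 0"
    proof (rule AE_I2)
      fix w assume "w \<in> space ?M"
      then have w: "norm w < 1" by simp
      have "(\<lambda>i. 1 / (real i + 2)) \<longlonglongrightarrow> 0"
        using LIMSEQ_ignore_initial_segment[OF lim_1_over_n[where 'a = real], of 2] by (simp add: add.commute)
      then have "eventually (\<lambda>i. 1 / (real i + 2) < 1 - norm w) sequentially"
        using w by (intro order_tendstoD(2)) auto
      then have ev: "eventually (\<lambda>i. norm (norm (F w - s i w)) \<le> 1 / real (Suc i)) sequentially"
      proof eventually_elim
        case (elim i)
        then have "w \<in> cball 0 (r i)"
          by (simp add: r_def)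
        then show ?case
          using s(2)[of w i] by (simp add: dist_norm)
      qed
      have "(\<lambda>i. norm (F w - s i w)) \<longlonglongrightarrow> 0"
        by (rule Lim_null_comparison[OF ev]) (rule LIMSEQ_Suc[OF lim_1_over_n])
      then show "(\<lambda>i. ennreal (norm (F w - s i w))) \<longlonglongrightarrow> 0"
        using tendsto_ennrealI[of _ 0] by fastforce
    qed
  qed simp
  then have "(\<lambda>i. \<integral>\<^sup>+w. ennreal (norm (F w - s i w)) \<partial>?M) \<longlonglongrightarrow> 0"
    by simp
  then obtain x where x: "has_bochner_int ?M F x"
    by (rule has_bochner_int_limit[OF meas sb])
  then show ?thesis
    by (simp add: bochner_int_eqI)
qed

lemma
  fixes F :: "complex ^ 'n \<Rightarrow> 'a::cbanach"
  assumes \<alpha>: "\<alpha> > -1" and F: "ball_integrable \<alpha> F" and \<phi>: "complex_functional \<phi>"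
  shows integrable_functional: "integrable (nu \<alpha>) (\<lambda>w. \<phi> (F w))"
    and functional_bochner_int: "\<phi> (bochner_int (nu \<alpha>) F) = (\<integral>w. \<phi> (F w) \<partial>nu \<alpha>)"
  using has_bochner_int_functional[OF \<phi> has_bochner_int_bochner_int[OF \<alpha> F]]
  by (auto simp: has_bochner_integral_iff)

lemma norm_bochner_int_le:
  fixes F :: "complex ^ 'n \<Rightarrow> 'a::cbanach"
  assumes \<alpha>: "\<alpha> > -1" and F: "ball_integrable \<alpha> F" and B: "(\<integral>\<^sup>+w. ennreal (norm (F w)) \<partial>nu \<alpha>) \<le> ennreal B" "B \<ge> 0"
  shows "norm (bochner_int (nu \<alpha>) F) \<le> B"
proof (rule complex_functional_norm_le)
  fix \<phi> :: "'a \<Rightarrow> complex" assume \<phi>: "complex_functional \<phi>"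
  have "ennreal (cmod (\<phi> (bochner_int (nu \<alpha>) F))) \<le> (\<integral>\<^sup>+w. ennreal (cmod (\<phi> (F w))) \<partial>nu \<alpha>)"
    unfolding functional_bochner_int[OF \<alpha> F \<phi>] by (rule integral_norm_bound_ennreal[OF integrable_functional[OF \<alpha> F \<phi>]])
  also have "\<dots> \<le> (\<integral>\<^sup>+w. ennreal (norm (F w)) \<partial>nu \<alpha>)"
    using \<phi> by (intro nn_integral_mono ennreal_leI) (simp add: complex_functional_def)
  also note B(1)
  finally show "cmod (\<phi> (bochner_int (nu \<alpha>) F)) \<le> B"
    using B(2) by simp
qed

section \<open>Complex scalar factors under the vector-valued integral\<close>

lemma bounded_bilinear_scaleC: "bounded_bilinear (scaleC :: complex \<Rightarrow> 'a::complex_normed_vector \<Rightarrow> 'a)"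
proof
  show "(r *\<^sub>R c) *\<^sub>C x = r *\<^sub>R c *\<^sub>C x" for r c and x :: 'a
    by (simp only: scaleR_conv_of_real) (simp add: scaleR_scaleC[of r "_ *\<^sub>C x"] scaleC_scaleC)
  show "c *\<^sub>C r *\<^sub>R x = r *\<^sub>R c *\<^sub>C x" for r c and x :: 'a
    by (simp add: scaleR_scaleC scaleC_scaleC mult.commute)
  show "\<exists>K. \<forall>c (x :: 'a). norm (c *\<^sub>C x) \<le> norm c * norm x * K"
    by (intro exI[of _ 1]) (simp add: norm_scaleC)
qed (simp_all add: scaleC_add_left scaleC_add_right)

lemmas continuous_on_scaleC [continuous_intros] = bounded_bilinear.continuous_on[OF bounded_bilinear_scaleC]

lemma nn_integral_norm_scaleC_le:
  fixes F :: "complex ^ 'n \<Rightarrow> 'a::complex_normed_vector"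
  assumes "continuous_on unit_ball F" and k: "\<And>w. norm w < 1 \<Longrightarrow> cmod (k w) \<le> B" and "B \<ge> 0"
  shows "(\<integral>\<^sup>+w. ennreal (norm (k w *\<^sub>C F w)) \<partial>nu \<alpha>) \<le> ennreal B * (\<integral>\<^sup>+w. ennreal (norm (F w)) \<partial>nu \<alpha>)"
proof -
  have "(\<integral>\<^sup>+w. ennreal (norm (k w *\<^sub>C F w)) \<partial>nu \<alpha>) \<le> (\<integral>\<^sup>+w. ennreal B * ennreal (norm (F w)) \<partial>nu \<alpha>)"
    using assms by (intro nn_integral_mono) (auto simp: norm_scaleC ennreal_mult'[symmetric] intro!: ennreal_leI mult_right_mono)
  also have "\<dots> = ennreal B * (\<integral>\<^sup>+w. ennreal (norm (F w)) \<partial>nu \<alpha>)"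
    by (intro nn_integral_cmult measurable_compose[OF borel_measurable_nu_continuous_on[OF continuous_on_norm[OF assms(1)]]]) simp
  finally show ?thesis .
qed

lemma ball_integrable_scaleC:
  fixes F :: "complex ^ 'n \<Rightarrow> 'a::complex_normed_vector"
  assumes F: "ball_integrable \<alpha> F" and "continuous_on unit_ball k" "\<And>w. norm w < 1 \<Longrightarrow> cmod (k w) \<le> B"
  shows "ball_integrable \<alpha> (\<lambda>w. k w *\<^sub>C F w)"
  unfolding ball_integrable_def
proof
  show "continuous_on unit_ball (\<lambda>w. k w *\<^sub>C F w)"
    using F assms(2) by (intro continuous_intros) (auto simp: ball_integrable_def)
  have "B \<ge> 0"
    using assms(3)[of 0] norm_ge_zero[of "k 0"] by (simp del: norm_ge_zero)
  then have "(\<integral>\<^sup>+w. ennreal (norm (k w *\<^sub>C F w)) \<partial>nu \<alpha>) \<le> ennreal B * (\<integral>\<^sup>+w. ennreal (norm (F w)) \<partial>nu \<alpha>)"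
    using F assms(3) by (intro nn_integral_norm_scaleC_le) (auto simp: ball_integrable_def)
  also have "\<dots> < \<infinity>"
    using F by (simp add: ball_integrable_def ennreal_mult_less_top)
  finally show "(\<integral>\<^sup>+w. ennreal (norm (k w *\<^sub>C F w)) \<partial>nu \<alpha>) < \<infinity>" .
qed

lemma complex_functional_linear:
  assumes "complex_functional \<phi>"
  shows "\<phi> (x + y) = \<phi> x + \<phi> y" "\<phi> (x - y) = \<phi> x - \<phi> y" "\<phi> (c *\<^sub>C x) = c * \<phi> x"
    "\<phi> (r *\<^sub>R x) = of_real r * \<phi> x" "cmod (\<phi> x) \<le> norm x" "bounded_linear \<phi>"
  using assms linear_add[of \<phi>] linear_diff[of \<phi>] linear_scale[of \<phi>] bounded_linear.linear[of \<phi>]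
  by (auto simp: complex_functional_def scaleR_conv_of_real)

lemma bochner_int_diff_scaleC:
  fixes F :: "complex ^ 'n \<Rightarrow> 'a::cbanach"
  assumes \<alpha>: "\<alpha> > -1" and F: "ball_integrable \<alpha> (\<lambda>w. k w *\<^sub>C F w)" "ball_integrable \<alpha> (\<lambda>w. l w *\<^sub>C F w)"
    and d: "ball_integrable \<alpha> (\<lambda>w. (k w - l w) *\<^sub>C F w)"
  shows "bochner_int (nu \<alpha>) (\<lambda>w. (k w - l w) *\<^sub>C F w) =
    bochner_int (nu \<alpha>) (\<lambda>w. k w *\<^sub>C F w) - bochner_int (nu \<alpha>) (\<lambda>w. l w *\<^sub>C F w)"
proof (rule complex_functional_eqI)
  fix \<phi> :: "'a \<Rightarrow> complex" assume \<phi>: "complex_functional \<phi>"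
  note int = integrable_functional[OF \<alpha> F(1) \<phi>] integrable_functional[OF \<alpha> F(2) \<phi>]
  show "\<phi> (bochner_int (nu \<alpha>) (\<lambda>w. (k w - l w) *\<^sub>C F w)) =
      \<phi> (bochner_int (nu \<alpha>) (\<lambda>w. k w *\<^sub>C F w) - bochner_int (nu \<alpha>) (\<lambda>w. l w *\<^sub>C F w))"
    unfolding complex_functional_linear[OF \<phi>] functional_bochner_int[OF \<alpha> F(1) \<phi>]
      functional_bochner_int[OF \<alpha> F(2) \<phi>] functional_bochner_int[OF \<alpha> d \<phi>]
    using Bochner_Integration.integral_diff[OF int]
    by (simp add: complex_functional_linear[OF \<phi>] left_diff_distrib)
qed

lemma bochner_int_scaleC_left:
  fixes F :: "complex ^ 'n \<Rightarrow> 'a::cbanach"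
  assumes \<alpha>: "\<alpha> > -1" and F: "ball_integrable \<alpha> (\<lambda>w. k w *\<^sub>C F w)"
    and d: "ball_integrable \<alpha> (\<lambda>w. (c * k w) *\<^sub>C F w)"
  shows "bochner_int (nu \<alpha>) (\<lambda>w. (c * k w) *\<^sub>C F w) = c *\<^sub>C bochner_int (nu \<alpha>) (\<lambda>w. k w *\<^sub>C F w)"
proof (rule complex_functional_eqI)
  fix \<phi> :: "'a \<Rightarrow> complex" assume \<phi>: "complex_functional \<phi>"
  show "\<phi> (bochner_int (nu \<alpha>) (\<lambda>w. (c * k w) *\<^sub>C F w)) = \<phi> (c *\<^sub>C bochner_int (nu \<alpha>) (\<lambda>w. k w *\<^sub>C F w))"
    unfolding complex_functional_linear[OF \<phi>] functional_bochner_int[OF \<alpha> F \<phi>] functional_bochner_int[OF \<alpha> d \<phi>]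
    by (simp add: complex_functional_linear[OF \<phi>] mult.assoc)
qed

section \<open>Differentiation of kernel integrals\<close>

text \<open>The one-variable profile of the kernel. Taylor estimates for it hold on a disc and
  become uniform in \<open>w\<close> after inserting \<open>hinner z w\<close>.\<close>

definition binomial_fun :: "real \<Rightarrow> complex \<Rightarrow> complex"
  where "binomial_fun s t = inverse ((1 - t) powr complex_of_real s)"

lemma bergman_kernel_conv: "bergman_kernel s z w = binomial_fun s (hinner z w)"
  by (simp add: bergman_kernel_def binomial_fun_def)

lemma binomial_fun_deriv:
  assumes "cmod t < 1"
  shows "(binomial_fun s has_field_derivative of_real s * binomial_fun (s + 1) t) (at t within S)"
proof -
  have t: "1 - t \<notin> \<real>\<^sub>\<le>\<^sub>0"
    using complex_Re_le_cmod[of t] assms by (auto simp: complex_nonpos_Reals_iff)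
  have "((\<lambda>t. (1 - t) powr (- complex_of_real s)) has_field_derivative
      (- complex_of_real s) * (1 - t) powr (- complex_of_real s - 1) * (0 - 1)) (at t)"
    by (rule DERIV_chain2[where g = "\<lambda>t. 1 - t", OF has_field_derivative_powr[OF t]]) (auto intro!: derivative_eq_intros)
  moreover have "binomial_fun s = (\<lambda>t. (1 - t) powr (- complex_of_real s))"
    by (simp add: fun_eq_iff binomial_fun_def powr_minus)
  moreover have "binomial_fun (s + 1) t = (1 - t) powr (- complex_of_real s - 1)"
    by (simp add: binomial_fun_def powr_minus[symmetric])
  ultimately show ?thesis
    by (auto intro: has_field_derivative_at_within)
qed

lemma norm_binomial_fun_le:
  assumes "cmod t \<le> r" "r < 1" "s \<ge> 0"
  shows "cmod (binomial_fun s t) \<le> (1 - r) powr (- s)"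
proof -
  have "1 - r \<le> cmod (1 - t)"
    using norm_triangle_ineq2[of 1 t] assms by simp
  then show ?thesis
    unfolding binomial_fun_def norm_inverse using assms
    by (simp add: norm_powr_real_powr' flip: powr_minus) (intro powr_mono2', auto)
qed

lemma binomial_fun_taylor:
  assumes "cmod a \<le> r" "cmod b \<le> r" "r < 1" "s \<ge> 0"
  shows "cmod (binomial_fun s b - binomial_fun s a - of_real s * (b - a) * binomial_fun (s + 1) a) \<le>
    s * (s + 1) * (1 - r) powr (- (s + 2)) * (cmod (b - a))\<^sup>2"
proof -
  \<comment> \<open>The derivatives of order 0, 1 and 2, with the rising factorials of
    \<open>s\<close> written out.\<close>
  define f where "f i = (\<lambda>t. of_real (if i = 0 then 1 else if i = Suc 0 then s else s * (s + 1)) * binomial_fun (s + real i) t)" for i :: nat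
  have "cmod (f 0 b - (\<Sum>i\<le>1. f i a * (b - a) ^ i / fact i)) \<le>
      s * (s + 1) * (1 - r) powr (- (s + 2)) * cmod (b - a) ^ Suc 1 / fact 1"
  proof (rule complex_Taylor[where S = "cball 0 r"])
    show "(f i has_field_derivative f (Suc i) t) (at t within cball 0 r)" if "t \<in> cball 0 r" "i \<le> 1" for i t
    proof -
      have "(f i has_field_derivative of_real (if i = 0 then 1 else if i = Suc 0 then s else s * (s + 1)) * (of_real (s + real i) * binomial_fun (s + real i + 1) t)) (at t within cball 0 r)"
        unfolding f_def using that assms by (intro DERIV_cmult binomial_fun_deriv) auto
      moreover have "of_real (if i = 0 then 1 else if i = Suc 0 then s else s * (s + 1)) * (of_real (s + real i) * binomial_fun (s + real i + 1) t) = f (Suc i) t"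
        using that(2) by (cases "i = 0") (auto simp: f_def le_Suc_eq add_ac)
      ultimately show ?thesis by simp
    qed
    show "cmod (f (Suc 1) t) \<le> s * (s + 1) * (1 - r) powr (- (s + 2))" if "t \<in> cball 0 r" for t
      using norm_binomial_fun_le[of t r "s + 2"] that assms
      by (auto simp: f_def norm_mult abs_mult intro!: mult_left_mono simp del: of_real_add of_real_mult)
  qed (use assms in auto)
  then show ?thesis
    by (simp add: f_def power2_eq_square mult_ac diff_diff_eq)
qed

text \<open>For \<open>F = b\<close> and \<open>s = N + j\<close> this is the function
  \<open>B\<close> with index \<open>j\<close> of the overview.\<close>

definition kernel_integral :: "real \<Rightarrow> (complex ^ 'n \<Rightarrow> 'a::cbanach) \<Rightarrow> real \<Rightarrow> complex ^ 'n \<Rightarrow> 'a"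
  where "kernel_integral \<alpha> F s z = bochner_int (nu \<alpha>) (\<lambda>w. bergman_kernel s z w *\<^sub>C F w)"

lemma ball_integrable_kernel:
  fixes F :: "complex ^ 'n \<Rightarrow> 'a::cbanach"
  assumes F: "ball_integrable \<alpha> F" and "s \<ge> 0" "norm z < 1"
  shows "ball_integrable \<alpha> (\<lambda>w. bergman_kernel s z w *\<^sub>C F w)"
  using assms norm_bergman_kernel_le[OF assms(3) _ assms(2)]
  by (intro ball_integrable_scaleC[OF F, where B = "(1 - norm z) powr (- s)"] continuous_intros) auto

text \<open>The second-order Taylor remainder of the kernel is bounded uniformly in \<open>w\<close>
  by a multiple of \<open>(norm (y - z))\<^sup>2\<close>. Integrating it against
  \<open>norm (F w)\<close> gives Frechet differentiability, and the kernel of \<open>D\<close> is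
  already complex-linear in \<open>v\<close>.\<close>

lemma kernel_integral_derivative:
  fixes F :: "complex ^ 'n \<Rightarrow> 'a::cbanach"
  assumes \<alpha>: "\<alpha> > -1" and F: "ball_integrable \<alpha> F" and s: "s \<ge> 0" and z: "norm z < 1"
  defines "D \<equiv> \<lambda>v. bochner_int (nu \<alpha>) (\<lambda>w. (of_real s * hinner v w * bergman_kernel (s + 1) z w) *\<^sub>C F w)"
  shows "(kernel_integral \<alpha> F s has_derivative D) (at z)"
    and "D (c *s v) = c *\<^sub>C D v"
    and "D z = s *\<^sub>R (kernel_integral \<alpha> F (s + 1) z - kernel_integral \<alpha> F s z)"
proof -
  let ?k = "\<lambda>v w. of_real s * hinner v w * bergman_kernel (s + 1) z w"
  obtain A where A: "A \<ge> 0" "(\<integral>\<^sup>+w. ennreal (norm (F w)) \<partial>nu \<alpha>) = ennreal A"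
    using F by (cases "\<integral>\<^sup>+w. ennreal (norm (F w)) \<partial>nu \<alpha>") (auto simp: ball_integrable_def)
  have contF: "continuous_on unit_ball F"
    using F by (simp add: ball_integrable_def)
  define B where "B = (1 - norm z) powr (- (s + 1))"
  have kb: "cmod (?k v w) \<le> s * B * norm v" if "norm w < 1" for v w
  proof -
    have "cmod (hinner v w) \<le> norm v"
      using norm_hinner_le_left[of w v] that by simp
    moreover have "cmod (bergman_kernel (s + 1) z w) \<le> B"
      unfolding B_def using that s z by (intro norm_bergman_kernel_le) auto
    ultimately have "cmod (hinner v w) * cmod (bergman_kernel (s + 1) z w) \<le> norm v * B"
      by (intro mult_mono) auto
    then have "s * (cmod (hinner v w) * cmod (bergman_kernel (s + 1) z w)) \<le> s * (norm v * B)"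
      using s by (intro mult_left_mono)
    then show ?thesis
      using s by (simp add: norm_mult mult_ac)
  qed
  have kc: "continuous_on unit_ball (?k v)" for v
    using z by (intro continuous_intros) auto
  have Dint: "ball_integrable \<alpha> (\<lambda>w. ?k v w *\<^sub>C F w)" for v
    by (rule ball_integrable_scaleC[OF F kc kb])
  show DC: "D (c *s v) = c *\<^sub>C D v" for c v
  proof -
    have eq: "?k (c *s v) w = c * ?k v w" for w
      by (simp add: hinner_scale_left mult_ac)
    show ?thesis
      unfolding D_def eq using Dint[of "c *s v"] unfolding eq by (rule bochner_int_scaleC_left[OF \<alpha> Dint])
  qed
  have Ddiff: "D (x - y) = D x - D y" for x y
  proof -
    have eq: "?k (x - y) w = ?k x w - ?k y w" for w
      by (simp add: linear_diff[OF bounded_linear.linear[OF bounded_linear_hinner_left]] algebra_simps)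
    show ?thesis
      unfolding D_def eq using Dint[of "x - y"] unfolding eq by (rule bochner_int_diff_scaleC[OF \<alpha> Dint Dint])
  qed
  have Dadd: "D (x + y) = D x + D y" for x y
    using Ddiff[of "x + y" y] by simp
  have Dscale: "D (r *\<^sub>R x) = r *\<^sub>R D x" for r x
  proof -
    have "r *\<^sub>R x = complex_of_real r *s x"
      unfolding vec_eq_iff vector_scaleR_component vector_smult_component by (simp add: scaleR_conv_of_real)
    then show ?thesis
      by (simp add: DC scaleR_scaleC)
  qed
  have Dbound: "norm (D v) \<le> norm v * (s * B * A)" for v
  proof -
    have "(\<integral>\<^sup>+w. ennreal (norm (?k v w *\<^sub>C F w)) \<partial>nu \<alpha>) \<le> ennreal (s * B * norm v) * ennreal A"
      using kb s unfolding A(2)[symmetric] by (intro nn_integral_norm_scaleC_le contF) (auto simp: B_def)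
    also have "\<dots> = ennreal (norm v * (s * B * A))"
      using A s by (simp add: ennreal_mult'[symmetric] B_def mult_ac)
    finally show ?thesis
      unfolding D_def using A s by (intro norm_bochner_int_le[OF \<alpha> Dint]) (auto simp: B_def)
  qed
  have Dlin: "bounded_linear D"
    by (rule bounded_linear_intro[OF Dadd Dscale Dbound])
  \<comment> \<open>Strictly between \<open>norm z\<close> and 1: for \<open>y\<close> near
    \<open>z\<close> both inner products stay in the disc of radius \<open>r\<close>, away from the
    singularity at 1.\<close>
  define r where "r = (1 + norm z) / 2"
  have r: "norm z < r" "r < 1"
    using z by (auto simp: r_def)
  define M where "M = s * (s + 1) * (1 - r) powr (- (s + 2))"
  have M: "M \<ge> 0"
    using s by (simp add: M_def)
  have rem: "norm (kernel_integral \<alpha> F s y - kernel_integral \<alpha> F s z - D (y - z)) / norm (y - z) \<le> M * A * norm (y - z)"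
    if y: "y \<noteq> z" "dist y z < r - norm z" for y
  proof -
    have ny: "norm y < r"
      using y(2) norm_triangle_ineq2[of y z] by (simp add: dist_norm)
    let ?l = "\<lambda>w. bergman_kernel s y w - bergman_kernel s z w"
    let ?m = "\<lambda>w. ?l w - ?k (y - z) w"
    have mb: "cmod (?m w) \<le> M * (norm (y - z))\<^sup>2" if "norm w < 1" for w
    proof -
      have h: "cmod (hinner x w) \<le> norm x" for x
        using norm_hinner_le_left[of w x] that by simp
      have hd: "hinner (y - z) w = hinner y w - hinner z w"
        using linear_diff[OF bounded_linear.linear[OF bounded_linear_hinner_left], of y z w] .
      have "cmod (?m w) \<le> M * (cmod (hinner y w - hinner z w))\<^sup>2"
        unfolding bergman_kernel_conv hd M_def using h[of y] h[of z] ny r s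
        by (intro binomial_fun_taylor) auto
      also have "\<dots> \<le> M * (norm (y - z))\<^sup>2"
        using M h[of "y - z"] unfolding hd by (intro mult_left_mono power_mono) auto
      finally show ?thesis .
    qed
    have i1: "ball_integrable \<alpha> (\<lambda>w. bergman_kernel s y w *\<^sub>C F w)"
      using ny r by (intro ball_integrable_kernel[OF F s]) simp
    have i2: "ball_integrable \<alpha> (\<lambda>w. bergman_kernel s z w *\<^sub>C F w)"
      by (rule ball_integrable_kernel[OF F s z])
    have mc: "continuous_on unit_ball ?m"
      using z ny r by (intro continuous_intros) auto
    have mi: "ball_integrable \<alpha> (\<lambda>w. ?m w *\<^sub>C F w)"
      by (rule ball_integrable_scaleC[OF F mc mb])
    have lc: "continuous_on unit_ball ?l"
      using z ny r by (intro continuous_intros) auto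
    \<comment> \<open>The kernel difference is the sum of the remainder and the linear part, both of
      which are already bounded.\<close>
    have li: "ball_integrable \<alpha> (\<lambda>w. ?l w *\<^sub>C F w)"
    proof (rule ball_integrable_scaleC[OF F lc])
      show "cmod (?l w) \<le> M * (norm (y - z))\<^sup>2 + s * B * norm (y - z)" if "norm w < 1" for w
        using norm_triangle_ineq[of "?m w" "?k (y - z) w"] mb[OF that] kb[OF that, of "y - z"] by simp
    qed
    have "kernel_integral \<alpha> F s y - kernel_integral \<alpha> F s z - D (y - z) = bochner_int (nu \<alpha>) (\<lambda>w. ?m w *\<^sub>C F w)"
      unfolding kernel_integral_def D_def
      by (simp only: bochner_int_diff_scaleC[OF \<alpha> i1 i2 li] bochner_int_diff_scaleC[OF \<alpha> li Dint mi])
    moreover have "norm (bochner_int (nu \<alpha>) (\<lambda>w. ?m w *\<^sub>C F w)) \<le> M * (norm (y - z))\<^sup>2 * A"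
    proof (rule norm_bochner_int_le[OF \<alpha> mi])
      have "(\<integral>\<^sup>+w. ennreal (norm (?m w *\<^sub>C F w)) \<partial>nu \<alpha>) \<le> ennreal (M * (norm (y - z))\<^sup>2) * ennreal A"
        using mb M unfolding A(2)[symmetric] by (intro nn_integral_norm_scaleC_le contF) auto
      then show "(\<integral>\<^sup>+w. ennreal (norm (?m w *\<^sub>C F w)) \<partial>nu \<alpha>) \<le> ennreal (M * (norm (y - z))\<^sup>2 * A)"
        using A M by (simp add: ennreal_mult')
    qed (use M A in simp)
    ultimately show ?thesis
      using y(1) by (simp add: divide_le_eq power2_eq_square mult_ac)
  qed
  show "(kernel_integral \<alpha> F s has_derivative D) (at z)"
  proof (rule has_derivativeI_sandwich[where e = "r - norm z" and H = "\<lambda>y. M * A * norm (y - z)"])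
    have "((\<lambda>y. M * A * norm (y - z)) \<longlongrightarrow> M * A * norm (z - z)) (at z)"
      by (intro tendsto_intros)
    then show "((\<lambda>y. M * A * norm (y - z)) \<longlongrightarrow> 0) (at z)"
      by simp
  qed (use r Dlin rem in auto)
  \<comment> \<open>In the direction \<open>z\<close> the factor \<open>hinner z w\<close> equals
    \<open>1 - (1 - hinner z w)\<close>, and the subtracted term lowers the exponent by one.\<close>
  have eq: "?k z w = of_real s * (bergman_kernel (s + 1) z w - bergman_kernel s z w)" if "norm w < 1" for w
  proof -
    have *: "bergman_kernel s z w = bergman_kernel (s + 1) z w * (1 - hinner z w)"
      using bergman_kernel_Suc[OF z less_imp_le[OF that], of s] one_minus_hinner_bounds(4)[OF z less_imp_le[OF that]]
      by simp
    show ?thesis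
      unfolding * by (simp add: algebra_simps)
  qed
  have j1: "ball_integrable \<alpha> (\<lambda>w. bergman_kernel (s + 1) z w *\<^sub>C F w)"
    using s by (intro ball_integrable_kernel[OF F _ z]) simp
  have j2: "ball_integrable \<alpha> (\<lambda>w. bergman_kernel s z w *\<^sub>C F w)"
    by (rule ball_integrable_kernel[OF F s z])
  show "D z = s *\<^sub>R (kernel_integral \<alpha> F (s + 1) z - kernel_integral \<alpha> F s z)"
  proof (rule complex_functional_eqI)
    fix \<phi> :: "'a \<Rightarrow> complex" assume \<phi>: "complex_functional \<phi>"
    have "\<phi> (D z) = (\<integral>w. \<phi> (?k z w *\<^sub>C F w) \<partial>nu \<alpha>)"
      unfolding D_def by (rule functional_bochner_int[OF \<alpha> Dint \<phi>])
    also have "\<dots> = (\<integral>w. of_real s * (\<phi> (bergman_kernel (s + 1) z w *\<^sub>C F w) - \<phi> (bergman_kernel s z w *\<^sub>C F w)) \<partial>nu \<alpha>)"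
      by (rule Bochner_Integration.integral_cong[OF refl])
        (simp only: complex_functional_linear[OF \<phi>] space_nu mem_ball_0 eq, simp only: left_diff_distrib right_diff_distrib mult.assoc)
    also have "\<dots> = of_real s * (\<phi> (kernel_integral \<alpha> F (s + 1) z) - \<phi> (kernel_integral \<alpha> F s z))"
      unfolding kernel_integral_def functional_bochner_int[OF \<alpha> j1 \<phi>] functional_bochner_int[OF \<alpha> j2 \<phi>]
      using integrable_functional[OF \<alpha> j1 \<phi>] integrable_functional[OF \<alpha> j2 \<phi>] by simp
    finally show "\<phi> (D z) = \<phi> (s *\<^sub>R (kernel_integral \<alpha> F (s + 1) z - kernel_integral \<alpha> F s z))"
      by (simp add: complex_functional_linear[OF \<phi>])
  qed
qed

lemma holomorphic_kernel_integral:
  fixes F :: "complex ^ 'n \<Rightarrow> 'a::cbanach"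
  assumes "\<alpha> > -1" "ball_integrable \<alpha> F" "s \<ge> 0"
  shows "kernel_integral \<alpha> F s \<in> holomorphic unit_ball"
proof -
  have "\<exists>D. (kernel_integral \<alpha> F s has_derivative D) (at z) \<and> (\<forall>c v. D (c *s v) = c *\<^sub>C D v)" if "z \<in> unit_ball" for z
    using kernel_integral_derivative(1,2)[OF assms, of z] that unfolding mem_ball_0 by blast
  then show ?thesis
    unfolding holomorphic_def by blast
qed

section \<open>Radial derivatives\<close>

text \<open>Complex linearity sums the partial derivatives to the derivative in the direction
  \<open>z\<close>. Uniqueness of Frechet derivatives resolves the \<open>THE\<close> in
  \<open>cpartial\<close>.\<close>

lemma radial_deriv_eq:
  fixes f :: "complex ^ 'n \<Rightarrow> 'a::complex_normed_vector"
  assumes D: "(f has_derivative D) (at z)" and C: "\<And>c v. D (c *s v) = c *\<^sub>C D v"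
  shows "radial_deriv f z = D z"
proof -
  have cp: "cpartial j f z = D (axis j 1)" for j
  proof -
    have ax: "axis j t = t *s axis j (1::complex)" for t
      by (simp add: vec_eq_iff axis_def)
    have "((\<lambda>t. z + t *s axis j 1) has_derivative (\<lambda>t. t *s axis j (1::complex))) (at 0)"
      by (auto intro!: derivative_eq_intros bounded_linear_imp_has_derivative linear_conv_bounded_linear[THEN iffD1]
          linearI simp: vec_eq_iff algebra_simps)
    moreover have "(f has_derivative D) (at (z + 0 *s axis j 1))"
      using D by simp
    ultimately have "((\<lambda>t. f (z + t *s axis j 1)) has_derivative (\<lambda>t. D (t *s axis j 1))) (at 0)"
      by (rule has_derivative_compose)
    then have d: "((\<lambda>t. f (z + axis j t)) has_derivative (\<lambda>t. t *\<^sub>C D (axis j 1))) (at 0)"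
      unfolding C unfolding ax[symmetric] .
    show ?thesis
      unfolding cpartial_def
    proof (rule the_equality)
      show "((\<lambda>t. f (z + axis j t)) has_derivative (\<lambda>t. t *\<^sub>C D (axis j 1))) (at 0)"
        by (rule d)
      fix d' assume "((\<lambda>t. f (z + axis j t)) has_derivative (\<lambda>t. t *\<^sub>C d')) (at 0)"
      from has_derivative_unique[OF this d] have "1 *\<^sub>C d' = 1 *\<^sub>C D (axis j 1)"
        by (rule fun_cong)
      then show "d' = D (axis j 1)"
        by (simp add: scaleC_one)
    qed
  qed
  have lin: "linear D"
    using has_derivative_linear[OF D] .
  have "radial_deriv f z = (\<Sum>j\<in>UNIV. D (z $ j *s axis j 1))"
    by (simp add: radial_deriv_def cp C)
  also have "\<dots> = D (\<Sum>j\<in>UNIV. z $ j *s axis j 1)"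
    by (rule linear_sum[OF lin, symmetric])
  also have "(\<Sum>j\<in>UNIV. z $ j *s axis j 1) = z"
    by (rule basis_expansion)
  finally show ?thesis .
qed

lemma holomorphicE:
  assumes "f \<in> holomorphic S" "z \<in> S"
  obtains D where "(f has_derivative D) (at z)" "\<And>c v. D (c *s v) = c *\<^sub>C D v" "radial_deriv f z = D z"
  using assms radial_deriv_eq unfolding holomorphic_def by blast

text \<open>Radial derivatives are local, so a formula valid only on the ball may be differentiated;
  the iterates are known only there.\<close>

lemma holomorphic_cong:
  assumes f: "f \<in> holomorphic S" and eq: "\<And>z. z \<in> S \<Longrightarrow> f z = g z"
  shows "g \<in> holomorphic S" and "z \<in> S \<Longrightarrow> radial_deriv g z = radial_deriv f z"
proof -
  have S: "open S"
    using f by (simp add: holomorphic_def)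
  have D: "(g has_derivative D) (at z)" if "(f has_derivative D) (at z)" "z \<in> S" for z D
    using has_derivative_transform_within_open[OF that(1) S that(2) eq] .
  show "g \<in> holomorphic S"
    using f D unfolding holomorphic_def by blast
  show "radial_deriv g z = radial_deriv f z" if z: "z \<in> S"
    using f z
  proof (rule holomorphicE)
    fix D assume "(f has_derivative D) (at z)" "\<And>c v. D (c *s v) = c *\<^sub>C D v" "radial_deriv f z = D z"
    then show ?thesis
      using radial_deriv_eq[OF D[OF _ z]] by metis
  qed
qed

lemma holomorphic_lincomb:
  fixes f :: "'i \<Rightarrow> complex ^ 'n \<Rightarrow> 'a::complex_normed_vector" and c :: "'i \<Rightarrow> real"
  assumes f: "\<And>i. i \<in> I \<Longrightarrow> f i \<in> holomorphic S" and S: "open S"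
  shows "(\<lambda>z. \<Sum>i\<in>I. c i *\<^sub>R f i z) \<in> holomorphic S"
    and "z \<in> S \<Longrightarrow> radial_deriv (\<lambda>z. \<Sum>i\<in>I. c i *\<^sub>R f i z) z = (\<Sum>i\<in>I. c i *\<^sub>R radial_deriv (f i) z)"
proof -
  have *: "\<exists>D. ((\<lambda>z. \<Sum>i\<in>I. c i *\<^sub>R f i z) has_derivative D) (at z) \<and> (\<forall>c v. D (c *s v) = c *\<^sub>C D v) \<and>
      D z = (\<Sum>i\<in>I. c i *\<^sub>R radial_deriv (f i) z)" if z: "z \<in> S" for z
  proof -
    have "\<forall>i\<in>I. \<exists>D. (f i has_derivative D) (at z) \<and> (\<forall>c v. D (c *s v) = c *\<^sub>C D v) \<and> radial_deriv (f i) z = D z"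
      using holomorphicE[OF f z] by metis
    then obtain D where D: "\<And>i. i \<in> I \<Longrightarrow> (f i has_derivative D i) (at z)"
      "\<And>i c v. i \<in> I \<Longrightarrow> D i (c *s v) = c *\<^sub>C D i v" "\<And>i. i \<in> I \<Longrightarrow> radial_deriv (f i) z = D i z"
      by metis
    have sw: "r *\<^sub>R k *\<^sub>C x = k *\<^sub>C r *\<^sub>R x" for r k and x :: 'a
      by (simp add: scaleR_scaleC scaleC_scaleC mult.commute)
    have "((\<lambda>z. \<Sum>i\<in>I. c i *\<^sub>R f i z) has_derivative (\<lambda>v. \<Sum>i\<in>I. c i *\<^sub>R D i v)) (at z)"
      by (intro has_derivative_sum has_derivative_scaleR_right D)
    moreover have "(\<Sum>i\<in>I. c i *\<^sub>R D i (k *s v)) = k *\<^sub>C (\<Sum>i\<in>I. c i *\<^sub>R D i v)" for k v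
      by (simp add: linear_sum[OF bounded_linear.linear[OF bounded_linear_scaleC]] D(2) sw)
    moreover have "(\<Sum>i\<in>I. c i *\<^sub>R D i z) = (\<Sum>i\<in>I. c i *\<^sub>R radial_deriv (f i) z)"
      by (simp add: D(3))
    ultimately show ?thesis
      by (intro exI[of _ "\<lambda>v. \<Sum>i\<in>I. c i *\<^sub>R D i v"]) blast
  qed
  then show "(\<lambda>z. \<Sum>i\<in>I. c i *\<^sub>R f i z) \<in> holomorphic S"
    using S unfolding holomorphic_def by blast
  show "radial_deriv (\<lambda>z. \<Sum>i\<in>I. c i *\<^sub>R f i z) z = (\<Sum>i\<in>I. c i *\<^sub>R radial_deriv (f i) z)" if "z \<in> S"
    using *[OF that] radial_deriv_eq by metis
qed

lemma holomorphic_bounded_clinear: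
  assumes f: "f \<in> holomorphic S" and L: "bounded_linear L" "\<And>c x. L (c *\<^sub>C x) = c *\<^sub>C L x"
  shows "(\<lambda>z. L (f z)) \<in> holomorphic S"
proof -
  have "\<exists>D. ((\<lambda>z. L (f z)) has_derivative D) (at z) \<and> (\<forall>c v. D (c *s v) = c *\<^sub>C D v)" if z: "z \<in> S" for z
    using f z
  proof (rule holomorphicE)
    fix D assume D: "(f has_derivative D) (at z)" "\<And>c v. D (c *s v) = c *\<^sub>C D v"
    have "((\<lambda>z. L (f z)) has_derivative (\<lambda>v. L (D v))) (at z)"
      by (rule bounded_linear.has_derivative[OF L(1) D(1)])
    then show ?thesis
      by (intro exI[of _ "\<lambda>v. L (D v)"]) (simp add: D(2) L(2))
  qed
  then show ?thesis
    using f unfolding holomorphic_def by blast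
qed

lemma holomorphic_functional:
  assumes "f \<in> holomorphic S" "complex_functional \<phi>"
  shows "(\<lambda>z. \<phi> (f z)) \<in> holomorphic S"
  by (rule holomorphic_bounded_clinear[OF assms(1) complex_functional_linear(6)[OF assms(2)]])
    (simp only: complex_functional_linear(3)[OF assms(2)] scaleC_complex_def)

lemma radial_deriv_kernel_integral:
  fixes F :: "complex ^ 'n \<Rightarrow> 'a::cbanach"
  assumes "\<alpha> > -1" "ball_integrable \<alpha> F" "s \<ge> 0" "norm z < 1"
  shows "radial_deriv (kernel_integral \<alpha> F s) z = s *\<^sub>R (kernel_integral \<alpha> F (s + 1) z - kernel_integral \<alpha> F s z)"
  using radial_deriv_eq[OF kernel_integral_derivative(1,2)[OF assms]] kernel_integral_derivative(3)[OF assms]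
  by simp

lemma kernel_integral_reproducing:
  fixes F :: "complex ^ 'n \<Rightarrow> 'a::cbanach"
  assumes \<alpha>: "\<alpha> > -1" and hol: "F \<in> holomorphic unit_ball" and F: "ball_integrable \<alpha> F" and z: "norm z < 1"
  shows "kernel_integral \<alpha> F (real CARD('n) + 1 + \<alpha>) z = nu_mass TYPE('n) \<alpha> *\<^sub>R F z"
proof (rule complex_functional_eqI)
  let ?N = "real CARD('n) + 1 + \<alpha>"
  fix \<phi> :: "'a \<Rightarrow> complex" assume \<phi>: "complex_functional \<phi>"
  have N: "?N \<ge> 0"
    using \<alpha> by simp
  have "\<phi> (kernel_integral \<alpha> F ?N z) = (\<integral>w. \<phi> (bergman_kernel ?N z w *\<^sub>C F w) \<partial>nu \<alpha>)"
    unfolding kernel_integral_def by (rule functional_bochner_int[OF \<alpha> ball_integrable_kernel[OF F N z] \<phi>])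
  also have "\<dots> = (\<integral>w. \<phi> (F w) * bergman_kernel ?N z w \<partial>nu \<alpha>)"
    by (simp only: complex_functional_linear[OF \<phi>] mult.commute)
  also have "\<dots> = nu_mass TYPE('n) \<alpha> *\<^sub>R \<phi> (F z)"
    by (rule bergman_reproducing[OF holomorphic_functional[OF hol \<phi>] \<alpha> integrable_functional[OF \<alpha> F \<phi>] z])
  finally show "\<phi> (kernel_integral \<alpha> F ?N z) = \<phi> (nu_mass TYPE('n) \<alpha> *\<^sub>R F z)"
    by (simp add: complex_functional_linear[OF \<phi>] scaleR_conv_of_real)
qed

section \<open>Iterated radial derivatives versus kernel integrals\<close>

lemma sum_shift_difference:
  fixes K :: "nat \<Rightarrow> 'a::real_vector"
  shows "(\<Sum>j\<le>k. a j *\<^sub>R (K (Suc j) - K j)) =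
    (\<Sum>i\<le>Suc k. ((if i = 0 then 0 else a (i - 1)) - (if i \<le> k then a i else 0)) *\<^sub>R K i)"
proof -
  have "(\<Sum>i\<le>Suc k. ((if i = 0 then 0 else a (i - 1)) - (if i \<le> k then a i else 0)) *\<^sub>R K i) =
    (\<Sum>i\<le>Suc k. (if i = 0 then 0 else a (i - 1)) *\<^sub>R K i) - (\<Sum>i\<le>Suc k. (if i \<le> k then a i else 0) *\<^sub>R K i)"
    by (simp only: scaleR_diff_left sum_subtractf)
  also have "(\<Sum>i\<le>Suc k. (if i = 0 then 0 else a (i - 1)) *\<^sub>R K i) = (\<Sum>j\<le>k. a j *\<^sub>R K (Suc j))"
    by (subst sum.atMost_Suc_shift) simp
  also have "(\<Sum>i\<le>Suc k. (if i \<le> k then a i else 0) *\<^sub>R K i) = (\<Sum>j\<le>k. a j *\<^sub>R K j)"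
    by simp
  finally show ?thesis
    by (simp add: scaleR_diff_right sum_subtractf)
qed

text \<open>\<open>F\<close> is a multiple of its kernel integral of order \<open>N\<close>, and a
  radial derivative maps the kernel integral of order \<open>N + j\<close> to a combination of the
  orders \<open>N + j\<close> and \<open>N + j + 1\<close>. So \<open>k\<close> derivatives reach at
  most order \<open>N + k\<close>.\<close>

lemma radial_iterate_expansion:
  fixes F :: "complex ^ 'n \<Rightarrow> 'a::cbanach"
  assumes \<alpha>: "\<alpha> > -1" and hol: "F \<in> holomorphic unit_ball" and F: "ball_integrable \<alpha> F"
  defines "N \<equiv> real CARD('n) + 1 + \<alpha>"
  shows "\<exists>c. \<forall>z\<in>unit_ball. (radial_deriv ^^ k) F z = (\<Sum>j\<le>k. c j *\<^sub>R kernel_integral \<alpha> F (N + real j) z)"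
proof (induction k)
  case 0
  show ?case
  proof (intro exI[of _ "\<lambda>_. inverse (nu_mass TYPE('n) \<alpha>)"] ballI)
    fix z :: "complex ^ 'n" assume "z \<in> unit_ball"
    then have "kernel_integral \<alpha> F N z = nu_mass TYPE('n) \<alpha> *\<^sub>R F z"
      unfolding N_def by (intro kernel_integral_reproducing[OF \<alpha> hol F]) simp
    then show "(radial_deriv ^^ 0) F z = (\<Sum>j\<le>0. inverse (nu_mass TYPE('n) \<alpha>) *\<^sub>R kernel_integral \<alpha> F (N + real j) z)"
      using nu_mass_pos[OF \<alpha>, where 'n = 'n] by simp
  qed
next
  case (Suc k)
  then obtain c where c: "\<And>z. z \<in> unit_ball \<Longrightarrow> (radial_deriv ^^ k) F z = (\<Sum>j\<le>k. c j *\<^sub>R kernel_integral \<alpha> F (N + real j) z)"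
    by blast
  have N: "N + real j \<ge> 0" for j
    using \<alpha> by (simp add: N_def)
  define a where "a j = c j * (N + real j)" for j
  have "(radial_deriv ^^ Suc k) F z =
      (\<Sum>i\<le>Suc k. ((if i = 0 then 0 else a (i - 1)) - (if i \<le> k then a i else 0)) *\<^sub>R kernel_integral \<alpha> F (N + real i) z)"
    if z: "z \<in> unit_ball" for z
  proof -
    have hk: "\<And>j. j \<in> {..k} \<Longrightarrow> kernel_integral \<alpha> F (N + real j) \<in> holomorphic unit_ball"
      by (rule holomorphic_kernel_integral[OF \<alpha> F N])
    have "(radial_deriv ^^ Suc k) F z = radial_deriv ((radial_deriv ^^ k) F) z"
      by simp
    also have "\<dots> = radial_deriv (\<lambda>z. \<Sum>j\<le>k. c j *\<^sub>R kernel_integral \<alpha> F (N + real j) z) z"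
      by (rule holomorphic_cong(2)[OF holomorphic_lincomb(1)[OF hk]]) (use c z in auto)
    also have "\<dots> = (\<Sum>j\<le>k. c j *\<^sub>R radial_deriv (kernel_integral \<alpha> F (N + real j)) z)"
      by (rule holomorphic_lincomb(2)[OF hk _ z]) auto
    also have "\<dots> = (\<Sum>j\<le>k. a j *\<^sub>R (kernel_integral \<alpha> F (N + real (Suc j)) z - kernel_integral \<alpha> F (N + real j) z))"
      using z by (simp add: radial_deriv_kernel_integral[OF \<alpha> F N] a_def add_ac)
    also have "\<dots> = (\<Sum>i\<le>Suc k. ((if i = 0 then 0 else a (i - 1)) - (if i \<le> k then a i else 0)) *\<^sub>R kernel_integral \<alpha> F (N + real i) z)"
      by (rule sum_shift_difference)
    finally show ?thesis .
  qed
  then show ?case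
    by (intro exI[of _ "\<lambda>i. (if i = 0 then 0 else a (i - 1)) - (if i \<le> k then a i else 0)"] ballI)
qed

text \<open>Read off from the expansion, as a finite combination of kernel integrals is
  holomorphic.\<close>

lemma radial_iterate_holomorphic:
  fixes F :: "complex ^ 'n \<Rightarrow> 'a::cbanach"
  assumes \<alpha>: "\<alpha> > -1" and hol: "F \<in> holomorphic unit_ball" and F: "ball_integrable \<alpha> F"
  shows "(radial_deriv ^^ k) F \<in> holomorphic unit_ball"
proof -
  obtain c where c: "\<forall>z\<in>unit_ball. (radial_deriv ^^ k) F z = (\<Sum>j\<le>k. c j *\<^sub>R kernel_integral \<alpha> F (real CARD('n) + 1 + \<alpha> + real j) z)"
    using radial_iterate_expansion[OF assms] by blast
  show ?thesis
    by (rule holomorphic_cong(1)[OF holomorphic_lincomb(1)[where I = "{..k}" and c = c]])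
      (use c in \<open>auto intro!: holomorphic_kernel_integral[OF \<alpha> F] simp: \<alpha>[THEN less_imp_le]\<close>, use \<alpha> in linarith)
qed

text \<open>The converse: the derivative relation is solved for the kernel integral of the next
  order, which is possible because \<open>N + k > 0\<close>.\<close>

lemma kernel_integral_expansion:
  fixes F :: "complex ^ 'n \<Rightarrow> 'a::cbanach"
  assumes \<alpha>: "\<alpha> > -1" and hol: "F \<in> holomorphic unit_ball" and F: "ball_integrable \<alpha> F"
  defines "N \<equiv> real CARD('n) + 1 + \<alpha>"
  shows "\<exists>d. \<forall>z\<in>unit_ball. kernel_integral \<alpha> F (N + real k) z = (\<Sum>i\<le>k. d i *\<^sub>R (radial_deriv ^^ i) F z)"
proof (induction k)
  case 0
  show ?case
    by (intro exI[of _ "\<lambda>_. nu_mass TYPE('n) \<alpha>"] ballI)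
      (simp add: N_def kernel_integral_reproducing[OF \<alpha> hol F])
next
  case (Suc k)
  then obtain d where d: "\<And>z. z \<in> unit_ball \<Longrightarrow> kernel_integral \<alpha> F (N + real k) z = (\<Sum>i\<le>k. d i *\<^sub>R (radial_deriv ^^ i) F z)"
    by blast
  have N: "N + real k > 0"
    using \<alpha> by (simp add: N_def add_pos_nonneg)
  define e where "e i = (if i \<le> k then d i else 0) + (if i = 0 then 0 else d (i - 1) / (N + real k))" for i
  have "kernel_integral \<alpha> F (N + real (Suc k)) z = (\<Sum>i\<le>Suc k. e i *\<^sub>R (radial_deriv ^^ i) F z)" if z: "z \<in> unit_ball" for z
  proof -
    have hk: "\<And>i. i \<in> {..k} \<Longrightarrow> (radial_deriv ^^ i) F \<in> holomorphic unit_ball"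
      by (rule radial_iterate_holomorphic[OF \<alpha> hol F])
    have "(N + real k) *\<^sub>R (kernel_integral \<alpha> F (N + real k + 1) z - kernel_integral \<alpha> F (N + real k) z) =
        radial_deriv (kernel_integral \<alpha> F (N + real k)) z"
      using z N by (simp add: radial_deriv_kernel_integral[OF \<alpha> F less_imp_le])
    also have "\<dots> = radial_deriv (\<lambda>z. \<Sum>i\<le>k. d i *\<^sub>R (radial_deriv ^^ i) F z) z"
      by (rule holomorphic_cong(2)[OF holomorphic_lincomb(1)[OF hk]]) (use d z in auto)
    also have "\<dots> = (\<Sum>i\<le>k. d i *\<^sub>R (radial_deriv ^^ Suc i) F z)"
      by (subst holomorphic_lincomb(2)[OF hk _ z]) auto
    finally have eq: "(N + real k) *\<^sub>R (kernel_integral \<alpha> F (N + real k + 1) z - kernel_integral \<alpha> F (N + real k) z) =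
        (\<Sum>i\<le>k. d i *\<^sub>R (radial_deriv ^^ Suc i) F z)" .
    have "kernel_integral \<alpha> F (N + real k + 1) z - kernel_integral \<alpha> F (N + real k) z =
        inverse (N + real k) *\<^sub>R (\<Sum>i\<le>k. d i *\<^sub>R (radial_deriv ^^ Suc i) F z)"
      unfolding eq[symmetric] scaleR_scaleR using N by simp
    then have "kernel_integral \<alpha> F (N + real (Suc k)) z =
        (\<Sum>i\<le>k. d i *\<^sub>R (radial_deriv ^^ i) F z) + (\<Sum>i\<le>k. (d i / (N + real k)) *\<^sub>R (radial_deriv ^^ Suc i) F z)"
      using d[OF z] by (simp add: scaleR_sum_right algebra_simps divide_inverse)
    also have "(\<Sum>i\<le>k. (d i / (N + real k)) *\<^sub>R (radial_deriv ^^ Suc i) F z) =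
        (\<Sum>i\<le>Suc k. (if i = 0 then 0 else d (i - 1) / (N + real k)) *\<^sub>R (radial_deriv ^^ i) F z)"
      by (subst sum.atMost_Suc_shift) simp
    also have "(\<Sum>i\<le>k. d i *\<^sub>R (radial_deriv ^^ i) F z) = (\<Sum>i\<le>Suc k. (if i \<le> k then d i else 0) *\<^sub>R (radial_deriv ^^ i) F z)"
      by simp
    finally show ?thesis
      by (simp only: e_def scaleR_add_left sum.distrib)
  qed
  then show ?case
    by (intro exI[of _ e] ballI)
qed

section \<open>The spaces \<open>\<Gamma>\<^sub>\<gamma>\<close>\<close>

lemma one_minus_norm_power_pos: "norm z < 1 \<Longrightarrow> 0 < 1 - (norm z)\<^sup>2"
  using power_strict_mono[of "norm z" 1 2] by simp

text \<open>Along the ray the derivative of \<open>g (t *\<^sub>R z)\<close> is the radial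
  derivative divided by \<open>t\<close>, so integration starts at \<open>t = 1/2\<close>, where
  \<open>g\<close> is bounded by compactness. The exponent is kept, since lower iterates only have
  to match the growth of the top one.\<close>

lemma holomorphic_radial_descent:
  fixes g :: "complex ^ 'n \<Rightarrow> 'a::complex_normed_vector"
  assumes g: "g \<in> holomorphic unit_ball" and e: "e \<ge> 0"
    and M: "\<And>z. norm z < 1 \<Longrightarrow> norm (radial_deriv g z) \<le> M * (1 - (norm z)\<^sup>2) powr (- e)"
  shows "\<exists>M'. \<forall>z\<in>unit_ball. norm (g z) \<le> M' * (1 - (norm z)\<^sup>2) powr (- e)"
proof -
  have cont: "continuous_on unit_ball g"
    by (rule holomorphic_imp_continuous_on[OF g])
  obtain K where K: "\<And>v. norm v \<le> 1 / 2 \<Longrightarrow> norm (g v) \<le> K"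
    using holomorphic_bounded_half_ball[OF g] by blast
  have K0: "K \<ge> 0" and M0: "M \<ge> 0"
    using K[of 0] norm_ge_zero[of "g 0"] M[of 0] norm_ge_zero[of "radial_deriv g 0"] by (simp_all del: norm_ge_zero)
  have "norm (g z) \<le> (K + M) * (1 - (norm z)\<^sup>2) powr (- e)" if "z \<in> unit_ball" for z
  proof -
    have z: "norm z < 1"
      using that by simp
    let ?P = "(1 - (norm z)\<^sup>2) powr (- e)"
    have P1: "?P \<ge> 1"
      using powr_mono2'[of "- e" "1 - (norm z)\<^sup>2" 1] one_minus_norm_power_pos[OF z] e by simp
    define h where "h t = g (t *\<^sub>R z)" for t :: real
    have tz: "norm (t *\<^sub>R z) < 1" "norm (t *\<^sub>R z) \<le> norm z" if "t \<in> {1/2..1}" for t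
    proof -
      have "\<bar>t\<bar> * norm z \<le> 1 * norm z"
        using that by (intro mult_right_mono) auto
      then show "norm (t *\<^sub>R z) < 1" "norm (t *\<^sub>R z) \<le> norm z"
        using z by auto
    qed
    \<comment> \<open>The factor 2 bounds \<open>1 / t\<close> on [1/2, 1] and is undone by the
      length of the interval.\<close>
    have "norm (h 1 - h (1/2)) \<le> (2 * M * ?P) * norm (1 - 1/2 :: real)"
    proof (rule differentiable_bound[where S = "{1/2..1}" and f' = "\<lambda>t s. s *\<^sub>R ((1 / t) *\<^sub>R radial_deriv g (t *\<^sub>R z))"])
      fix t :: real assume t: "t \<in> {1/2..1}"
      have "t *\<^sub>R z \<in> unit_ball"
        using tz(1)[OF t] by simp
      with g show "(h has_derivative (\<lambda>s. s *\<^sub>R ((1 / t) *\<^sub>R radial_deriv g (t *\<^sub>R z)))) (at t within {1/2..1})"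
      proof (rule holomorphicE)
        fix D assume D: "(g has_derivative D) (at (t *\<^sub>R z))" "radial_deriv g (t *\<^sub>R z) = D (t *\<^sub>R z)"
        have "(h has_derivative (\<lambda>s. D (s *\<^sub>R z))) (at t)"
          unfolding h_def by (rule has_derivative_compose[where f = "\<lambda>t. t *\<^sub>R z" and g = g, OF _ D(1)]) (auto intro!: derivative_eq_intros)
        moreover have "D (s *\<^sub>R z) = s *\<^sub>R ((1 / t) *\<^sub>R radial_deriv g (t *\<^sub>R z))" for s
          using t linear_scale[OF has_derivative_linear[OF D(1)]] by (simp add: D(2))
        ultimately show ?thesis
          by (simp add: has_derivative_at_withinI)
      qed
      show "onorm (\<lambda>s. s *\<^sub>R ((1 / t) *\<^sub>R radial_deriv g (t *\<^sub>R z))) \<le> 2 * M * ?P"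
      proof (rule onorm_bound)
        fix s :: real
        have "norm (radial_deriv g (t *\<^sub>R z)) \<le> M * (1 - (norm (t *\<^sub>R z))\<^sup>2) powr (- e)"
          by (rule M[OF tz(1)[OF t]])
        also have "\<dots> \<le> M * ?P"
          using tz(2)[OF t] one_minus_norm_power_pos[OF z] M0 e
          by (intro mult_left_mono powr_mono2') (auto intro!: power_mono simp del: norm_scaleR)
        finally have "norm (radial_deriv g (t *\<^sub>R z)) \<le> M * ?P" .
        moreover have "\<bar>1 / t\<bar> \<le> 2"
          using t by (auto simp: field_simps)
        ultimately have "\<bar>1 / t\<bar> * norm (radial_deriv g (t *\<^sub>R z)) \<le> 2 * (M * ?P)"
          by (intro mult_mono) auto
        then have "\<bar>s\<bar> * (\<bar>1 / t\<bar> * norm (radial_deriv g (t *\<^sub>R z))) \<le> \<bar>s\<bar> * (2 * (M * ?P))"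
          by (intro mult_left_mono) auto
        then show "norm (s *\<^sub>R ((1 / t) *\<^sub>R radial_deriv g (t *\<^sub>R z))) \<le> 2 * M * ?P * norm s"
          by (simp add: mult_ac)
      qed (use M0 in simp)
    qed auto
    then have "norm (g z - g ((1/2) *\<^sub>R z)) \<le> M * ?P"
      by (simp add: h_def)
    moreover have "norm (g ((1/2) *\<^sub>R z)) \<le> K * 1"
      using K[of "(1/2) *\<^sub>R z"] z by simp
    moreover have "K * 1 \<le> K * ?P"
      using P1 K0 by (rule mult_left_mono)
    ultimately show ?thesis
      using norm_triangle_ineq2[of "g z" "g ((1/2) *\<^sub>R z)"] by (simp add: distrib_right)
  qed
  then show ?thesis by blast
qed

text \<open>The definition controls only the iterate of order \<open>k\<close>. Descent carries its
  growth rate to all lower iterates, whose combinations include the kernel integral of order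
  \<open>N + k\<close>.\<close>

lemma Gamma_space_kernel_bound:
  fixes F :: "complex ^ 'n \<Rightarrow> 'a::cbanach"
  assumes \<alpha>: "\<alpha> > -1" and F: "ball_integrable \<alpha> F" and G: "F \<in> Gamma_space \<gamma>"
  obtains k :: nat and M where "real k > \<gamma>" "\<And>z. norm z < 1 \<Longrightarrow>
    norm (kernel_integral \<alpha> F (real CARD('n) + 1 + \<alpha> + real k) z) \<le> M * (1 - (norm z)\<^sup>2) powr (\<gamma> - real k)"
proof -
  let ?P = "\<lambda>k z. (1 - (norm (z :: complex ^ 'n))\<^sup>2) powr (- (real k - \<gamma>))"
  obtain k where hol: "F \<in> holomorphic unit_ball" and k: "real k > \<gamma>" and
    fin: "ennreal (norm (F 0)) + (SUP z\<in>unit_ball. ennreal ((1 - (norm z)\<^sup>2) powr (real k - \<gamma>) * norm ((radial_deriv ^^ k) F z))) < \<infinity>"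
    using G unfolding Gamma_space_def by blast
  from fin have "(SUP z\<in>unit_ball. ennreal ((1 - (norm z)\<^sup>2) powr (real k - \<gamma>) * norm ((radial_deriv ^^ k) F z))) < \<infinity>"
    by simp
  then obtain M where M: "M \<ge> 0" "(SUP z\<in>unit_ball. ennreal ((1 - (norm z)\<^sup>2) powr (real k - \<gamma>) * norm ((radial_deriv ^^ k) F z))) = ennreal M"
    by (cases "SUP z\<in>unit_ball. ennreal ((1 - (norm z)\<^sup>2) powr (real k - \<gamma>) * norm ((radial_deriv ^^ k) F z))") auto
  have top: "norm ((radial_deriv ^^ k) F z) \<le> M * ?P k z" if "z \<in> unit_ball" for z
  proof -
    have "ennreal ((1 - (norm z)\<^sup>2) powr (real k - \<gamma>) * norm ((radial_deriv ^^ k) F z)) \<le> ennreal M"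
      unfolding M(2)[symmetric] using that by (rule SUP_upper)
    then have "(1 - (norm z)\<^sup>2) powr (real k - \<gamma>) * norm ((radial_deriv ^^ k) F z) \<le> M"
      using M(1) by simp
    moreover have "0 < 1 - (norm z)\<^sup>2"
      using that by (intro one_minus_norm_power_pos) simp
    ultimately show ?thesis
      by (subst powr_minus) (simp add: field_simps)
  qed
  \<comment> \<open>The induction runs downwards from order \<open>k\<close>; \<open>i\<close>
    counts the derivatives removed.\<close>
  have all: "\<exists>M. \<forall>z\<in>unit_ball. norm ((radial_deriv ^^ (k - i)) F z) \<le> M * ?P k z" if "i \<le> k" for i
    using that
  proof (induction i)
    case 0
    show ?case
      using top by (intro exI[of _ M] ballI) simp
  next
    case (Suc i)
    from Suc.IH[OF Suc_leD[OF Suc.prems]] obtain M where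
      M: "\<And>z. z \<in> unit_ball \<Longrightarrow> norm ((radial_deriv ^^ (k - i)) F z) \<le> M * ?P k z"
      by blast
    have eq: "k - i = Suc (k - Suc i)"
      using Suc.prems by simp
    show ?case
      by (rule holomorphic_radial_descent[OF radial_iterate_holomorphic[OF \<alpha> hol F]])
        (use M k in \<open>auto simp: eq\<close>)
  qed
  have "\<forall>i\<in>{..k}. \<exists>M. \<forall>z\<in>unit_ball. norm ((radial_deriv ^^ i) F z) \<le> M * ?P k z"
    using all by (metis atMost_iff diff_diff_cancel diff_le_self)
  then obtain m where m: "\<And>i z. i \<le> k \<Longrightarrow> z \<in> unit_ball \<Longrightarrow> norm ((radial_deriv ^^ i) F z) \<le> m i * ?P k z"
    unfolding Ball_def by (metis atMost_iff)
  obtain d where d: "\<forall>z\<in>unit_ball. kernel_integral \<alpha> F (real CARD('n) + 1 + \<alpha> + real k) z = (\<Sum>i\<le>k. d i *\<^sub>R (radial_deriv ^^ i) F z)"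
    using kernel_integral_expansion[OF \<alpha> hol F] by blast
  show ?thesis
  proof (rule that[OF k])
    fix z :: "complex ^ 'n" assume z: "norm z < 1"
    then have "norm (kernel_integral \<alpha> F (real CARD('n) + 1 + \<alpha> + real k) z) \<le> (\<Sum>i\<le>k. \<bar>d i\<bar> * (m i * ?P k z))"
      using d m by (auto intro!: sum_norm_le mult_left_mono)
    also have "\<dots> = (\<Sum>i\<le>k. \<bar>d i\<bar> * m i) * (1 - (norm z)\<^sup>2) powr (\<gamma> - real k)"
      by (simp add: sum_distrib_right mult.assoc)
    finally show "norm (kernel_integral \<alpha> F (real CARD('n) + 1 + \<alpha> + real k) z) \<le>
        (\<Sum>i\<le>k. \<bar>d i\<bar> * m i) * (1 - (norm z)\<^sup>2) powr (\<gamma> - real k)" .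
  qed
qed

text \<open>The iterate of order \<open>k\<close> is a combination of the kernel integrals of orders
  \<open>N\<close> to \<open>N + k\<close>; one common growth rate for all of them is therefore
  enough.\<close>

lemma Gamma_spaceI:
  fixes F :: "complex ^ 'n \<Rightarrow> 'a::cbanach"
  assumes \<alpha>: "\<alpha> > -1" and hol: "F \<in> holomorphic unit_ball" and F: "ball_integrable \<alpha> F" and k: "real k > \<gamma>"
    and M: "\<And>j z. j \<le> k \<Longrightarrow> norm z < 1 \<Longrightarrow>
      norm (kernel_integral \<alpha> F (real CARD('n) + 1 + \<alpha> + real j) z) \<le> M * (1 - (norm z)\<^sup>2) powr (\<gamma> - real k)"
  shows "F \<in> Gamma_space \<gamma>"
proof -
  obtain c where c: "\<forall>z\<in>unit_ball. (radial_deriv ^^ k) F z = (\<Sum>j\<le>k. c j *\<^sub>R kernel_integral \<alpha> F (real CARD('n) + 1 + \<alpha> + real j) z)"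
    using radial_iterate_expansion[OF \<alpha> hol F] by blast
  have bound: "(1 - (norm z)\<^sup>2) powr (real k - \<gamma>) * norm ((radial_deriv ^^ k) F z) \<le> (\<Sum>j\<le>k. \<bar>c j\<bar> * M)"
    if z: "z \<in> unit_ball" for z
  proof -
    have pos: "0 < 1 - (norm z)\<^sup>2"
      using z by (intro one_minus_norm_power_pos) simp
    have "norm ((radial_deriv ^^ k) F z) \<le> (\<Sum>j\<le>k. \<bar>c j\<bar> * (M * (1 - (norm z)\<^sup>2) powr (\<gamma> - real k)))"
      using c M z by (auto intro!: sum_norm_le mult_left_mono)
    also have "\<dots> = (\<Sum>j\<le>k. \<bar>c j\<bar> * M) * (1 - (norm z)\<^sup>2) powr (\<gamma> - real k)"
      by (simp add: sum_distrib_right mult.assoc)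
    finally have "(1 - (norm z)\<^sup>2) powr (real k - \<gamma>) * norm ((radial_deriv ^^ k) F z) \<le>
        (1 - (norm z)\<^sup>2) powr (real k - \<gamma>) * ((\<Sum>j\<le>k. \<bar>c j\<bar> * M) * (1 - (norm z)\<^sup>2) powr (\<gamma> - real k))"
      by (intro mult_left_mono) auto
    also have "\<dots> = (\<Sum>j\<le>k. \<bar>c j\<bar> * M) * ((1 - (norm z)\<^sup>2) powr (real k - \<gamma>) * (1 - (norm z)\<^sup>2) powr (\<gamma> - real k))"
      by (simp only: mult_ac)
    also have "\<dots> = (\<Sum>j\<le>k. \<bar>c j\<bar> * M)"
      using pos by (simp flip: powr_add)
    finally show ?thesis .
  qed
  have "(SUP z\<in>unit_ball. ennreal ((1 - (norm z)\<^sup>2) powr (real k - \<gamma>) * norm ((radial_deriv ^^ k) F z))) \<le> ennreal (\<Sum>j\<le>k. \<bar>c j\<bar> * M)"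
    using bound by (intro SUP_least ennreal_leI)
  also have "\<dots> < \<infinity>"
    by simp
  finally show ?thesis
    using hol k unfolding Gamma_space_def by auto
qed

section \<open>Estimates for bounded holomorphic functions in Bergman spaces\<close>

lemma continuous_on_norm_powr:
  fixes f :: "complex ^ 'n \<Rightarrow> 'a::real_normed_vector"
  assumes "continuous_on S f" "p > 0"
  shows "continuous_on S (\<lambda>w. norm (f w) powr p)"
  using assms by (intro continuous_on_powr' continuous_intros) auto

lemma borel_measurable_nu_ennreal:
  fixes f :: "complex ^ 'n \<Rightarrow> real"
  assumes "continuous_on unit_ball f"
  shows "(\<lambda>w. ennreal (f w)) \<in> borel_measurable (nu \<alpha>)"
  by (rule measurable_compose[OF borel_measurable_nu_continuous_on[OF assms]]) simp

lemma continuous_on_one_minus_norm_powr: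
  "continuous_on unit_ball (\<lambda>w :: complex ^ 'n. (1 - (norm w)\<^sup>2) powr \<delta>)"
  using one_minus_norm_power_pos by (intro continuous_intros) (force simp: less_imp_neq[symmetric])

text \<open>A power of \<open>1 - (norm w)\<^sup>2\<close> can be absorbed into the measure at the
  cost of a quotient of normalizing constants.\<close>

lemma nn_integral_nu_change_weight:
  fixes g :: "complex ^ 'n \<Rightarrow> real"
  assumes \<alpha>: "\<alpha> > -1" and \<beta>: "\<alpha> + \<delta> > -1" and g: "continuous_on unit_ball g" "\<And>w. g w \<ge> 0"
  shows "(\<integral>\<^sup>+w. ennreal (g w) \<partial>nu (\<alpha> + \<delta>)) = ennreal (nu_factor TYPE('n) (\<alpha> + \<delta>) / nu_factor TYPE('n) \<alpha>) *
    (\<integral>\<^sup>+w. ennreal (g w * (1 - (norm w)\<^sup>2) powr \<delta>) \<partial>nu \<alpha>)"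
proof -
  let ?c = "nu_factor TYPE('n) \<alpha>" and ?d = "nu_factor TYPE('n) (\<alpha> + \<delta>)"
  have c: "?c > 0" "?d > 0"
    using nu_factor_pos[OF \<alpha>] nu_factor_pos[OF \<beta>] by auto
  have "(\<integral>\<^sup>+w. ennreal (g w) \<partial>nu (\<alpha> + \<delta>)) = ennreal ?d * (\<integral>\<^sup>+w. ennreal (ball_weight (\<alpha> + \<delta>) w) * ennreal (g w) \<partial>lborel)"
    by (rule nn_integral_nu[OF \<beta> borel_measurable_nu_ennreal[OF g(1)]])
  also have "(\<integral>\<^sup>+w. ennreal (ball_weight (\<alpha> + \<delta>) w) * ennreal (g w) \<partial>lborel) =
      (\<integral>\<^sup>+w. ennreal (ball_weight \<alpha> w) * ennreal (g w * (1 - (norm w)\<^sup>2) powr \<delta>) \<partial>lborel)"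
    using g(2) by (intro nn_integral_cong) (auto simp: ball_weight_def powr_add ennreal_mult'[symmetric] mult_ac)
  also have "ennreal ?d * \<dots> = ennreal (?d / ?c) * (ennreal ?c * \<dots>)"
    using c by (simp add: mult.assoc[symmetric] ennreal_mult'[symmetric])
  also have "ennreal ?c * (\<integral>\<^sup>+w. ennreal (ball_weight \<alpha> w) * ennreal (g w * (1 - (norm w)\<^sup>2) powr \<delta>) \<partial>lborel) =
      (\<integral>\<^sup>+w. ennreal (g w * (1 - (norm w)\<^sup>2) powr \<delta>) \<partial>nu \<alpha>)"
    by (rule nn_integral_nu[OF \<alpha> borel_measurable_nu_ennreal, symmetric])
      (intro continuous_on_mult g continuous_on_one_minus_norm_powr)
  finally show ?thesis .
qed

text \<open>Up to a constant, the integral is the mass of \<open>nu (\<alpha> + \<delta>)\<close>;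
  the exponent \<delta> may be negative.\<close>

lemma nn_integral_nu_power_finite:
  assumes \<alpha>: "\<alpha> > -1" and \<beta>: "\<alpha> + \<delta> > -1"
  shows "(\<integral>\<^sup>+w. ennreal ((1 - (norm (w :: complex ^ 'n))\<^sup>2) powr \<delta>) \<partial>nu \<alpha>) < \<infinity>"
proof -
  have "(\<integral>\<^sup>+w. ennreal 1 \<partial>(nu (\<alpha> + \<delta>) :: (complex ^ 'n) measure)) < \<infinity>"
    using finite_measure.emeasure_finite[OF finite_measure_nu[OF \<beta>, where 'n = 'n]] by (simp add: less_top[symmetric])
  then show ?thesis
    using nn_integral_nu_change_weight[OF \<alpha> \<beta>, of "\<lambda>_ :: complex ^ 'n. 1"] nu_factor_pos[OF \<alpha>, where 'n = 'n] nu_factor_pos[OF \<beta>, where 'n = 'n]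
    by (auto simp: ennreal_mult_less_top)
qed

lemma ball_integrable_bounded:
  fixes f :: "complex ^ 'n \<Rightarrow> 'a::real_normed_vector"
  assumes \<alpha>: "\<alpha> > -1" and "continuous_on unit_ball f" and M: "\<And>w. norm w < 1 \<Longrightarrow> norm (f w) \<le> M"
  shows "ball_integrable \<alpha> f"
proof -
  interpret finite_measure "nu \<alpha> :: (complex ^ 'n) measure"
    by (rule finite_measure_nu[OF \<alpha>])
  have "(\<integral>\<^sup>+w. ennreal (norm (f w)) \<partial>nu \<alpha>) \<le> (\<integral>\<^sup>+w. ennreal M \<partial>(nu \<alpha> :: (complex ^ 'n) measure))"
    using M by (intro nn_integral_mono ennreal_leI) simp
  also have "\<dots> < \<infinity>"
  proof -
    have "emeasure (nu \<alpha> :: (complex ^ 'n) measure) unit_ball < top"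
      using emeasure_finite[of unit_ball] unfolding infinity_ennreal_def less_top .
    then show ?thesis
      by (simp add: ennreal_mult_less_top)
  qed
  finally show ?thesis
    using assms by (simp add: ball_integrable_def)
qed

lemma hardy_infinityE:
  assumes "f \<in> hardy_infinity"
  obtains M where "f \<in> holomorphic unit_ball" "continuous_on unit_ball f" "M \<ge> 0" "\<And>w. norm w < 1 \<Longrightarrow> norm (f w) \<le> M"
proof -
  obtain M where "\<forall>x\<in>f ` unit_ball. norm x \<le> M"
    using assms unfolding hardy_infinity_def bounded_iff by blast
  then have M: "norm (f w) \<le> M" if "norm w < 1" for w
    using that by simp
  have "M \<ge> 0"
    using M[of 0] norm_ge_zero[of "f 0"] by (simp del: norm_ge_zero)
  moreover have hol: "f \<in> holomorphic unit_ball"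
    using assms by (simp add: hardy_infinity_def)
  ultimately show ?thesis
    using M by (intro that[OF hol holomorphic_imp_continuous_on[OF hol]])
qed

lemma ball_integrable_hardy: "\<alpha> > -1 \<Longrightarrow> f \<in> hardy_infinity \<Longrightarrow> ball_integrable \<alpha> f"
  by (metis hardy_infinityE ball_integrable_bounded)

lemma hardy_infinityI:
  assumes "f \<in> holomorphic unit_ball" "\<And>w. norm w < 1 \<Longrightarrow> norm (f w) \<le> M"
  shows "f \<in> hardy_infinity"
  using assms unfolding hardy_infinity_def bounded_iff by (auto intro!: exI[of _ M])

lemma nn_integral_norm_powr_finite:
  fixes f :: "complex ^ 'n \<Rightarrow> 'a::complex_normed_vector"
  assumes \<alpha>: "\<alpha> > -1" and f: "f \<in> hardy_infinity" and p: "p > 0"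
  shows "(\<integral>\<^sup>+w. ennreal (norm (f w) powr p) \<partial>nu \<alpha>) < \<infinity>"
proof -
  obtain M where M: "f \<in> holomorphic unit_ball" "continuous_on unit_ball f" "M \<ge> 0" "\<And>w. norm w < 1 \<Longrightarrow> norm (f w) \<le> M"
    using hardy_infinityE[OF f] by blast
  have "ball_integrable \<alpha> (\<lambda>w. norm (f w) powr p)"
    by (rule ball_integrable_bounded[OF \<alpha> continuous_on_norm_powr[OF M(2) p], of "M powr p"])
      (use M p in \<open>auto intro!: powr_mono2\<close>)
  then show ?thesis
    by (simp add: ball_integrable_def)
qed

text \<open>Up to a constant the \<open>L^1\<close> norm for
  \<open>nu (\<alpha> + \<gamma>)\<close>, written over \<open>nu \<alpha>\<close> so that its
  integrand can be compared pointwise with that of the \<open>L^p\<close> norm.\<close>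

definition weighted_norm :: "real \<Rightarrow> real \<Rightarrow> (complex ^ 'n \<Rightarrow> 'a::real_normed_vector) \<Rightarrow> real"
  where "weighted_norm \<alpha> \<gamma> f = enn2real (\<integral>\<^sup>+w. ennreal (norm (f w) * (1 - (norm w)\<^sup>2) powr \<gamma>) \<partial>nu \<alpha>)"

lemma weighted_norm:
  fixes f :: "complex ^ 'n \<Rightarrow> 'a::cbanach"
  assumes \<alpha>: "\<alpha> > -1" and f: "f \<in> hardy_infinity" and \<gamma>: "\<gamma> \<ge> 0"
  shows "(\<integral>\<^sup>+w. ennreal (norm (f w) * (1 - (norm w)\<^sup>2) powr \<gamma>) \<partial>nu \<alpha>) = ennreal (weighted_norm \<alpha> \<gamma> f)" and "weighted_norm \<alpha> \<gamma> f \<ge> 0"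
proof -
  have "(\<integral>\<^sup>+w. ennreal (norm (f w) * (1 - (norm w)\<^sup>2) powr \<gamma>) \<partial>nu \<alpha>) \<le> (\<integral>\<^sup>+w. ennreal (norm (f w)) \<partial>nu \<alpha>)"
  proof (intro nn_integral_mono ennreal_leI)
    fix w :: "complex ^ 'n" assume "w \<in> space (nu \<alpha>)"
    then have "(1 - (norm w)\<^sup>2) powr \<gamma> \<le> 1"
      using \<gamma> one_minus_norm_power_pos[of w] by (intro powr_le1) auto
    then show "norm (f w) * (1 - (norm w)\<^sup>2) powr \<gamma> \<le> norm (f w)"
      by (rule mult_left_le) simp
  qed
  also have "\<dots> < \<infinity>"
    using ball_integrable_hardy[OF \<alpha> f] by (simp add: ball_integrable_def)
  finally show "(\<integral>\<^sup>+w. ennreal (norm (f w) * (1 - (norm w)\<^sup>2) powr \<gamma>) \<partial>nu \<alpha>) = ennreal (weighted_norm \<alpha> \<gamma> f)"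
    unfolding weighted_norm_def by simp
qed (simp add: weighted_norm_def)

text \<open>The reproducing formula for the weight \<alpha> + \<gamma>, with its kernel of exponent
  \<open>N + \<gamma>\<close> estimated by its supremum in \<open>w\<close>.\<close>

lemma hardy_pointwise_weighted:
  assumes \<alpha>: "\<alpha> > -1" and \<gamma>: "\<gamma> \<ge> 0"
  shows "\<exists>C>0. \<forall>(f :: complex ^ 'n \<Rightarrow> 'a::cbanach) z. f \<in> hardy_infinity \<longrightarrow> norm z < 1 \<longrightarrow>
    norm (f z) \<le> C * (1 - norm z) powr (- (real CARD('n) + 1 + \<alpha> + \<gamma>)) * weighted_norm \<alpha> \<gamma> f"
proof -
  let ?s = "real CARD('n) + 1 + (\<alpha> + \<gamma>)"
  let ?R = "nu_factor TYPE('n) (\<alpha> + \<gamma>) / nu_factor TYPE('n) \<alpha>"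
  have \<beta>: "\<alpha> + \<gamma> > -1"
    using \<alpha> \<gamma> by simp
  have R: "?R > 0"
    by (intro divide_pos_pos nu_factor_pos \<alpha> \<beta>)
  have m: "nu_mass TYPE('n) (\<alpha> + \<gamma>) > 0"
    by (rule nu_mass_pos[OF \<beta>])
  have s: "?s \<ge> 0"
    using \<beta> by simp
  have "norm (f z) \<le> (?R / nu_mass TYPE('n) (\<alpha> + \<gamma>)) * (1 - norm z) powr (- ?s) * weighted_norm \<alpha> \<gamma> f"
    if f: "f \<in> hardy_infinity" and z: "norm z < 1" for f :: "complex ^ 'n \<Rightarrow> 'a" and z
  proof (rule complex_functional_norm_le)
    fix \<phi> :: "'a \<Rightarrow> complex" assume \<phi>: "complex_functional \<phi>"
    have fb: "ball_integrable (\<alpha> + \<gamma>) f"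
      by (rule ball_integrable_hardy[OF \<beta> f])
    have hol: "f \<in> holomorphic unit_ball"
      using f by (simp add: hardy_infinity_def)
    have cont: "continuous_on unit_ball f"
      by (rule holomorphic_imp_continuous_on[OF hol])
    have eq: "kernel_integral (\<alpha> + \<gamma>) f ?s z = nu_mass TYPE('n) (\<alpha> + \<gamma>) *\<^sub>R f z"
      by (rule kernel_integral_reproducing[OF \<beta> hol fb z])
    have "norm (kernel_integral (\<alpha> + \<gamma>) f ?s z) \<le> (1 - norm z) powr (- ?s) * (?R * weighted_norm \<alpha> \<gamma> f)"
      unfolding kernel_integral_def
    proof (rule norm_bochner_int_le[OF \<beta> ball_integrable_kernel[OF fb s z]])
      have "(\<integral>\<^sup>+w. ennreal (norm (bergman_kernel ?s z w *\<^sub>C f w)) \<partial>nu (\<alpha> + \<gamma>)) \<le>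
          ennreal ((1 - norm z) powr (- ?s)) * (\<integral>\<^sup>+w. ennreal (norm (f w)) \<partial>nu (\<alpha> + \<gamma>))"
        by (rule nn_integral_norm_scaleC_le[OF cont norm_bergman_kernel_le[OF z less_imp_le s]]) auto
      also have "(\<integral>\<^sup>+w. ennreal (norm (f w)) \<partial>nu (\<alpha> + \<gamma>)) = ennreal ?R * ennreal (weighted_norm \<alpha> \<gamma> f)"
        unfolding weighted_norm(1)[OF \<alpha> f \<gamma>, symmetric]
        by (rule nn_integral_nu_change_weight[OF \<alpha> \<beta> continuous_on_norm[OF cont]]) simp
      finally show "(\<integral>\<^sup>+w. ennreal (norm (bergman_kernel ?s z w *\<^sub>C f w)) \<partial>nu (\<alpha> + \<gamma>)) \<le>
          ennreal ((1 - norm z) powr (- ?s) * (?R * weighted_norm \<alpha> \<gamma> f))"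
        by (simp only: ennreal_mult'[OF powr_ge_zero] ennreal_mult'[OF less_imp_le[OF R]])
    qed (intro mult_nonneg_nonneg powr_ge_zero less_imp_le[OF R] weighted_norm(2)[OF \<alpha> f \<gamma>])
    then have "nu_mass TYPE('n) (\<alpha> + \<gamma>) * norm (f z) \<le> (1 - norm z) powr (- ?s) * (?R * weighted_norm \<alpha> \<gamma> f)"
      using m by (simp add: eq)
    then have "norm (f z) \<le> ((1 - norm z) powr (- ?s) * (?R * weighted_norm \<alpha> \<gamma> f)) / nu_mass TYPE('n) (\<alpha> + \<gamma>)"
      unfolding pos_le_divide_eq[OF m] by (simp only: mult.commute)
    also have "\<dots> = (?R / nu_mass TYPE('n) (\<alpha> + \<gamma>)) * (1 - norm z) powr (- ?s) * weighted_norm \<alpha> \<gamma> f"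
      by simp
    finally show "cmod (\<phi> (f z)) \<le> (?R / nu_mass TYPE('n) (\<alpha> + \<gamma>)) * (1 - norm z) powr (- ?s) * weighted_norm \<alpha> \<gamma> f"
      using complex_functional_linear(5)[OF \<phi>, of "f z"] by linarith
  qed
  moreover have "?R / nu_mass TYPE('n) (\<alpha> + \<gamma>) > 0"
    using R m by (rule divide_pos_pos)
  moreover have "?s = real CARD('n) + 1 + \<alpha> + \<gamma>"
    by simp
  ultimately show ?thesis
    by metis
qed

text \<open>Both parts use that \<open>1 - (norm w)\<^sup>2\<close> is at most twice
  \<open>1 - norm w\<close>; they translate between the two measures of distance to the
  sphere.\<close>

lemma powr_one_minus_norm_le:
  assumes "norm w < 1" "e \<ge> 0"
  shows "(1 - norm w) powr (- e) \<le> 2 powr e * (1 - (norm w)\<^sup>2) powr (- e)"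
    and "(1 - (norm w)\<^sup>2) powr e \<le> 2 powr e * (1 - norm w) powr e"
proof -
  have le: "1 - (norm w)\<^sup>2 \<le> 2 * (1 - norm w)"
    using zero_le_power2[of "1 - norm w"] by (simp add: power2_eq_square algebra_simps)
  have pos: "1 - (norm w)\<^sup>2 > 0"
    using assms(1) by (rule one_minus_norm_power_pos)
  have "(2 * (1 - norm w)) powr (- e) = 2 powr (- e) * (1 - norm w) powr (- e)"
    by (rule powr_mult)
  then have "(1 - norm w) powr (- e) = 2 powr e * (2 * (1 - norm w)) powr (- e)"
    by (simp add: powr_minus)
  also have "\<dots> \<le> 2 powr e * (1 - (norm w)\<^sup>2) powr (- e)"
    using le pos assms by (intro mult_left_mono powr_mono2') auto
  finally show "(1 - norm w) powr (- e) \<le> 2 powr e * (1 - (norm w)\<^sup>2) powr (- e)" .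
  have "(1 - (norm w)\<^sup>2) powr e \<le> (2 * (1 - norm w)) powr e"
    using le pos assms by (intro powr_mono2) auto
  also have "\<dots> = 2 powr e * (1 - norm w) powr e"
    by (rule powr_mult)
  finally show "(1 - (norm w)\<^sup>2) powr e \<le> 2 powr e * (1 - norm w) powr e" .
qed

text \<open>
  Splitting \<open>norm f = norm f powr p * norm f powr (1 - p)\<close> and using the pointwise bound on the second
  factor gives \<open>E \<le> C * E powr (1 - p) * (norm of f) powr p\<close> for the weighted norm \<open>E\<close> of \<open>f\<close>; since \<open>f\<close> is bounded,
  \<open>E\<close> is finite and can be cancelled.
\<close>

lemma weighted_norm_le_bergman_norm:
  assumes \<alpha>: "\<alpha> > -1" and p: "0 < p" "p \<le> 1" and \<gamma>: "\<gamma> = (real CARD('n) + 1 + \<alpha>) * (1 / p - 1)"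
  shows "\<exists>C>0. \<forall>f :: complex ^ 'n \<Rightarrow> 'a::cbanach. f \<in> hardy_infinity \<longrightarrow> weighted_norm \<alpha> \<gamma> f \<le> C * bergman_norm p \<alpha> f"
proof -
  let ?N = "real CARD('n) + 1 + \<alpha>"
  have N: "?N > 0"
    using \<alpha> by (simp add: add_pos_nonneg)
  have \<gamma>0: "\<gamma> \<ge> 0"
    using N p unfolding \<gamma> by (intro mult_nonneg_nonneg) (auto simp: field_simps)
  \<comment> \<open>The identity that singles out \<gamma>: the pointwise bound raised to the power
    \<open>1 - p\<close> exactly consumes the weight.\<close>
  have s: "(?N + \<gamma>) * (1 - p) = \<gamma>"
    using p unfolding \<gamma> by (simp add: field_simps)
  obtain C where C: "C > 0" "\<And>(f :: complex ^ 'n \<Rightarrow> 'a) z. f \<in> hardy_infinity \<Longrightarrow> norm z < 1 \<Longrightarrow>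
      norm (f z) \<le> C * (1 - norm z) powr (- (?N + \<gamma>)) * weighted_norm \<alpha> \<gamma> f"
    using hardy_pointwise_weighted[OF \<alpha> \<gamma>0] by blast
  define K where "K = 2 powr \<gamma> * C powr (1 - p)"
  have K: "K > 0"
    using C by (simp add: K_def)
  have "weighted_norm \<alpha> \<gamma> f \<le> K powr (1 / p) * bergman_norm p \<alpha> f"
    if f: "f \<in> hardy_infinity" for f :: "complex ^ 'n \<Rightarrow> 'a"
  proof -
    define E where "E = weighted_norm \<alpha> \<gamma> f"
    define P where "P = enn2real (\<integral>\<^sup>+w. ennreal (norm (f w) powr p) \<partial>nu \<alpha>)"
    have cont: "continuous_on unit_ball f"
      using f by (rule hardy_infinityE)
    have P: "(\<integral>\<^sup>+w. ennreal (norm (f w) powr p) \<partial>nu \<alpha>) = ennreal P" "P \<ge> 0"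
      using nn_integral_norm_powr_finite[OF \<alpha> f p(1)] unfolding P_def by auto
    have bn: "bergman_norm p \<alpha> f = P powr (1 / p)"
      by (simp add: bergman_norm_def P_def)
    have E0: "E \<ge> 0"
      unfolding E_def by (rule weighted_norm(2)[OF \<alpha> f \<gamma>0])
    show ?thesis
    \<comment> \<open>Only a positive \<open>E\<close> allows the factor
      \<open>E powr (1 - p)\<close> to be divided out; for \<open>E = 0\<close> the claim is
      trivial.\<close>
    proof (cases "E = 0")
      case True
      then show ?thesis
        unfolding bn E_def[symmetric] by simp
    next
      case False
      with E0 have E: "E > 0" by simp
      have pt: "norm (f w) * (1 - (norm w)\<^sup>2) powr \<gamma> \<le> (K * E powr (1 - p)) * norm (f w) powr p" if w: "norm w < 1" for w
      proof (cases "f w = 0")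
        case False
        then have f0: "norm (f w) > 0" by simp
        have "norm (f w) powr (1 - p) \<le> (C * (1 - norm w) powr (- (?N + \<gamma>)) * E) powr (1 - p)"
          using C(2)[OF f w] p unfolding E_def by (intro powr_mono2) auto
        also have "\<dots> = C powr (1 - p) * (1 - norm w) powr (- \<gamma>) * E powr (1 - p)"
        proof -
          have "(C * A * E) powr (1 - p) = C powr (1 - p) * A powr (1 - p) * E powr (1 - p)" if "A \<ge> 0" for A
            using C(1) E that by (simp add: powr_mult)
          then show ?thesis
            by (simp only: powr_powr s minus_mult_left[symmetric] powr_ge_zero)
        qed
        finally have 1: "norm (f w) powr (1 - p) \<le> C powr (1 - p) * (1 - norm w) powr (- \<gamma>) * E powr (1 - p)" .
        have "norm (f w) powr (1 - p) * (1 - (norm w)\<^sup>2) powr \<gamma> \<le>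
            (C powr (1 - p) * (1 - norm w) powr (- \<gamma>) * E powr (1 - p)) * (2 powr \<gamma> * (1 - norm w) powr \<gamma>)"
          using 1 powr_one_minus_norm_le(2)[OF w \<gamma>0] by (intro mult_mono) auto
        also have "\<dots> = K * E powr (1 - p) * ((1 - norm w) powr (- \<gamma>) * (1 - norm w) powr \<gamma>)"
          by (simp add: K_def mult_ac)
        also have "(1 - norm w) powr (- \<gamma>) * (1 - norm w) powr \<gamma> = 1"
          using w by (simp flip: powr_add)
        finally have "norm (f w) powr p * (norm (f w) powr (1 - p) * (1 - (norm w)\<^sup>2) powr \<gamma>) \<le> norm (f w) powr p * (K * E powr (1 - p) * 1)"
          by (intro mult_left_mono) auto
        moreover have "norm (f w) powr p * norm (f w) powr (1 - p) = norm (f w)"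
          using f0 by (simp flip: powr_add)
        ultimately show ?thesis
          by (simp add: mult.assoc[symmetric]) (simp add: mult_ac)
      qed simp
      have "ennreal E = (\<integral>\<^sup>+w. ennreal (norm (f w) * (1 - (norm w)\<^sup>2) powr \<gamma>) \<partial>nu \<alpha>)"
        unfolding E_def by (rule weighted_norm(1)[OF \<alpha> f \<gamma>0, symmetric])
      also have "\<dots> \<le> (\<integral>\<^sup>+w. ennreal (K * E powr (1 - p)) * ennreal (norm (f w) powr p) \<partial>nu \<alpha>)"
        using K E by (intro nn_integral_mono) (auto simp: ennreal_mult'[symmetric] intro!: ennreal_leI pt)
      also have "\<dots> = ennreal (K * E powr (1 - p)) * ennreal P"
        unfolding P(1)[symmetric]
        by (rule nn_integral_cmult[OF borel_measurable_nu_ennreal[OF continuous_on_norm_powr[OF cont p(1)]]])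
      finally have "E \<le> (K * E powr (1 - p)) * P"
        using K E P(2) by (simp add: ennreal_mult'[symmetric])
      moreover have "E = E powr p * E powr (1 - p)"
        using E by (simp flip: powr_add)
      ultimately have "E powr p * E powr (1 - p) \<le> (K * P) * E powr (1 - p)"
        by (simp add: mult_ac)
      then have "E powr p \<le> K * P"
        using E by simp
      then have "(E powr p) powr (1 / p) \<le> (K * P) powr (1 / p)"
        using p by (intro powr_mono2) auto
      then show ?thesis
        using E p K P(2) unfolding bn E_def[symmetric] by (simp add: powr_powr powr_mult)
    qed
  qed
  then show ?thesis
    using K by (intro exI[of _ "K powr (1 / p)"]) auto
qed

section \<open>Point evaluation at the origin\<close>

lemma holomorphic_dilation:
  assumes f: "f \<in> holomorphic unit_ball" and r: "0 \<le> r" "r \<le> 1"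
  shows "(\<lambda>w. f (r *\<^sub>R w)) \<in> holomorphic unit_ball"
proof -
  have "\<exists>D. ((\<lambda>w. f (r *\<^sub>R w)) has_derivative D) (at z) \<and> (\<forall>c v. D (c *s v) = c *\<^sub>C D v)" if z: "z \<in> unit_ball" for z
  proof -
    have "r * norm z < 1"
      using z r mult_right_mono[of r 1 "norm z"] by simp
    then have "r *\<^sub>R z \<in> unit_ball"
      using r by simp
    with f show ?thesis
    proof (rule holomorphicE)
      fix D assume D: "(f has_derivative D) (at (r *\<^sub>R z))" "\<And>c v. D (c *s v) = c *\<^sub>C D v"
      have "((\<lambda>w. f (r *\<^sub>R w)) has_derivative (\<lambda>v. D (r *\<^sub>R v))) (at z)"
        by (rule has_derivative_compose[where f = "\<lambda>w. r *\<^sub>R w" and g = f, OF _ D(1)]) (auto intro!: derivative_eq_intros)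
      moreover have "D (r *\<^sub>R (c *s v)) = c *\<^sub>C D (r *\<^sub>R v)" for c v
      proof -
        have "r *\<^sub>R (c *s v) = c *s (r *\<^sub>R v)"
          by (simp add: vec_eq_iff)
        then show ?thesis
          by (simp add: D(2))
      qed
      ultimately show ?thesis
        by (intro exI[of _ "\<lambda>v. D (r *\<^sub>R v)"]) blast
    qed
  qed
  then show ?thesis
    unfolding holomorphic_def by auto
qed

lemma borel_measurable_ball_weight_times:
  fixes g :: "complex ^ 'n \<Rightarrow> real"
  assumes "continuous_on unit_ball g"
  shows "(\<lambda>w. ball_weight \<alpha> w * g w) \<in> borel_measurable borel"
proof -
  have [measurable]: "(\<lambda>w. indicator unit_ball w *\<^sub>R g w) \<in> borel_measurable borel"
    by (rule borel_measurable_continuous_on_indicator[OF _ assms]) simp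
  have eq: "(\<lambda>w. ball_weight \<alpha> w * g w) = (\<lambda>w. ball_weight \<alpha> w * (indicator unit_ball w *\<^sub>R g w))"
    by (auto simp: fun_eq_iff ball_weight_def indicator_def)
  have "(\<lambda>w. ball_weight \<alpha> w * (indicator unit_ball w *\<^sub>R g w)) \<in> borel_measurable borel"
    by measurable
  then show ?thesis
    unfolding eq .
qed

text \<open>On the ball of radius 1/2 the weight of exponent \<alpha> is bounded below. The dilated
  side carries exponent 0, because for negative \<alpha> the weight at \<open>2 *\<^sub>R w\<close>
  would be unbounded near radius 1/2.\<close>

lemma nn_integral_half_dilation_le:
  assumes \<alpha>: "\<alpha> > -1"
  shows "\<exists>K\<ge>0. \<forall>g :: complex ^ 'n \<Rightarrow> real. continuous_on unit_ball g \<longrightarrow> (\<forall>w. g w \<ge> 0) \<longrightarrow>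
    (\<integral>\<^sup>+w. ennreal (g ((1 / 2) *\<^sub>R w)) \<partial>nu 0) \<le> ennreal K * (\<integral>\<^sup>+w. ennreal (g w) \<partial>nu \<alpha>)"
proof -
  let ?c = "nu_factor TYPE('n) \<alpha>" and ?d = "nu_factor TYPE('n) 0"
  \<comment> \<open>There \<open>1 - (norm w)\<^sup>2\<close> lies between 3/4 and 1; the absolute
    value treats both signs of \<alpha> at once.\<close>
  define L where "L = (3 / 4 :: real) powr (- \<bar>\<alpha>\<bar>)"
  define K where "K = ?d * (2 ^ (2 * CARD('n)) * L) / ?c"
  have c: "?c > 0" "?d > 0"
    using nu_factor_pos[OF \<alpha>] nu_factor_pos[of 0] by auto
  have L: "L > 0"
    by (simp add: L_def)
  have wt: "ball_weight 0 (2 *\<^sub>R w) \<le> L * ball_weight \<alpha> w" for w :: "complex ^ 'n"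
  proof (cases "norm w < 1 / 2")
    case True
    then have "(norm w)\<^sup>2 \<le> (1 / 2)\<^sup>2"
      by (intro power_mono) auto
    then have t: "3 / 4 \<le> 1 - (norm w)\<^sup>2" "1 - (norm w)\<^sup>2 \<le> 1"
      by (auto simp: power2_eq_square)
    have "(3 / 4) powr \<bar>\<alpha>\<bar> \<le> (1 - (norm w)\<^sup>2) powr \<bar>\<alpha>\<bar>"
      using t by (intro powr_mono2) auto
    also have "\<dots> \<le> (1 - (norm w)\<^sup>2) powr \<alpha>"
      using t by (intro powr_mono') auto
    finally have "1 \<le> L * (1 - (norm w)\<^sup>2) powr \<alpha>"
      by (simp add: L_def powr_minus field_simps)
    \<comment> \<open>\<open>0 powr 0\<close> is 0, so the base must be known to be nonzero before
      the weight of exponent 0 evaluates to 1.\<close>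
    moreover have "(norm (2 *\<^sub>R w))\<^sup>2 \<noteq> 1"
      using True power_strict_mono[of "norm (2 *\<^sub>R w)" 1 2] by simp
    ultimately show ?thesis
      using True by (simp add: ball_weight_def)
  next
    case False
    then show ?thesis
      using L by (simp add: ball_weight_def)
  qed
  have "(\<integral>\<^sup>+w. ennreal (g ((1 / 2) *\<^sub>R w)) \<partial>nu 0) \<le> ennreal K * (\<integral>\<^sup>+w. ennreal (g w) \<partial>nu \<alpha>)"
    if g: "continuous_on unit_ball g" "\<And>w. g w \<ge> 0" for g :: "complex ^ 'n \<Rightarrow> real"
  proof -
    have gc: "continuous_on unit_ball (\<lambda>w. g ((1 / 2) *\<^sub>R w))"
      by (rule continuous_on_compose2[OF g(1)]) (auto intro!: continuous_intros)
    have mw: "(\<lambda>w. ennreal (ball_weight 0 w) * ennreal (g ((1 / 2) *\<^sub>R w))) \<in> borel_measurable borel"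
      using measurable_compose[OF borel_measurable_ball_weight_times[OF gc, of 0] measurable_ennreal]
      by (simp add: ennreal_mult')
    have mw': "(\<lambda>w. ennreal (ball_weight \<alpha> w) * ennreal (g w)) \<in> borel_measurable borel"
      using measurable_compose[OF borel_measurable_ball_weight_times[OF g(1), of \<alpha>] measurable_ennreal]
      by (simp add: ennreal_mult')
    have "(\<integral>\<^sup>+w. ennreal (g ((1 / 2) *\<^sub>R w)) \<partial>nu 0) = ennreal ?d * (\<integral>\<^sup>+w. ennreal (ball_weight 0 w) * ennreal (g ((1 / 2) *\<^sub>R w)) \<partial>lborel)"
      by (rule nn_integral_nu[OF _ borel_measurable_nu_ennreal[OF gc]]) simp
    also have "(\<integral>\<^sup>+w. ennreal (ball_weight 0 w) * ennreal (g ((1 / 2) *\<^sub>R w)) \<partial>lborel) =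
        ennreal (2 ^ (2 * CARD('n))) * (\<integral>\<^sup>+w. ennreal (ball_weight 0 (2 *\<^sub>R w)) * ennreal (g ((1 / 2) *\<^sub>R (2 *\<^sub>R w))) \<partial>lborel)"
      by (rule nn_integral_lborel_scale[OF mw]) simp
    also have "(\<integral>\<^sup>+w. ennreal (ball_weight 0 (2 *\<^sub>R w)) * ennreal (g ((1 / 2) *\<^sub>R (2 *\<^sub>R w))) \<partial>lborel) \<le>
        (\<integral>\<^sup>+w. ennreal L * (ennreal (ball_weight \<alpha> w) * ennreal (g w)) \<partial>lborel)"
    proof (rule nn_integral_mono)
      fix w
      have "ball_weight 0 (2 *\<^sub>R w) * g w \<le> L * ball_weight \<alpha> w * g w"
        using wt g(2) by (intro mult_right_mono)
      then show "ennreal (ball_weight 0 (2 *\<^sub>R w)) * ennreal (g ((1 / 2) *\<^sub>R (2 *\<^sub>R w))) \<le> ennreal L * (ennreal (ball_weight \<alpha> w) * ennreal (g w))"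
        using g(2) L by (simp add: ennreal_mult'[symmetric] mult.assoc ennreal_leI)
    qed
    also have "\<dots> = ennreal L * (\<integral>\<^sup>+w. ennreal (ball_weight \<alpha> w) * ennreal (g w) \<partial>lborel)"
      using mw' by (intro nn_integral_cmult) simp
    also have "ennreal ?d * (ennreal (2 ^ (2 * CARD('n))) * (ennreal L * (\<integral>\<^sup>+w. ennreal (ball_weight \<alpha> w) * ennreal (g w) \<partial>lborel))) =
        ennreal K * (ennreal ?c * (\<integral>\<^sup>+w. ennreal (ball_weight \<alpha> w) * ennreal (g w) \<partial>lborel))"
      using c L by (simp add: K_def mult.assoc[symmetric] ennreal_mult'[symmetric] del: ennreal_power ennreal_numeral)
    also have "ennreal ?c * (\<integral>\<^sup>+w. ennreal (ball_weight \<alpha> w) * ennreal (g w) \<partial>lborel) = (\<integral>\<^sup>+w. ennreal (g w) \<partial>nu \<alpha>)"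
      by (rule nn_integral_nu[OF \<alpha> borel_measurable_nu_ennreal[OF g(1)], symmetric])
    finally show ?thesis
      by (simp add: mult_left_mono)
  qed
  then show ?thesis
    using c L by (intro exI[of _ K]) (auto simp: K_def)
qed

lemma bergman_norm_mono:
  fixes f :: "complex ^ 'n \<Rightarrow> 'a::complex_normed_vector" and g :: "complex ^ 'm \<Rightarrow> 'b::complex_normed_vector"
  assumes le: "(\<integral>\<^sup>+w. ennreal (norm (f w) powr p) \<partial>nu \<alpha>) \<le> ennreal K * (\<integral>\<^sup>+w. ennreal (norm (g w) powr p) \<partial>nu \<beta>)"
    and fin: "(\<integral>\<^sup>+w. ennreal (norm (g w) powr p) \<partial>nu \<beta>) < \<infinity>" and "K \<ge> 0" "p > 0"
  shows "bergman_norm p \<alpha> f \<le> K powr (1 / p) * bergman_norm p \<beta> g"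
proof -
  have "enn2real (\<integral>\<^sup>+w. ennreal (norm (f w) powr p) \<partial>nu \<alpha>) \<le> enn2real (ennreal K * (\<integral>\<^sup>+w. ennreal (norm (g w) powr p) \<partial>nu \<beta>))"
    using fin by (intro enn2real_mono le) (simp add: ennreal_mult_less_top)
  also have "\<dots> = K * enn2real (\<integral>\<^sup>+w. ennreal (norm (g w) powr p) \<partial>nu \<beta>)"
    using assms(3) by (simp add: enn2real_mult)
  finally show ?thesis
    unfolding bergman_norm_def using assms(3,4) by (simp flip: powr_mult) (rule powr_mono2, auto)
qed

text \<open>The dilate \<open>h ((1 / 2) *\<^sub>R w)\<close> is bounded and has the same value at
  0, so the estimates for bounded functions apply to it with weight exponent 0; the dilation lemma
  returns to \<open>nu \<alpha>\<close>.\<close>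

lemma bergman_point_evaluation:
  assumes \<alpha>: "\<alpha> > -1" and q: "0 < q" "q \<le> 1"
  shows "\<exists>C>0. \<forall>h :: complex ^ 'n \<Rightarrow> 'a::cbanach. h \<in> bergman_space q \<alpha> \<longrightarrow> norm (h 0) \<le> C * bergman_norm q \<alpha> h"
proof -
  define \<gamma> where "\<gamma> = (real CARD('n) + 1 + 0) * (1 / q - 1)"
  have \<gamma>0: "\<gamma> \<ge> 0"
    using q unfolding \<gamma>_def by (intro mult_nonneg_nonneg) (auto simp: field_simps)
  obtain C1 where C1: "C1 > 0" "\<And>(f :: complex ^ 'n \<Rightarrow> 'a) z. f \<in> hardy_infinity \<Longrightarrow> norm z < 1 \<Longrightarrow>
      norm (f z) \<le> C1 * (1 - norm z) powr (- (real CARD('n) + 1 + 0 + \<gamma>)) * weighted_norm 0 \<gamma> f"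
    using hardy_pointwise_weighted[of 0 \<gamma>] \<gamma>0 by fastforce
  obtain C2 where C2: "C2 > 0" "\<And>f :: complex ^ 'n \<Rightarrow> 'a. f \<in> hardy_infinity \<Longrightarrow> weighted_norm 0 \<gamma> f \<le> C2 * bergman_norm q 0 f"
    using weighted_norm_le_bergman_norm[of 0 q \<gamma>] q \<gamma>_def by fastforce
  obtain K where K: "K \<ge> 0" "\<And>g :: complex ^ 'n \<Rightarrow> real. continuous_on unit_ball g \<Longrightarrow> (\<And>w. g w \<ge> 0) \<Longrightarrow>
      (\<integral>\<^sup>+w. ennreal (g ((1 / 2) *\<^sub>R w)) \<partial>nu 0) \<le> ennreal K * (\<integral>\<^sup>+w. ennreal (g w) \<partial>nu \<alpha>)"
    using nn_integral_half_dilation_le[OF \<alpha>, where 'n = 'n] by blast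
  \<comment> \<open>\<open>K\<close> is only known to be nonnegative; adding 1 makes the constant
    strictly positive.\<close>
  have "norm (h 0) \<le> (C1 * (C2 * (K powr (1 / q))) + 1) * bergman_norm q \<alpha> h"
    if h: "h \<in> bergman_space q \<alpha>" for h :: "complex ^ 'n \<Rightarrow> 'a"
  proof -
    have hol: "h \<in> holomorphic unit_ball" and fin: "(\<integral>\<^sup>+z. ennreal (norm (h z) powr q) \<partial>nu \<alpha>) < \<infinity>"
      using h by (auto simp: bergman_space_def)
    have cont: "continuous_on unit_ball h"
      by (rule holomorphic_imp_continuous_on[OF hol])
    let ?g = "\<lambda>w. h ((1 / 2) *\<^sub>R w)"
      obtain M where M: "\<And>v. norm v \<le> 1 / 2 \<Longrightarrow> norm (h v) \<le> M"
      using holomorphic_bounded_half_ball[OF hol] by blast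
    have g: "?g \<in> hardy_infinity"
      by (rule hardy_infinityI[OF holomorphic_dilation[OF hol], of _ M]) (auto intro!: M)
    have "norm (?g 0) \<le> C1 * (1 - norm (0 :: complex ^ 'n)) powr (- (real CARD('n) + 1 + 0 + \<gamma>)) * weighted_norm 0 \<gamma> ?g"
      by (rule C1(2)[OF g]) simp
    also have "\<dots> = C1 * weighted_norm 0 \<gamma> ?g"
      by simp
    also have "\<dots> \<le> C1 * (C2 * bergman_norm q 0 ?g)"
      using C1(1) by (intro mult_left_mono C2(2)[OF g]) simp
    also have "\<dots> \<le> C1 * (C2 * (K powr (1 / q) * bergman_norm q \<alpha> h))"
    proof -
      have "bergman_norm q 0 ?g \<le> K powr (1 / q) * bergman_norm q \<alpha> h"
        by (rule bergman_norm_mono[OF K(2)[OF continuous_on_norm_powr[OF cont q(1)]] fin K(1) q(1)]) simp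
      then show ?thesis
        using C1(1) C2(1) by (intro mult_left_mono) auto
    qed
    also have "\<dots> \<le> (C1 * (C2 * (K powr (1 / q))) + 1) * bergman_norm q \<alpha> h"
      by (simp add: bergman_norm_def distrib_right mult.assoc)
    finally show ?thesis by simp
  qed
  moreover have "C1 * (C2 * (K powr (1 / q))) + 1 > 0"
    using C1(1) C2(1) by (intro add_nonneg_pos mult_nonneg_nonneg) auto
  ultimately show ?thesis
    by blast
qed

section \<open>The pairing of a symbol with a bounded holomorphic function\<close>

lemma bounded_bilinear_clinop_apply:
  "bounded_bilinear (clinop_apply :: ('a::complex_normed_vector \<Rightarrow>\<^sub>C\<^sub>L 'b::complex_normed_vector) \<Rightarrow> 'a \<Rightarrow> 'b)"
proof
  show "\<exists>K. \<forall>(f :: 'a \<Rightarrow>\<^sub>C\<^sub>L 'b) x. norm (clinop_apply f x) \<le> norm f * norm x * K"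
    by (intro exI[of _ 1]) (simp add: norm_clinop_apply)
qed (simp_all add: clinop_apply_add_left clinop_apply_scaleR_left
    linear_add[OF bounded_linear.linear[OF bounded_linear_clinop_apply]]
    linear_scale[OF bounded_linear.linear[OF bounded_linear_clinop_apply]])

lemma bounded_linear_conj_vec: "bounded_linear (conj_vec :: 'x::complex_normed_vector \<Rightarrow> 'x conj_space)"
  by (rule bounded_linear_intro[where K = 1])
    (simp_all add: conj_vec_add scaleR_scaleC conj_vec_scaleC norm_conj_vec)

lemma surj_conj_vec: "\<exists>x. y = conj_vec x"
  by transfer auto

text \<open>Extending by 0 off the open product gives a Borel function on the full space, where the
  Borel sets of a product are those of the product algebra.\<close>

lemma borel_measurable_pair_nu:
  fixes \<Phi> :: "(complex ^ 'n) \<times> (complex ^ 'n) \<Rightarrow> complex"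
  assumes "continuous_on (unit_ball \<times> unit_ball) \<Phi>"
  shows "\<Phi> \<in> borel_measurable (nu \<beta> \<Otimes>\<^sub>M nu \<alpha>)"
proof -
  let ?B = "unit_ball :: (complex ^ 'n) set" and ?M = "nu \<beta> \<Otimes>\<^sub>M nu \<alpha> :: ((complex ^ 'n) \<times> (complex ^ 'n)) measure"
  have ext: "(\<lambda>p. indicator (?B \<times> ?B) p *\<^sub>R \<Phi> p) \<in> borel_measurable borel"
    by (rule borel_measurable_continuous_on_indicator[OF _ assms]) (intro borel_open open_Times open_ball)
  have id: "(\<lambda>x. x) \<in> measurable (nu \<delta>) (borel :: (complex ^ 'n) measure)" for \<delta>
    by (rule borel_measurable_nu_continuous_on[OF continuous_on_id])
  have "(\<lambda>p. (fst p, snd p)) \<in> measurable ?M (borel \<Otimes>\<^sub>M borel)"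
    by (intro measurable_Pair measurable_compose[OF measurable_fst id] measurable_compose[OF measurable_snd id])
  then have "(\<lambda>p. (fst p, snd p)) \<in> measurable ?M borel"
    unfolding borel_prod .
  from measurable_compose[OF this ext] have "(\<lambda>p. indicator (?B \<times> ?B) p *\<^sub>R \<Phi> p) \<in> borel_measurable ?M"
    by simp
  then show ?thesis
    by (rule measurable_cong[THEN iffD1, rotated]) (simp add: space_pair_measure)
qed

lemma integrable_ball_integrable:
  fixes H :: "complex ^ 'n \<Rightarrow> complex"
  shows "ball_integrable \<alpha> H \<Longrightarrow> integrable (nu \<alpha>) H"
  unfolding ball_integrable_def
  by (intro integrableI_bounded borel_measurable_nu_continuous_on) auto

context
  fixes b :: "complex ^ 'n \<Rightarrow> ('x::cbanach conj_space \<Rightarrow>\<^sub>C\<^sub>L 'y::cbanach)"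
    and \<psi> :: "'y \<Rightarrow> complex"
  assumes \<psi>: "complex_functional \<psi>"
begin

text \<open>Linear in \<open>T\<close> and conjugate-linear in \<open>x\<close>. For holomorphic
  \<open>g\<close> it is therefore the conjugate of \<open>sesqui T (g u)\<close> that is
  holomorphic in \<open>u\<close>.\<close>

definition sesqui :: "('x conj_space \<Rightarrow>\<^sub>C\<^sub>L 'y) \<Rightarrow> 'x \<Rightarrow> complex"
  where "sesqui T x = \<psi> (clinop_apply T (conj_vec x))"

lemma norm_sesqui_le: "cmod (sesqui T x) \<le> norm T * norm x"
  unfolding sesqui_def
  using complex_functional_linear(5)[OF \<psi>, of "clinop_apply T (conj_vec x)"] norm_clinop_apply[of T "conj_vec x"]
  by (simp add: norm_conj_vec)

lemma bounded_linear_sesqui_left: "bounded_linear (\<lambda>T. sesqui T x)"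
  unfolding sesqui_def
  by (rule bounded_linear_compose[OF complex_functional_linear(6)[OF \<psi>]
      bounded_bilinear.bounded_linear_left[OF bounded_bilinear_clinop_apply]])

lemma bounded_linear_cnj_sesqui_right: "bounded_linear (\<lambda>x. cnj (sesqui T x))"
  unfolding sesqui_def
  by (rule bounded_linear_compose[OF bounded_linear_cnj bounded_linear_compose[OF complex_functional_linear(6)[OF \<psi>]
      bounded_linear_compose[OF bounded_linear_clinop_apply bounded_linear_conj_vec]]])

lemma sesqui_scaleC_left: "sesqui (c *\<^sub>C T) x = c * sesqui T x"
  by (simp add: sesqui_def clinop_apply_scaleC_left complex_functional_linear[OF \<psi>])

lemma sesqui_scaleC_right: "sesqui T (c *\<^sub>C x) = cnj c * sesqui T x"
  by (simp add: sesqui_def conj_vec_scaleC clinop_apply_scaleC complex_functional_linear[OF \<psi>])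

lemma continuous_on_sesqui:
  fixes T :: "'i::topological_space \<Rightarrow> ('x conj_space \<Rightarrow>\<^sub>C\<^sub>L 'y)"
  assumes "continuous_on S T" "continuous_on S x"
  shows "continuous_on S (\<lambda>p. sesqui (T p) (x p))"
  unfolding sesqui_def
  by (intro bounded_linear.continuous_on[OF complex_functional_linear(6)[OF \<psi>]]
      bounded_bilinear.continuous_on[OF bounded_bilinear_clinop_apply] assms
      bounded_linear.continuous_on[OF bounded_linear_conj_vec])

text \<open>
  The reproducing formula for \<open>g\<close> with the weight \<open>\<alpha> + k\<close>, followed by Fubini's theorem. The dilation by
  \<open>r < 1\<close> makes the double integral absolutely convergent.
\<close>

lemma dilated_pairing:
  fixes k :: nat
  assumes \<alpha>: "\<alpha> > -1" and b: "ball_integrable \<alpha> b" and g: "g \<in> hardy_infinity" and r: "0 \<le> r" "r < 1"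
  defines "s \<equiv> real CARD('n) + 1 + \<alpha> + real k"
  shows "of_real (nu_mass TYPE('n) (\<alpha> + real k)) * (\<integral>w. sesqui (b w) (g (r *\<^sub>R w)) \<partial>nu \<alpha>) =
    (\<integral>u. sesqui (kernel_integral \<alpha> b s (r *\<^sub>R u)) (g u) \<partial>nu (\<alpha> + real k))"
proof -
  let ?\<beta> = "\<alpha> + real k"
  let ?m = "nu_mass TYPE('n) ?\<beta>"
  define f where "f u w = sesqui (b w) (g u) * bergman_kernel s (r *\<^sub>R u) w" for u w
  have \<beta>: "?\<beta> > -1" and s: "s \<ge> 0" "s = real CARD('n) + 1 + ?\<beta>"
    using \<alpha> by (simp_all add: s_def)
  obtain Mg where hol: "g \<in> holomorphic unit_ball" and cg: "continuous_on unit_ball g" and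
    Mg: "Mg \<ge> 0" "\<And>w. norm w < 1 \<Longrightarrow> norm (g w) \<le> Mg"
    using hardy_infinityE[OF g] by blast
  have cb: "continuous_on unit_ball b" and fb: "(\<integral>\<^sup>+w. ennreal (norm (b w)) \<partial>nu \<alpha>) < \<infinity>"
    using b by (auto simp: ball_integrable_def)
  have rn: "norm (r *\<^sub>R w) \<le> r" "norm (r *\<^sub>R w) < 1" if "norm w < 1" for w :: "complex ^ 'n"
  proof -
    have "r * norm w \<le> r * 1"
      using that r by (intro mult_left_mono) auto
    then show "norm (r *\<^sub>R w) \<le> r"
      using r by simp
    then show "norm (r *\<^sub>R w) < 1"
      using r by simp
  qed
  \<comment> \<open>For fixed \<open>w\<close> the conjugated integrand is holomorphic times a
    kernel, reproduced at the point \<open>r *\<^sub>R w\<close>.\<close>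
  have inner1: "(\<integral>u. f u w \<partial>nu ?\<beta>) = of_real ?m * sesqui (b w) (g (r *\<^sub>R w))" if w: "norm w < 1" for w
  proof -
    let ?H = "\<lambda>u. cnj (sesqui (b w) (g u))"
    have Hhol: "?H \<in> holomorphic unit_ball"
      by (rule holomorphic_bounded_clinear[OF hol bounded_linear_cnj_sesqui_right])
        (simp add: sesqui_scaleC_right scaleC_complex_def)
    have "ball_integrable ?\<beta> ?H"
    proof (rule ball_integrable_bounded[OF \<beta> holomorphic_imp_continuous_on[OF Hhol]])
      show "norm (?H u) \<le> norm (b w) * Mg" if "norm u < 1" for u
        using order_trans[OF norm_sesqui_le mult_left_mono[OF Mg(2)[OF that] norm_ge_zero], of "b w"] by simp
    qed
    then have "(\<integral>u. ?H u * bergman_kernel s (r *\<^sub>R w) u \<partial>nu ?\<beta>) = ?m *\<^sub>R ?H (r *\<^sub>R w)"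
      unfolding s(2) by (intro bergman_reproducing Hhol \<beta> integrable_ball_integrable rn(2) w)
    then have eq: "(\<integral>u. ?H u * bergman_kernel s (r *\<^sub>R w) u \<partial>nu ?\<beta>) = ?m *\<^sub>R ?H (r *\<^sub>R w)" .
    have "(\<integral>u. cnj (?H u * bergman_kernel s (r *\<^sub>R w) u) \<partial>nu ?\<beta>) = cnj (\<integral>u. ?H u * bergman_kernel s (r *\<^sub>R w) u \<partial>nu ?\<beta>)"
      by (rule Bochner_Integration.integral_cnj)
    also have "\<dots> = of_real ?m * sesqui (b w) (g (r *\<^sub>R w))"
      unfolding eq by (simp add: scaleR_conv_of_real)
    finally have "(\<integral>u. cnj (?H u * bergman_kernel s (r *\<^sub>R w) u) \<partial>nu ?\<beta>) = of_real ?m * sesqui (b w) (g (r *\<^sub>R w))" .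
    moreover have "(\<integral>u. f u w \<partial>nu ?\<beta>) = (\<integral>u. cnj (?H u * bergman_kernel s (r *\<^sub>R w) u) \<partial>nu ?\<beta>)"
    proof (rule Bochner_Integration.integral_cong[OF refl])
      fix u :: "complex ^ 'n" assume "u \<in> space (nu ?\<beta>)"
      then have u: "norm u \<le> 1" by simp
      \<comment> \<open>As \<open>r\<close> is real, the dilation moves from \<open>w\<close> to
        \<open>u\<close>.\<close>
      have "hinner u (r *\<^sub>R w) = hinner (r *\<^sub>R u) w"
        by (simp add: hinner_def)
      then have "cnj (bergman_kernel s (r *\<^sub>R w) u) = bergman_kernel s (r *\<^sub>R u) w"
        using cnj_bergman_kernel[OF rn(2)[OF w] u, of s] by (simp add: bergman_kernel_def)
      then show "f u w = cnj (?H u * bergman_kernel s (r *\<^sub>R w) u)"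
        by (simp add: f_def)
    qed
    ultimately show ?thesis
      by simp
  qed
  \<comment> \<open>For fixed \<open>u\<close> the form is bounded and linear in the symbol and
    passes through the vector-valued integral.\<close>
  have inner2: "(\<integral>w. f u w \<partial>nu \<alpha>) = sesqui (kernel_integral \<alpha> b s (r *\<^sub>R u)) (g u)" if u: "norm u < 1" for u
  proof -
    have "has_bochner_int (nu \<alpha>) (\<lambda>w. sesqui (bergman_kernel s (r *\<^sub>R u) w *\<^sub>C b w) (g u)) (sesqui (kernel_integral \<alpha> b s (r *\<^sub>R u)) (g u))"
      unfolding kernel_integral_def
      by (rule has_bochner_int_linear[OF bounded_linear_sesqui_left has_bochner_int_bochner_int[OF \<alpha>
          ball_integrable_kernel[OF b s(1) rn(2)[OF u]]]])
    then have "(\<integral>w. sesqui (bergman_kernel s (r *\<^sub>R u) w *\<^sub>C b w) (g u) \<partial>nu \<alpha>) = sesqui (kernel_integral \<alpha> b s (r *\<^sub>R u)) (g u)"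
      unfolding has_bochner_int_iff_has_bochner_integral by (rule has_bochner_integral_integral_eq)
    then show ?thesis
      by (simp only: f_def sesqui_scaleC_left mult.commute)
  qed
  interpret B: finite_measure "nu ?\<beta> :: (complex ^ 'n) measure"
    by (rule finite_measure_nu[OF \<beta>])
  interpret A: finite_measure "nu \<alpha> :: (complex ^ 'n) measure"
    by (rule finite_measure_nu[OF \<alpha>])
  interpret P: pair_sigma_finite "nu ?\<beta> :: (complex ^ 'n) measure" "nu \<alpha> :: (complex ^ 'n) measure" ..
  have int: "integrable (nu ?\<beta> \<Otimes>\<^sub>M nu \<alpha>) (case_prod f)"
  proof (rule integrableI_bounded)
    have "continuous_on (unit_ball \<times> unit_ball) (\<lambda>p. sesqui (b (snd p)) (g (fst p)) * bergman_kernel s (r *\<^sub>R fst p) (snd p))"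
      by (intro continuous_on_mult continuous_on_sesqui continuous_on_bergman_kernel continuous_on_compose2[OF cb]
          continuous_on_compose2[OF cg] continuous_intros) (use rn in auto)
    then show meas: "case_prod f \<in> borel_measurable (nu ?\<beta> \<Otimes>\<^sub>M nu \<alpha>)"
      unfolding f_def case_prod_beta by (rule borel_measurable_pair_nu)
    \<comment> \<open>All points \<open>r *\<^sub>R u\<close> have norm at most \<open>r\<close>, so
      kernel and \<open>g\<close> are bounded and only the integrable \<open>norm (b w)\<close>
      remains.\<close>
    let ?K = "Mg * (1 - r) powr (- s)"
    have "(\<integral>\<^sup>+p. ennreal (norm (case_prod f p)) \<partial>(nu ?\<beta> \<Otimes>\<^sub>M nu \<alpha>)) = (\<integral>\<^sup>+u. (\<integral>\<^sup>+w. ennreal (norm (case_prod f (u, w))) \<partial>nu \<alpha>) \<partial>nu ?\<beta>)"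
      by (rule A.nn_integral_fst[symmetric]) (use meas in measurable)
    also have "\<dots> \<le> (\<integral>\<^sup>+u. (\<integral>\<^sup>+w. ennreal ?K * ennreal (norm (b w)) \<partial>nu \<alpha>) \<partial>(nu ?\<beta> :: (complex ^ 'n) measure))"
    proof (intro nn_integral_mono)
      fix u w :: "complex ^ 'n" assume "u \<in> space (nu ?\<beta>)" "w \<in> space (nu \<alpha>)"
      then have u: "norm u < 1" and w: "norm w < 1" by auto
      have "cmod (bergman_kernel s (r *\<^sub>R u) w) \<le> (1 - norm (r *\<^sub>R u)) powr (- s)"
        by (rule norm_bergman_kernel_le[OF rn(2)[OF u] less_imp_le[OF w] s(1)])
      also have "\<dots> \<le> (1 - r) powr (- s)"
        using rn(1)[OF u] r s(1) by (intro powr_mono2') auto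
      finally have "cmod (sesqui (b w) (g u)) * cmod (bergman_kernel s (r *\<^sub>R u) w) \<le> (norm (b w) * Mg) * (1 - r) powr (- s)"
        using order_trans[OF norm_sesqui_le mult_left_mono[OF Mg(2)[OF u] norm_ge_zero], of "b w"] Mg(1)
        by (intro mult_mono) auto
      then have "norm (f u w) \<le> ?K * norm (b w)"
        by (simp add: f_def norm_mult mult_ac)
      then show "ennreal (norm (case_prod f (u, w))) \<le> ennreal ?K * ennreal (norm (b w))"
        using Mg(1) by (simp add: ennreal_mult'[symmetric] ennreal_leI)
    qed
    also have "\<dots> = (\<integral>\<^sup>+u. ennreal ?K * (\<integral>\<^sup>+w. ennreal (norm (b w)) \<partial>nu \<alpha>) \<partial>(nu ?\<beta> :: (complex ^ 'n) measure))"
      by (intro nn_integral_cong nn_integral_cmult borel_measurable_nu_ennreal continuous_on_norm cb)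
    also have "\<dots> = ennreal ?K * (\<integral>\<^sup>+w. ennreal (norm (b w)) \<partial>nu \<alpha>) * emeasure (nu ?\<beta> :: (complex ^ 'n) measure) (space (nu ?\<beta>))"
      by simp
    also have "\<dots> < \<infinity>"
    proof -
      have "emeasure (nu ?\<beta> :: (complex ^ 'n) measure) (space (nu ?\<beta>)) < top"
        using B.emeasure_finite unfolding infinity_ennreal_def less_top .
      then show ?thesis
        using fb by (simp add: ennreal_mult_less_top)
    qed
    finally show "(\<integral>\<^sup>+p. ennreal (norm (case_prod f p)) \<partial>(nu ?\<beta> \<Otimes>\<^sub>M nu \<alpha>)) < \<infinity>" .
  qed
  have "of_real ?m * (\<integral>w. sesqui (b w) (g (r *\<^sub>R w)) \<partial>nu \<alpha>) = (\<integral>w. of_real ?m * sesqui (b w) (g (r *\<^sub>R w)) \<partial>nu \<alpha>)"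
    by simp
  also have "\<dots> = (\<integral>w. (\<integral>u. f u w \<partial>nu ?\<beta>) \<partial>nu \<alpha>)"
    by (rule Bochner_Integration.integral_cong[OF refl]) (simp add: inner1)
  also have "\<dots> = (\<integral>u. (\<integral>w. f u w \<partial>nu \<alpha>) \<partial>nu ?\<beta>)"
    by (rule P.Fubini_integral[OF int])
  also have "\<dots> = (\<integral>u. sesqui (kernel_integral \<alpha> b s (r *\<^sub>R u)) (g u) \<partial>nu ?\<beta>)"
    by (rule Bochner_Integration.integral_cong[OF refl]) (simp add: inner2)
  finally show ?thesis .
qed

text \<open>Dominated convergence with the supremum of \<open>g\<close> times
  \<open>norm (b w)\<close>, integrable by assumption.\<close>

lemma dilated_pairing_limit:
  assumes \<alpha>: "\<alpha> > -1" and b: "ball_integrable \<alpha> b" and g: "g \<in> hardy_infinity"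
  shows "(\<lambda>i. \<integral>w. sesqui (b w) (g ((1 - 1 / real (Suc i)) *\<^sub>R w)) \<partial>nu \<alpha>) \<longlonglongrightarrow> (\<integral>w. sesqui (b w) (g w) \<partial>nu \<alpha>)"
proof -
  obtain Mg where hol: "g \<in> holomorphic unit_ball" and cg: "continuous_on unit_ball g" and
    Mg: "Mg \<ge> 0" "\<And>w. norm w < 1 \<Longrightarrow> norm (g w) \<le> Mg"
    using hardy_infinityE[OF g] by blast
  have cb: "continuous_on unit_ball b" and fb: "(\<integral>\<^sup>+w. ennreal (norm (b w)) \<partial>nu \<alpha>) < \<infinity>"
    using b by (auto simp: ball_integrable_def)
  let ?r = "\<lambda>i. 1 - 1 / real (Suc i)"
  have r: "0 \<le> ?r i" "?r i < 1" for i
    by (auto simp: field_simps)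
  have rn: "norm (?r i *\<^sub>R w) < 1" if "norm w < 1" for w :: "complex ^ 'n" and i
  proof -
    have "?r i * norm w \<le> 1 * norm w"
      using r[of i] by (intro mult_right_mono) auto
    then show ?thesis
      using r[of i] that by simp
  qed
  show ?thesis
  proof (rule integral_dominated_convergence[where w = "\<lambda>w. Mg * norm (b w)"])
    show "(\<lambda>w. sesqui (b w) (g w)) \<in> borel_measurable (nu \<alpha>)"
      by (intro borel_measurable_nu_continuous_on continuous_on_sesqui cb cg)
    show "(\<lambda>w. sesqui (b w) (g (?r i *\<^sub>R w))) \<in> borel_measurable (nu \<alpha>)" for i
      by (intro borel_measurable_nu_continuous_on continuous_on_sesqui cb continuous_on_compose2[OF cg] continuous_intros)
        (use rn in auto)
    have "integrable (nu \<alpha>) (\<lambda>w. norm (b w))"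
      using fb by (intro integrableI_bounded borel_measurable_nu_continuous_on continuous_on_norm cb) simp
    then show "integrable (nu \<alpha>) (\<lambda>w. Mg * norm (b w))"
      by simp
    show "AE w in nu \<alpha>. norm (sesqui (b w) (g (?r i *\<^sub>R w))) \<le> Mg * norm (b w)" for i
    proof (rule AE_I2)
      fix w :: "complex ^ 'n" assume "w \<in> space (nu \<alpha>)"
      then have "norm w < 1" by simp
      then show "norm (sesqui (b w) (g (?r i *\<^sub>R w))) \<le> Mg * norm (b w)"
        using order_trans[OF norm_sesqui_le mult_left_mono[OF Mg(2)[OF rn] norm_ge_zero], of w "b w" i] by (simp only: mult.commute)
    qed
    show "AE w in nu \<alpha>. (\<lambda>i. sesqui (b w) (g (?r i *\<^sub>R w))) \<longlonglongrightarrow> sesqui (b w) (g w)"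
    proof (rule AE_I2)
      fix w :: "complex ^ 'n" assume "w \<in> space (nu \<alpha>)"
      then have w: "norm w < 1" by simp
      have "(\<lambda>i. ?r i *\<^sub>R w) \<longlonglongrightarrow> (1 - 0) *\<^sub>R w"
        by (intro tendsto_intros LIMSEQ_Suc[OF lim_1_over_n])
      then have lim: "(\<lambda>i. ?r i *\<^sub>R w) \<longlonglongrightarrow> w"
        by simp
      have "continuous_on unit_ball (\<lambda>v. sesqui (b w) (g v))"
        by (intro continuous_on_sesqui cg continuous_intros)
      then show "(\<lambda>i. sesqui (b w) (g (?r i *\<^sub>R w))) \<longlonglongrightarrow> sesqui (b w) (g w)"
        by (rule continuous_on_tendsto_compose[OF _ lim]) (use w rn in auto)
    qed
  qed
qed

text \<open>The growth \<open>\<gamma> - k\<close> of the kernel integral meets the factor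
  \<open>(1 - (norm u)\<^sup>2) powr real k\<close> that separates
  \<open>nu (\<alpha> + real k)\<close> from \<open>nu \<alpha>\<close>, which leaves the weight of
  exponent \<gamma>. The bound does not depend on \<open>r\<close> and survives the limit.\<close>

lemma pairing_bound:
  assumes \<alpha>: "\<alpha> > -1" and b: "ball_integrable \<alpha> b" and g: "g \<in> hardy_infinity" and \<gamma>: "\<gamma> \<ge> 0" "\<gamma> < real k"
    and M: "\<And>z. norm z < 1 \<Longrightarrow>
      norm (kernel_integral \<alpha> b (real CARD('n) + 1 + \<alpha> + real k) z) \<le> M * (1 - (norm z)\<^sup>2) powr (\<gamma> - real k)"
  shows "cmod (\<integral>w. sesqui (b w) (g w) \<partial>nu \<alpha>) \<le>
    M * (nu_factor TYPE('n) (\<alpha> + real k) / nu_factor TYPE('n) \<alpha>) / nu_mass TYPE('n) (\<alpha> + real k) * weighted_norm \<alpha> \<gamma> g"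
proof -
  let ?\<beta> = "\<alpha> + real k" and ?s = "real CARD('n) + 1 + \<alpha> + real k"
  let ?m = "nu_mass TYPE('n) ?\<beta>" and ?R = "nu_factor TYPE('n) ?\<beta> / nu_factor TYPE('n) \<alpha>"
  have \<beta>: "?\<beta> > -1"
    using \<alpha> by simp
  have m: "?m > 0"
    by (rule nu_mass_pos[OF \<beta>])
  have R: "?R > 0"
    by (intro divide_pos_pos nu_factor_pos \<alpha> \<beta>)
  have M0: "M \<ge> 0"
    using order_trans[OF norm_ge_zero M[of 0]] by simp
  have cg: "continuous_on unit_ball g"
    using hardy_infinityE[OF g] by blast
  have W: "weighted_norm \<alpha> \<gamma> g \<ge> 0"
    by (rule weighted_norm(2)[OF \<alpha> g \<gamma>(1)])
  have bound: "cmod (\<integral>w. sesqui (b w) (g (r *\<^sub>R w)) \<partial>nu \<alpha>) \<le> M * ?R / ?m * weighted_norm \<alpha> \<gamma> g" if r: "0 \<le> r" "r < 1" for r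
  proof -
    let ?h = "\<lambda>u. sesqui (kernel_integral \<alpha> b ?s (r *\<^sub>R u)) (g u)"
    have "cmod (\<integral>u. ?h u \<partial>nu ?\<beta>) \<le> M * ?R * weighted_norm \<alpha> \<gamma> g"
    proof (cases "integrable (nu ?\<beta>) ?h")
      case True
      have "ennreal (cmod (\<integral>u. ?h u \<partial>nu ?\<beta>)) \<le> (\<integral>\<^sup>+u. ennreal (cmod (?h u)) \<partial>nu ?\<beta>)"
        by (rule integral_norm_bound_ennreal[OF True])
      also have "\<dots> \<le> (\<integral>\<^sup>+u. ennreal M * ennreal (norm (g u) * (1 - (norm u)\<^sup>2) powr (\<gamma> - real k)) \<partial>nu ?\<beta>)"
      proof (rule nn_integral_mono)
        fix u :: "complex ^ 'n" assume "u \<in> space (nu ?\<beta>)"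
        then have u: "norm u < 1" by simp
        have ru: "norm (r *\<^sub>R u) \<le> norm u"
          using r u mult_right_mono[of r 1 "norm u"] by simp
        have "norm (kernel_integral \<alpha> b ?s (r *\<^sub>R u)) \<le> M * (1 - (norm (r *\<^sub>R u))\<^sup>2) powr (\<gamma> - real k)"
          using ru u by (intro M) linarith
        \<comment> \<open>The exponent is negative, so moving inwards from \<open>u\<close> to
          \<open>r *\<^sub>R u\<close> only lowers the bound; hence the uniformity in
          \<open>r\<close>.\<close>
        also have "\<dots> \<le> M * (1 - (norm u)\<^sup>2) powr (\<gamma> - real k)"
          using one_minus_norm_power_pos[OF u] ru \<gamma> M0
          by (intro mult_left_mono powr_mono2' diff_left_mono power_mono) auto
        finally have "norm (kernel_integral \<alpha> b ?s (r *\<^sub>R u)) * norm (g u) \<le> M * (1 - (norm u)\<^sup>2) powr (\<gamma> - real k) * norm (g u)"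
          by (rule mult_right_mono) simp
        then have "cmod (?h u) \<le> M * (norm (g u) * (1 - (norm u)\<^sup>2) powr (\<gamma> - real k))"
          using norm_sesqui_le[of "kernel_integral \<alpha> b ?s (r *\<^sub>R u)" "g u"] by (simp add: mult_ac)
        then show "ennreal (cmod (?h u)) \<le> ennreal M * ennreal (norm (g u) * (1 - (norm u)\<^sup>2) powr (\<gamma> - real k))"
          using M0 by (simp add: ennreal_mult'[symmetric] ennreal_leI)
      qed
      also have "\<dots> = ennreal M * (\<integral>\<^sup>+u. ennreal (norm (g u) * (1 - (norm u)\<^sup>2) powr (\<gamma> - real k)) \<partial>nu ?\<beta>)"
        by (intro nn_integral_cmult borel_measurable_nu_ennreal continuous_on_mult continuous_on_norm cg continuous_on_one_minus_norm_powr)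
      also have "(\<integral>\<^sup>+u. ennreal (norm (g u) * (1 - (norm u)\<^sup>2) powr (\<gamma> - real k)) \<partial>nu ?\<beta>) =
          ennreal ?R * (\<integral>\<^sup>+u. ennreal (norm (g u) * (1 - (norm u)\<^sup>2) powr (\<gamma> - real k) * (1 - (norm u)\<^sup>2) powr real k) \<partial>nu \<alpha>)"
        by (intro nn_integral_nu_change_weight \<alpha> \<beta> continuous_on_mult continuous_on_norm cg continuous_on_one_minus_norm_powr) simp
      also have "(\<integral>\<^sup>+u. ennreal (norm (g u) * (1 - (norm u)\<^sup>2) powr (\<gamma> - real k) * (1 - (norm u)\<^sup>2) powr real k) \<partial>nu \<alpha>) =
          (\<integral>\<^sup>+u. ennreal (norm (g u) * (1 - (norm u)\<^sup>2) powr \<gamma>) \<partial>nu \<alpha>)"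
        by (simp only: mult.assoc powr_add[symmetric] diff_add_cancel)
      also have "\<dots> = ennreal (weighted_norm \<alpha> \<gamma> g)"
        by (rule weighted_norm(1)[OF \<alpha> g \<gamma>(1)])
      also have "ennreal M * (ennreal ?R * ennreal (weighted_norm \<alpha> \<gamma> g)) = ennreal (M * ?R * weighted_norm \<alpha> \<gamma> g)"
        by (simp only: ennreal_mult'[OF M0] ennreal_mult'[OF less_imp_le[OF R]] mult.assoc)
      finally show ?thesis
        by (subst (asm) ennreal_le_iff) (intro mult_nonneg_nonneg M0 less_imp_le[OF R] W)
    next
      \<comment> \<open>The integral of a non-integrable function is 0 by convention, and the right
        side is nonnegative.\<close>
      case False
      then show ?thesis
        using mult_nonneg_nonneg[OF mult_nonneg_nonneg[OF M0 less_imp_le[OF R]] W]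
        by (simp only: not_integrable_integral_eq[OF False] norm_zero)
    qed
    then have "?m * cmod (\<integral>w. sesqui (b w) (g (r *\<^sub>R w)) \<partial>nu \<alpha>) \<le> M * ?R * weighted_norm \<alpha> \<gamma> g"
      unfolding dilated_pairing[OF \<alpha> b g r, symmetric] using m by (simp add: norm_mult)
    then have "cmod (\<integral>w. sesqui (b w) (g (r *\<^sub>R w)) \<partial>nu \<alpha>) \<le> (M * ?R * weighted_norm \<alpha> \<gamma> g) / ?m"
      unfolding pos_le_divide_eq[OF m] by (simp only: mult.commute)
    then show ?thesis
      by simp
  qed
  show ?thesis
    by (rule Lim_bounded[OF tendsto_norm[OF dilated_pairing_limit[OF \<alpha> b g]], of 0]) (intro allI impI bound, auto simp: field_simps)
qed

end

section \<open>Little Hankel operators\<close>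

lemma holomorphic_bergman_kernel:
  assumes z: "norm z < 1"
  shows "(\<lambda>w. bergman_kernel s w z) \<in> holomorphic unit_ball"
proof -
  have "\<exists>D. ((\<lambda>w. bergman_kernel s w z) has_derivative D) (at w) \<and> (\<forall>c v. D (c *s v) = c *\<^sub>C D v)" if "w \<in> unit_ball" for w
  proof -
    have "cmod (hinner w z) < 1"
      using that z by (intro norm_hinner_less_1) auto
    then have "(binomial_fun s has_derivative (*) (of_real s * binomial_fun (s + 1) (hinner w z))) (at (hinner w z))"
      using binomial_fun_deriv by (simp add: has_field_derivative_def)
    from has_derivative_compose[OF bounded_linear_imp_has_derivative[OF bounded_linear_hinner_left] this]
    have "((\<lambda>w. bergman_kernel s w z) has_derivative (\<lambda>v. of_real s * binomial_fun (s + 1) (hinner w z) * hinner v z)) (at w)"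
      by (simp add: bergman_kernel_conv)
    then show ?thesis
      by (intro exI[of _ "\<lambda>v. of_real s * binomial_fun (s + 1) (hinner w z) * hinner v z"])
        (simp add: hinner_scale_left scaleC_complex_def)
  qed
  then show ?thesis
    by (simp add: holomorphic_def)
qed

lemma holomorphic_scaleC:
  fixes k :: "complex ^ 'n \<Rightarrow> complex" and f :: "complex ^ 'n \<Rightarrow> 'a::complex_normed_vector"
  assumes k: "k \<in> holomorphic S" and f: "f \<in> holomorphic S"
  shows "(\<lambda>z. k z *\<^sub>C f z) \<in> holomorphic S"
proof -
  have "\<exists>D. ((\<lambda>z. k z *\<^sub>C f z) has_derivative D) (at z) \<and> (\<forall>c v. D (c *s v) = c *\<^sub>C D v)" if z: "z \<in> S" for z
  proof -
    obtain Dk where Dk: "(k has_derivative Dk) (at z)" "\<And>c v. Dk (c *s v) = c *\<^sub>C Dk v"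
      using k z unfolding holomorphic_def by blast
    obtain Df where Df: "(f has_derivative Df) (at z)" "\<And>c v. Df (c *s v) = c *\<^sub>C Df v"
      using f z unfolding holomorphic_def by blast
    have "((\<lambda>z. k z *\<^sub>C f z) has_derivative (\<lambda>v. k z *\<^sub>C Df v + Dk v *\<^sub>C f z)) (at z)"
      by (rule bounded_bilinear.FDERIV[OF bounded_bilinear_scaleC Dk(1) Df(1)])
    moreover have "k z *\<^sub>C Df (c *s v) + Dk (c *s v) *\<^sub>C f z = c *\<^sub>C (k z *\<^sub>C Df v + Dk v *\<^sub>C f z)" for c v
      by (simp add: Dk(2) Df(2) scaleC_add_right scaleC_scaleC scaleC_complex_def mult.commute)
    ultimately show ?thesis
      by (intro exI[of _ "\<lambda>v. k z *\<^sub>C Df v + Dk v *\<^sub>C f z"]) blast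
  qed
  then show ?thesis
    using k unfolding holomorphic_def by blast
qed

lemma holomorphic_const: "open S \<Longrightarrow> (\<lambda>_. x) \<in> holomorphic S"
  unfolding holomorphic_def by (auto intro!: exI[of _ "\<lambda>_. 0"] simp: scaleC_zero_right)

lemma norm_bergman_kernel_le':
  assumes "norm z < 1" "norm w < 1" "s \<ge> 0"
  shows "cmod (bergman_kernel s w z) \<le> (1 - norm z) powr (- s)"
proof -
  have "cmod (bergman_kernel s w z) = cmod (cnj (bergman_kernel s z w))"
    using assms by (simp only: cnj_bergman_kernel less_imp_le)
  then show ?thesis
    using norm_bergman_kernel_le[of z w s] assms by simp
qed

lemma hardy_infinity_kernel:
  fixes f :: "complex ^ 'n \<Rightarrow> 'a::complex_normed_vector"
  assumes f: "f \<in> hardy_infinity" and z: "norm z < 1" and s: "s \<ge> 0"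
  shows "(\<lambda>w. bergman_kernel s w z *\<^sub>C f w) \<in> hardy_infinity"
proof -
  obtain M where M: "f \<in> holomorphic unit_ball" "M \<ge> 0" "\<And>w. norm w < 1 \<Longrightarrow> norm (f w) \<le> M"
    using hardy_infinityE[OF f] by blast
  show ?thesis
  proof (rule hardy_infinityI[OF holomorphic_scaleC[OF holomorphic_bergman_kernel[OF z] M(1)]])
    show "norm (bergman_kernel s w z *\<^sub>C f w) \<le> (1 - norm z) powr (- s) * M" if "norm w < 1" for w
      using norm_bergman_kernel_le'[OF z that s] M(3)[OF that] unfolding norm_scaleC
      by (intro mult_mono) auto
  qed
qed

lemma bochner_int_cong:
  assumes "\<And>w. w \<in> space M \<Longrightarrow> f w = g w"
  shows "bochner_int M f = bochner_int M g"
proof -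
  have "has_bochner_int M f = has_bochner_int M g"
    unfolding has_bochner_int.simps fun_eq_iff using assms
    by (simp cong: measurable_cong_simp nn_integral_cong_simp)
  then show ?thesis
    by (simp add: bochner_int_def)
qed

lemma little_hankel_conv_kernel_integral:
  fixes b :: "complex ^ 'n \<Rightarrow> ('x::cbanach conj_space \<Rightarrow>\<^sub>C\<^sub>L 'y::cbanach)"
  shows "little_hankel \<alpha> b f = kernel_integral \<alpha> (\<lambda>w. clinop_apply (b w) (conj_vec (f w))) (real CARD('n) + 1 + \<alpha>)"
  by (rule ext) (simp only: little_hankel_def kernel_integral_def bergman_kernel_def)

section \<open>Sufficiency of the growth condition\<close>

lemma ball_integrable_symbol:
  fixes b :: "complex ^ 'n \<Rightarrow> ('x::cbanach conj_space \<Rightarrow>\<^sub>C\<^sub>L 'y::cbanach)"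
  assumes b: "ball_integrable \<alpha> b" and f: "f \<in> hardy_infinity"
  shows "ball_integrable \<alpha> (\<lambda>w. clinop_apply (b w) (conj_vec (f w)))"
proof -
  obtain M where M: "continuous_on unit_ball f" "M \<ge> 0" "\<And>w. norm w < 1 \<Longrightarrow> norm (f w) \<le> M"
    using hardy_infinityE[OF f] by blast
  have cb: "continuous_on unit_ball b"
    using b by (simp add: ball_integrable_def)
  have "(\<integral>\<^sup>+w. ennreal (norm (clinop_apply (b w) (conj_vec (f w)))) \<partial>nu \<alpha>) \<le> (\<integral>\<^sup>+w. ennreal M * ennreal (norm (b w)) \<partial>nu \<alpha>)"
  proof (rule nn_integral_mono)
    fix w :: "complex ^ 'n" assume "w \<in> space (nu \<alpha>)"
    then have w: "norm w < 1" by simp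
    have "norm (clinop_apply (b w) (conj_vec (f w))) \<le> norm (b w) * norm (f w)"
      using norm_clinop_apply[of "b w" "conj_vec (f w)"] by (simp add: norm_conj_vec)
    also have "\<dots> \<le> norm (b w) * M"
      using M(3)[OF w] by (rule mult_left_mono) simp
    finally show "ennreal (norm (clinop_apply (b w) (conj_vec (f w)))) \<le> ennreal M * ennreal (norm (b w))"
      using M(2) by (simp add: ennreal_mult'[symmetric] ennreal_leI mult.commute)
  qed
  also have "\<dots> = ennreal M * (\<integral>\<^sup>+w. ennreal (norm (b w)) \<partial>nu \<alpha>)"
    by (intro nn_integral_cmult borel_measurable_nu_ennreal continuous_on_norm cb)
  also have "\<dots> < \<infinity>"
    using b by (simp add: ball_integrable_def ennreal_mult_less_top)
  moreover have "continuous_on unit_ball (\<lambda>w. clinop_apply (b w) (conj_vec (f w)))"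
    by (intro bounded_bilinear.continuous_on[OF bounded_bilinear_clinop_apply] cb
        bounded_linear.continuous_on[OF bounded_linear_conj_vec] M(1))
  ultimately show ?thesis
    by (simp add: ball_integrable_def)
qed

text \<open>Tested on \<psi>, the value at \<open>z\<close> is a pairing of \<open>b\<close> with
  \<open>f\<close> times a kernel centred at \<open>z\<close>. The kernel is bounded by
  \<open>(1 - norm z) powr (- N)\<close>, and this factor comes out of the \<open>L^p\<close>
  norm.\<close>

lemma little_hankel_pointwise_bound:
  fixes b :: "complex ^ 'n \<Rightarrow> ('x::cbanach conj_space \<Rightarrow>\<^sub>C\<^sub>L 'y::cbanach)"
  assumes \<alpha>: "\<alpha> > -1" and p: "0 < p" "p \<le> 1" and \<gamma>: "\<gamma> = (real CARD('n) + 1 + \<alpha>) * (1 / p - 1)"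
    and b: "ball_integrable \<alpha> b" and G: "b \<in> Gamma_space \<gamma>"
  shows "\<exists>C\<ge>0. \<forall>f\<in>hardy_infinity. \<forall>z\<in>unit_ball.
    norm (little_hankel \<alpha> b f z) \<le> C * (1 - norm z) powr (- (real CARD('n) + 1 + \<alpha>)) * bergman_norm p \<alpha> f"
proof -
  let ?N = "real CARD('n) + 1 + \<alpha>"
  have N: "?N > 0"
    using \<alpha> by (simp add: add_pos_nonneg)
  have \<gamma>0: "\<gamma> \<ge> 0"
    using N p unfolding \<gamma> by (intro mult_nonneg_nonneg) (auto simp: field_simps)
  obtain k M where k: "real k > \<gamma>" and M: "\<And>z. norm z < 1 \<Longrightarrow>
      norm (kernel_integral \<alpha> b (?N + real k) z) \<le> M * (1 - (norm z)\<^sup>2) powr (\<gamma> - real k)"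
    using Gamma_space_kernel_bound[OF \<alpha> b G] by blast
  obtain C1 where C1: "C1 > 0" "\<And>f :: complex ^ 'n \<Rightarrow> 'x. f \<in> hardy_infinity \<Longrightarrow> weighted_norm \<alpha> \<gamma> f \<le> C1 * bergman_norm p \<alpha> f"
    using weighted_norm_le_bergman_norm[OF \<alpha> p \<gamma>] by blast
  define C2 where "C2 = M * (nu_factor TYPE('n) (\<alpha> + real k) / nu_factor TYPE('n) \<alpha>) / nu_mass TYPE('n) (\<alpha> + real k)"
  have M0: "M \<ge> 0"
    using order_trans[OF norm_ge_zero M[of 0]] by simp
  have \<beta>: "\<alpha> + real k > -1"
    using \<alpha> by simp
  have C2: "C2 \<ge> 0"
    unfolding C2_def
    by (intro divide_nonneg_nonneg mult_nonneg_nonneg M0 less_imp_le[OF nu_factor_pos] less_imp_le[OF nu_mass_pos] \<alpha> \<beta>)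
  have "norm (little_hankel \<alpha> b f z) \<le> (C2 * C1) * (1 - norm z) powr (- ?N) * bergman_norm p \<alpha> f"
    if f: "f \<in> hardy_infinity" and z: "z \<in> unit_ball" for f z
    unfolding little_hankel_conv_kernel_integral
  proof (rule complex_functional_norm_le)
    fix \<psi> :: "'y \<Rightarrow> complex" assume \<psi>: "complex_functional \<psi>"
    let ?H = "\<lambda>w. clinop_apply (b w) (conj_vec (f w))"
    let ?g = "\<lambda>w. bergman_kernel ?N w z *\<^sub>C f w"
    have z1: "norm z < 1"
      using z by simp
    have g: "?g \<in> hardy_infinity"
      using N by (intro hardy_infinity_kernel f z1) simp
    have "\<psi> (kernel_integral \<alpha> ?H ?N z) = (\<integral>w. \<psi> (bergman_kernel ?N z w *\<^sub>C ?H w) \<partial>nu \<alpha>)"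
      unfolding kernel_integral_def
      by (intro functional_bochner_int \<alpha> ball_integrable_kernel ball_integrable_symbol b f z1 \<psi> less_imp_le[OF N])
    also have "\<dots> = (\<integral>w. sesqui \<psi> (b w) (?g w) \<partial>nu \<alpha>)"
    proof (rule Bochner_Integration.integral_cong[OF refl])
      fix w :: "complex ^ 'n" assume "w \<in> space (nu \<alpha>)"
      \<comment> \<open>Pulled into the conjugate-linear slot, the kernel is conjugated and becomes
        holomorphic in \<open>w\<close>, as the pairing requires.\<close>
      then have "cnj (bergman_kernel ?N w z) = bergman_kernel ?N z w"
        using z1 by (intro cnj_bergman_kernel) auto
      then have "sesqui \<psi> (b w) (?g w) = bergman_kernel ?N z w * sesqui \<psi> (b w) (f w)"
        by (simp add: sesqui_scaleC_right[OF \<psi>])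
      then show "\<psi> (bergman_kernel ?N z w *\<^sub>C ?H w) = sesqui \<psi> (b w) (?g w)"
        by (simp only: complex_functional_linear(3)[OF \<psi>] sesqui_def[OF \<psi>])
    qed
    also have "cmod \<dots> \<le> C2 * weighted_norm \<alpha> \<gamma> ?g"
      unfolding C2_def by (rule pairing_bound[OF \<psi> \<alpha> b g \<gamma>0 k M])
    also have "\<dots> \<le> C2 * (C1 * bergman_norm p \<alpha> ?g)"
      by (intro mult_left_mono C1(2) g C2)
    also have "\<dots> \<le> C2 * (C1 * ((1 - norm z) powr (- ?N) * bergman_norm p \<alpha> f))"
    proof -
      have cf: "continuous_on unit_ball f"
        using hardy_infinityE[OF f] by blast
      have "bergman_norm p \<alpha> ?g \<le> (((1 - norm z) powr (- ?N)) powr p) powr (1 / p) * bergman_norm p \<alpha> f"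
      proof (rule bergman_norm_mono)
        have "(\<integral>\<^sup>+w. ennreal (norm (?g w) powr p) \<partial>nu \<alpha>) \<le> (\<integral>\<^sup>+w. ennreal (((1 - norm z) powr (- ?N)) powr p) * ennreal (norm (f w) powr p) \<partial>nu \<alpha>)"
        proof (rule nn_integral_mono)
          fix w :: "complex ^ 'n" assume "w \<in> space (nu \<alpha>)"
          then have w: "norm w < 1" by simp
          have "norm (?g w) \<le> (1 - norm z) powr (- ?N) * norm (f w)"
            unfolding norm_scaleC by (intro mult_right_mono norm_bergman_kernel_le' z1 w less_imp_le[OF N]) simp
          then have "norm (?g w) powr p \<le> ((1 - norm z) powr (- ?N) * norm (f w)) powr p"
            using p by (intro powr_mono2) auto
          also have "\<dots> = ((1 - norm z) powr (- ?N)) powr p * norm (f w) powr p"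
            by (rule powr_mult)
          finally show "ennreal (norm (?g w) powr p) \<le> ennreal (((1 - norm z) powr (- ?N)) powr p) * ennreal (norm (f w) powr p)"
            by (simp only: ennreal_mult'[symmetric, OF powr_ge_zero] ennreal_leI)
        qed
        also have "\<dots> = ennreal (((1 - norm z) powr (- ?N)) powr p) * (\<integral>\<^sup>+w. ennreal (norm (f w) powr p) \<partial>nu \<alpha>)"
          by (intro nn_integral_cmult borel_measurable_nu_ennreal continuous_on_norm_powr cf p)
        finally show "(\<integral>\<^sup>+w. ennreal (norm (?g w) powr p) \<partial>nu \<alpha>) \<le>
            ennreal (((1 - norm z) powr (- ?N)) powr p) * (\<integral>\<^sup>+w. ennreal (norm (f w) powr p) \<partial>nu \<alpha>)" .
      qed (use nn_integral_norm_powr_finite[OF \<alpha> f p(1)] p in auto)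
      also have "(((1 - norm z) powr (- ?N)) powr p) powr (1 / p) = (1 - norm z) powr (- ?N)"
        using p by (simp add: powr_powr)
      finally show ?thesis
        using C1(1) C2 by (intro mult_left_mono) auto
    qed
    finally show "cmod (\<psi> (kernel_integral \<alpha> ?H ?N z)) \<le> C2 * C1 * (1 - norm z) powr (- ?N) * bergman_norm p \<alpha> f"
      by (simp only: mult.assoc)
  qed
  then show ?thesis
    using C1(1) C2 by (intro exI[of _ "C2 * C1"]) auto
qed

lemma Gamma_space_imp_hankel_bounded:
  fixes b :: "complex ^ 'n \<Rightarrow> ('x::cbanach conj_space \<Rightarrow>\<^sub>C\<^sub>L 'y::cbanach)"
  assumes \<alpha>: "\<alpha> > -1" and p: "0 < p" "p \<le> 1" and \<gamma>: "\<gamma> = (real CARD('n) + 1 + \<alpha>) * (1 / p - 1)"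
    and b: "ball_integrable \<alpha> b" and G: "b \<in> Gamma_space \<gamma>"
  shows "\<exists>q. 0 < q \<and> q < 1 \<and> hankel_extends_boundedly \<alpha> b p q"
proof -
  let ?N = "real CARD('n) + 1 + \<alpha>"
  \<comment> \<open>Then \<open>?N * q\<close> is half of \<open>1 + \<alpha>\<close>, so the
    boundary growth of order \<open>?N * q\<close> is integrable for \<open>nu \<alpha>\<close>;
    \<open>q < 1\<close> because \<open>?N > 1 + \<alpha>\<close>.\<close>
  define q where "q = (1 + \<alpha>) / (2 * ?N)"
  have N: "?N > 0" "?N > 1 + \<alpha>"
    using \<alpha> by (simp_all add: add_pos_nonneg)
  have q: "0 < q" "q < 1" "?N * q = (1 + \<alpha>) / 2"
    using \<alpha> N by (simp_all add: q_def field_simps)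
  obtain C where C: "C \<ge> 0" "\<And>f z. f \<in> hardy_infinity \<Longrightarrow> z \<in> unit_ball \<Longrightarrow>
      norm (little_hankel \<alpha> b f z) \<le> C * (1 - norm z) powr (- ?N) * bergman_norm p \<alpha> f"
    using little_hankel_pointwise_bound[OF \<alpha> p \<gamma> b G] by blast
  define \<delta> where "\<delta> = - (?N * q)"
  have "\<alpha> + \<delta> > -1"
    using \<alpha> unfolding \<delta>_def q(3) by (simp add: field_simps)
  then obtain J where J: "J \<ge> 0" "(\<integral>\<^sup>+z. ennreal ((1 - (norm (z :: complex ^ 'n))\<^sup>2) powr \<delta>) \<partial>nu \<alpha>) = ennreal J"
    using nn_integral_nu_power_finite[OF \<alpha>, of \<delta>, where 'n = 'n]
    by (cases "\<integral>\<^sup>+z. ennreal ((1 - (norm (z :: complex ^ 'n))\<^sup>2) powr \<delta>) \<partial>nu \<alpha>") auto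
  have bn: "bergman_norm p \<alpha> f \<ge> 0" for f :: "complex ^ 'n \<Rightarrow> 'x"
    by (simp add: bergman_norm_def)
  have main: "little_hankel \<alpha> b f \<in> bergman_space q \<alpha> \<and>
      bergman_norm q \<alpha> (little_hankel \<alpha> b f) \<le> C * (2 powr (?N * q) * J) powr (1 / q) * bergman_norm p \<alpha> f"
    if f: "f \<in> hardy_infinity" for f
  proof -
    let ?h = "little_hankel \<alpha> b f" and ?B = "bergman_norm p \<alpha> f"
    have hol: "?h \<in> holomorphic unit_ball"
      unfolding little_hankel_conv_kernel_integral
      by (intro holomorphic_kernel_integral \<alpha> ball_integrable_symbol b f less_imp_le[OF N(1)])
    let ?A = "(C * ?B) powr q * 2 powr (?N * q)"
    have "(\<integral>\<^sup>+z. ennreal (norm (?h z) powr q) \<partial>nu \<alpha>) \<le> (\<integral>\<^sup>+z. ennreal ?A * ennreal ((1 - (norm (z :: complex ^ 'n))\<^sup>2) powr \<delta>) \<partial>nu \<alpha>)"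
    proof (rule nn_integral_mono)
      fix z :: "complex ^ 'n" assume "z \<in> space (nu \<alpha>)"
      then have z: "norm z < 1" by simp
      have "norm (?h z) powr q \<le> (C * (1 - norm z) powr (- ?N) * ?B) powr q"
        using C(2)[OF f, of z] z q by (intro powr_mono2) auto
      also have "\<dots> = (C * ?B * (1 - norm z) powr (- ?N)) powr q"
        by (simp only: mult_ac)
      also have "\<dots> = (C * ?B) powr q * (1 - norm z) powr (- (?N * q))"
        by (simp only: powr_mult[of "C * ?B"] powr_powr minus_mult_left)
      also have "\<dots> \<le> (C * ?B) powr q * (2 powr (?N * q) * (1 - (norm z)\<^sup>2) powr (- (?N * q)))"
        using powr_one_minus_norm_le(1)[OF z mult_nonneg_nonneg[OF less_imp_le[OF N(1)] less_imp_le[OF q(1)]]]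
        by (rule mult_left_mono) simp
      finally have "norm (?h z) powr q \<le> ?A * (1 - (norm z)\<^sup>2) powr \<delta>"
        by (simp only: \<delta>_def mult.assoc)
      then show "ennreal (norm (?h z) powr q) \<le> ennreal ?A * ennreal ((1 - (norm z)\<^sup>2) powr \<delta>)"
        by (simp add: ennreal_mult'[symmetric] ennreal_leI)
    qed
    also have "\<dots> = ennreal ?A * ennreal J"
      unfolding J(2)[symmetric] by (intro nn_integral_cmult borel_measurable_nu_ennreal continuous_on_one_minus_norm_powr)
    also have "\<dots> = ennreal (?A * J)"
      by (simp add: ennreal_mult'[symmetric])
    finally have le: "(\<integral>\<^sup>+z. ennreal (norm (?h z) powr q) \<partial>nu \<alpha>) \<le> ennreal (?A * J)" .
    then have "(\<integral>\<^sup>+z. ennreal (norm (?h z) powr q) \<partial>nu \<alpha>) < \<infinity>"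
      by (rule le_less_trans) simp
    then have "?h \<in> bergman_space q \<alpha>"
      using hol by (simp add: bergman_space_def)
    moreover have e: "enn2real (\<integral>\<^sup>+z. ennreal (norm (?h z) powr q) \<partial>nu \<alpha>) \<le> ?A * J"
      using le J(1) by (intro enn2real_leI) auto
    have "bergman_norm q \<alpha> ?h \<le> (?A * J) powr (1 / q)"
      unfolding bergman_norm_def[of q] by (rule powr_mono2[OF _ _ e]) (use q in auto)
    moreover have "(?A * J) powr (1 / q) = C * (2 powr (?N * q) * J) powr (1 / q) * ?B"
    proof -
      have "(?A * J) powr (1 / q) = ((C * ?B) powr q * (2 powr (?N * q) * J)) powr (1 / q)"
        by (simp only: mult.assoc)
      also have "\<dots> = ((C * ?B) powr q) powr (1 / q) * (2 powr (?N * q) * J) powr (1 / q)"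
        by (rule powr_mult)
      also have "((C * ?B) powr q) powr (1 / q) = C * ?B"
        using q C(1) bn[of f] by (simp add: powr_powr)
      finally show ?thesis
        by (simp only: mult_ac)
    qed
    ultimately show ?thesis
      by simp
  qed
  then have "hankel_extends_boundedly \<alpha> b p q"
    unfolding hankel_extends_boundedly_def by blast
  then show ?thesis
    using q by blast
qed

section \<open>Necessity: kernels as test functions\<close>

lemma nn_integral_kernel_square:
  assumes \<alpha>: "\<alpha> > -1" and a: "norm (a :: complex ^ 'n) < 1"
  defines "N \<equiv> real CARD('n) + 1 + \<alpha>"
  shows "(\<integral>\<^sup>+w. ennreal ((cmod (bergman_kernel N w a))\<^sup>2) \<partial>nu \<alpha>) = ennreal (nu_mass TYPE('n) \<alpha> * (1 - (norm a)\<^sup>2) powr (- N))"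
proof -
  have N: "N > 0"
    using \<alpha> by (simp add: N_def add_pos_nonneg)
  have hol: "(\<lambda>w. bergman_kernel N w a) \<in> holomorphic unit_ball"
    by (rule holomorphic_bergman_kernel[OF a])
  have cont: "continuous_on unit_ball (\<lambda>w. bergman_kernel N w a)"
    by (rule holomorphic_imp_continuous_on[OF hol])
  have bi: "ball_integrable \<alpha> (\<lambda>w. bergman_kernel N w a)"
    by (rule ball_integrable_bounded[OF \<alpha> cont norm_bergman_kernel_le'[OF a _ less_imp_le[OF N]]])
  have "of_real (\<integral>w. (cmod (bergman_kernel N w a))\<^sup>2 \<partial>nu \<alpha>) = (\<integral>w. complex_of_real ((cmod (bergman_kernel N w a))\<^sup>2) \<partial>nu \<alpha>)"
    by (rule integral_complex_of_real[symmetric])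
  \<comment> \<open>One of the two conjugate factors serves as the function and the other as the
    reproducing kernel, so the integral is the mass times the kernel at
    \<open>(a, a)\<close>.\<close>
  also have "\<dots> = (\<integral>w. bergman_kernel N w a * bergman_kernel N a w \<partial>nu \<alpha>)"
  proof (rule Bochner_Integration.integral_cong[OF refl])
    fix w :: "complex ^ 'n" assume "w \<in> space (nu \<alpha>)"
    then have "cnj (bergman_kernel N w a) = bergman_kernel N a w"
      using a by (intro cnj_bergman_kernel) auto
    then show "complex_of_real ((cmod (bergman_kernel N w a))\<^sup>2) = bergman_kernel N w a * bergman_kernel N a w"
      using complex_norm_square[of "bergman_kernel N w a"] by simp
  qed
  also have "\<dots> = nu_mass TYPE('n) \<alpha> *\<^sub>R bergman_kernel N a a"
    unfolding N_def by (intro bergman_reproducing \<alpha> a holomorphic_bergman_kernel integrable_ball_integrable bi[unfolded N_def])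
  also have "bergman_kernel N a a = of_real ((1 - (norm a)\<^sup>2) powr (- N))"
  proof -
    have "1 - hinner a a = complex_of_real (1 - (norm a)\<^sup>2)"
      by (simp add: hinner_self)
    moreover have "complex_of_real (1 - (norm a)\<^sup>2) powr complex_of_real N = of_real ((1 - (norm a)\<^sup>2) powr N)"
      using one_minus_norm_power_pos[OF a] by (intro powr_of_real) auto
    ultimately show ?thesis
      by (simp add: bergman_kernel_def powr_minus)
  qed
  finally have "complex_of_real (\<integral>w. (cmod (bergman_kernel N w a))\<^sup>2 \<partial>nu \<alpha>) = of_real (nu_mass TYPE('n) \<alpha> * (1 - (norm a)\<^sup>2) powr (- N))"
    by (simp add: scaleR_conv_of_real)
  then have val: "(\<integral>w. (cmod (bergman_kernel N w a))\<^sup>2 \<partial>nu \<alpha>) = nu_mass TYPE('n) \<alpha> * (1 - (norm a)\<^sup>2) powr (- N)"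
    by (simp only: of_real_eq_iff)
  have c2: "continuous_on unit_ball (\<lambda>w. (cmod (bergman_kernel N w a))\<^sup>2)"
    by (intro continuous_intros continuous_on_norm cont)
  have "ball_integrable \<alpha> (\<lambda>w. (cmod (bergman_kernel N w a))\<^sup>2)"
  proof (rule ball_integrable_bounded[OF \<alpha> c2])
    show "norm ((cmod (bergman_kernel N w a))\<^sup>2) \<le> ((1 - norm a) powr (- N))\<^sup>2" if "norm w < 1" for w
      using norm_bergman_kernel_le'[OF a that less_imp_le[OF N]] by (simp add: power_mono)
  qed
  then have "integrable (nu \<alpha>) (\<lambda>w. (cmod (bergman_kernel N w a))\<^sup>2)"
    unfolding ball_integrable_def by (intro integrableI_bounded borel_measurable_nu_continuous_on c2) auto
  then have "(\<integral>\<^sup>+w. ennreal ((cmod (bergman_kernel N w a))\<^sup>2) \<partial>nu \<alpha>) = ennreal (\<integral>w. (cmod (bergman_kernel N w a))\<^sup>2 \<partial>nu \<alpha>)"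
    by (rule nn_integral_eq_integral) simp
  then show ?thesis
    unfolding val .
qed

text \<open>With \<open>A = cmod (1 - hinner w a)\<close>, the exponent splits as
  \<open>- (N + j) p = (k - j) p - e - 2 N\<close>. The first power is bounded through
  \<open>A \<le> 2\<close>, the second through \<open>A \<ge> 1 - norm a\<close>, and the third is
  integrated exactly; the lower bound on \<open>k\<close> makes \<open>e \<ge> 0\<close>.\<close>

lemma bergman_norm_kernel_le:
  assumes \<alpha>: "\<alpha> > -1" and p: "0 < p"
    and \<gamma>: "\<gamma> = (real CARD('n) + 1 + \<alpha>) * (1 / p - 1)" and k: "real k * p \<ge> 2 * (real CARD('n) + 1 + \<alpha>)"
  shows "\<exists>K\<ge>0. \<forall>(a :: complex ^ 'n) j (x :: 'a::complex_normed_vector). norm a < 1 \<longrightarrow> j \<le> k \<longrightarrow>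
    bergman_norm p \<alpha> (\<lambda>w. bergman_kernel (real CARD('n) + 1 + \<alpha> + real j) w a *\<^sub>C x) \<le>
      K * (1 - (norm a)\<^sup>2) powr (\<gamma> - real k) * norm x"
proof -
  define N where "N = real CARD('n) + 1 + \<alpha>"
  have N: "N > 0"
    using \<alpha> by (simp add: N_def add_pos_nonneg)
  define e where "e = (N + real k) * p - 2 * N"
  have e: "e \<ge> 0"
  proof -
    have "0 < N * p"
      using N p by simp
    then show ?thesis
      using k unfolding e_def N_def[symmetric] distrib_right by linarith
  qed
  let ?m = "nu_mass TYPE('n) \<alpha>"
  define L where "L = 2 powr (real k * p) * 2 powr e * ?m"
  have m: "?m > 0"
    by (rule nu_mass_pos[OF \<alpha>])
  have L: "L \<ge> 0"
    using m by (simp add: L_def)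
  \<comment> \<open>The exponent of \<open>1 - (norm a)\<^sup>2\<close> after the
    \<open>p\<close>-th root: \<open>e + N\<close> is \<open>(N + k) p - N\<close>, and
    \<open>N / p - N\<close> is \<gamma>.\<close>
  have ex: "(- e - N) / p = \<gamma> - real k"
    using p unfolding e_def \<gamma> N_def[symmetric] by (simp add: field_simps)
  have "bergman_norm p \<alpha> (\<lambda>w. bergman_kernel (N + real j) w a *\<^sub>C x) \<le> L powr (1 / p) * (1 - (norm a)\<^sup>2) powr (\<gamma> - real k) * norm x"
    if a: "norm a < 1" and j: "j \<le> k" for a :: "complex ^ 'n" and j and x :: 'a
  proof -
    let ?P = "1 - (norm a)\<^sup>2"
    have P: "?P > 0"
      by (rule one_minus_norm_power_pos[OF a])
    let ?D = "2 powr (real k * p) * (2 powr e * ?P powr (- e)) * norm x powr p"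
    have "(\<integral>\<^sup>+w. ennreal (norm (bergman_kernel (N + real j) w a *\<^sub>C x) powr p) \<partial>nu \<alpha>) \<le>
        (\<integral>\<^sup>+w. ennreal ?D * ennreal ((cmod (bergman_kernel N w a))\<^sup>2) \<partial>nu \<alpha>)"
    proof (rule nn_integral_mono)
      fix w :: "complex ^ 'n" assume "w \<in> space (nu \<alpha>)"
      then have w: "norm w < 1" by simp
      define A where "A = cmod (1 - hinner w a)"
      have A2: "A \<le> 2" "A > 0"
        using one_minus_hinner_bounds[OF w less_imp_le[OF a]] by (simp_all add: A_def)
      have "A = cmod (cnj (1 - hinner w a))"
        by (simp only: A_def complex_mod_cnj)
      also have "cnj (1 - hinner w a) = 1 - hinner a w"
        by (simp add: cnj_hinner)
      finally have A1: "1 - norm a \<le> A"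
        using one_minus_hinner_bounds(1)[OF a less_imp_le[OF w]] by simp
      have kj: "(real k - real j) * p \<le> real k * p"
        using p by (intro mult_right_mono) auto
      have "norm (bergman_kernel (N + real j) w a *\<^sub>C x) powr p = A powr (- (N + real j) * p) * norm x powr p"
        by (simp add: norm_scaleC norm_bergman_kernel A_def[symmetric] powr_mult powr_powr)
      also have "A powr (- (N + real j) * p) = A powr ((real k - real j) * p) * (A powr (- e) * A powr (- (2 * N)))"
        by (simp add: powr_add[symmetric] e_def algebra_simps)
      also have "\<dots> \<le> 2 powr (real k * p) * ((2 powr e * ?P powr (- e)) * A powr (- (2 * N)))"
      proof (intro mult_mono)
        have "A powr ((real k - real j) * p) \<le> 2 powr ((real k - real j) * p)"
          using A2 j p by (intro powr_mono2 mult_nonneg_nonneg) auto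
        also have "\<dots> \<le> 2 powr (real k * p)"
          using kj by (intro powr_mono) auto
        finally show "A powr ((real k - real j) * p) \<le> 2 powr (real k * p)" .
        have "A powr (- e) \<le> (1 - norm a) powr (- e)"
          using A1 a e by (intro powr_mono2') auto
        also have "\<dots> \<le> 2 powr e * ?P powr (- e)"
          by (rule powr_one_minus_norm_le(1)[OF a e])
        finally show "A powr (- e) \<le> 2 powr e * ?P powr (- e)" .
      qed auto
      also have "A powr (- (2 * N)) = (cmod (bergman_kernel N w a))\<^sup>2"
        by (simp add: norm_bergman_kernel A_def[symmetric] power2_eq_square flip: powr_add)
      finally have "norm (bergman_kernel (N + real j) w a *\<^sub>C x) powr p \<le>
          (2 powr (real k * p) * (2 powr e * ?P powr (- e) * (cmod (bergman_kernel N w a))\<^sup>2)) * norm x powr p"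
        by (simp add: mult_right_mono)
      also have "\<dots> = ?D * (cmod (bergman_kernel N w a))\<^sup>2"
        by (simp only: mult_ac)
      finally show "ennreal (norm (bergman_kernel (N + real j) w a *\<^sub>C x) powr p) \<le> ennreal ?D * ennreal ((cmod (bergman_kernel N w a))\<^sup>2)"
        by (simp add: ennreal_mult'[symmetric] ennreal_leI)
    qed
    also have "\<dots> = ennreal ?D * (\<integral>\<^sup>+w. ennreal ((cmod (bergman_kernel N w a))\<^sup>2) \<partial>nu \<alpha>)"
      by (intro nn_integral_cmult borel_measurable_nu_ennreal continuous_intros continuous_on_norm
          holomorphic_imp_continuous_on[OF holomorphic_bergman_kernel[OF a]])
    also have "\<dots> = ennreal ?D * ennreal (?m * ?P powr (- N))"
      unfolding N_def by (simp only: nn_integral_kernel_square[OF \<alpha> a])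
    also have "\<dots> = ennreal (L * ?P powr (- e - N) * norm x powr p)"
    proof -
      have "?P powr (- e - N) = ?P powr (- e) * ?P powr (- N)"
        by (simp flip: powr_add)
      then have "L * ?P powr (- e - N) * norm x powr p = ?D * (?m * ?P powr (- N))"
        by (simp only: L_def mult_ac)
      moreover have "ennreal ?D * ennreal (?m * ?P powr (- N)) = ennreal (?D * (?m * ?P powr (- N)))"
        by (rule ennreal_mult'[symmetric]) simp
      ultimately show ?thesis
        by (simp only:)
    qed
    finally have le: "(\<integral>\<^sup>+w. ennreal (norm (bergman_kernel (N + real j) w a *\<^sub>C x) powr p) \<partial>nu \<alpha>) \<le>
        ennreal (L * ?P powr (- e - N) * norm x powr p)" .
    have "bergman_norm p \<alpha> (\<lambda>w. bergman_kernel (N + real j) w a *\<^sub>C x) \<le> (L * ?P powr (- e - N) * norm x powr p) powr (1 / p)"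
      unfolding bergman_norm_def using le L p by (intro powr_mono2 enn2real_leI) auto
    also have "\<dots> = L powr (1 / p) * (?P powr (- e - N)) powr (1 / p) * (norm x powr p) powr (1 / p)"
      by (simp only: powr_mult)
    also have "(norm x powr p) powr (1 / p) = norm x"
      using p by (simp add: powr_powr)
    also have "(?P powr (- e - N)) powr (1 / p) = ?P powr (\<gamma> - real k)"
      unfolding powr_powr ex[symmetric] by simp
    finally show ?thesis .
  qed
  then show ?thesis
    unfolding N_def by (intro exI[of _ "L powr (1 / p)"]) auto
qed

text \<open>\<open>conj_vec\<close> is an isometry onto the conjugate space, so the operator norm
  may be tested on its image.\<close>

lemma norm_clinop_le:
  fixes T :: "'x::complex_normed_vector conj_space \<Rightarrow>\<^sub>C\<^sub>L 'y::complex_normed_vector"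
  assumes "B \<ge> 0" "\<And>x. norm (clinop_apply T (conj_vec x)) \<le> B * norm x"
  shows "norm T \<le> B"
  unfolding norm_clinop_onorm
proof (rule onorm_bound[OF assms(1)])
  fix y :: "'x conj_space"
  obtain x where "y = conj_vec x"
    using surj_conj_vec by blast
  then show "norm (clinop_apply T y) \<le> B * norm y"
    using assms(2)[of x] by (simp add: norm_conj_vec)
qed

text \<open>At \<open>z = 0\<close> the kernel of the operator is 1, and the test kernel leaves the
  conjugate-linear slot as \<open>bergman_kernel s a w\<close>, the kernel defining
  \<open>kernel_integral\<close>.\<close>

lemma little_hankel_kernel_at_0:
  fixes b :: "complex ^ 'n \<Rightarrow> ('x::cbanach conj_space \<Rightarrow>\<^sub>C\<^sub>L 'y::cbanach)"
  assumes \<alpha>: "\<alpha> > -1" and b: "ball_integrable \<alpha> b" and a: "norm a < 1" and s: "s \<ge> 0"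
  shows "little_hankel \<alpha> b (\<lambda>w. bergman_kernel s w a *\<^sub>C x) 0 = clinop_apply (kernel_integral \<alpha> b s a) (conj_vec x)"
proof -
  have "little_hankel \<alpha> b (\<lambda>w. bergman_kernel s w a *\<^sub>C x) 0 =
      bochner_int (nu \<alpha>) (\<lambda>w. clinop_apply (bergman_kernel s a w *\<^sub>C b w) (conj_vec x))"
    unfolding little_hankel_conv_kernel_integral kernel_integral_def
  proof (rule bochner_int_cong)
    fix w :: "complex ^ 'n" assume "w \<in> space (nu \<alpha>)"
    then have "cnj (bergman_kernel s w a) = bergman_kernel s a w"
      using a by (intro cnj_bergman_kernel) auto
    then show "bergman_kernel (real CARD('n) + 1 + \<alpha>) 0 w *\<^sub>C clinop_apply (b w) (conj_vec (bergman_kernel s w a *\<^sub>C x)) =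
        clinop_apply (bergman_kernel s a w *\<^sub>C b w) (conj_vec x)"
      by (simp add: bergman_kernel_def[of _ 0] scaleC_one conj_vec_scaleC clinop_apply_scaleC clinop_apply_scaleC_left)
  qed
  also have "\<dots> = clinop_apply (kernel_integral \<alpha> b s a) (conj_vec x)"
    unfolding kernel_integral_def
    by (intro bochner_int_eqI has_bochner_int_linear[OF bounded_bilinear.bounded_linear_left[OF bounded_bilinear_clinop_apply]]
        has_bochner_int_bochner_int \<alpha> ball_integrable_kernel b s a)
  finally show ?thesis .
qed

lemma hankel_bounded_imp_Gamma_space:
  fixes b :: "complex ^ 'n \<Rightarrow> ('x::cbanach conj_space \<Rightarrow>\<^sub>C\<^sub>L 'y::cbanach)"
  assumes \<alpha>: "\<alpha> > -1" and p: "0 < p" "p \<le> 1" and \<gamma>: "\<gamma> = (real CARD('n) + 1 + \<alpha>) * (1 / p - 1)"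
    and hol: "b \<in> holomorphic unit_ball" and b: "ball_integrable \<alpha> b"
    and q: "0 < q" "q < 1" and h: "hankel_extends_boundedly \<alpha> b p q"
  shows "b \<in> Gamma_space \<gamma>"
proof -
  let ?N = "real CARD('n) + 1 + \<alpha>"
  have N: "?N > 0"
    using \<alpha> by (simp add: add_pos_nonneg)
  \<comment> \<open>Serves two purposes: the exponent condition of the test functions and
    \<open>k > \<gamma>\<close>, as \<gamma> is at most \<open>?N / p\<close>.\<close>
  obtain k :: nat where k: "real k > 2 * ?N / p"
    using reals_Archimedean2 by blast
  have kp: "real k * p \<ge> 2 * ?N"
    using k p by (simp add: field_simps)
  have "\<gamma> = ?N / p - ?N"
    unfolding \<gamma> right_diff_distrib by simp
  then have "\<gamma> \<le> ?N / p"
    using N by linarith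
  also have "\<dots> \<le> 2 * ?N / p"
    using N p by (intro divide_right_mono) auto
  finally have k\<gamma>: "real k > \<gamma>"
    using k by linarith
  obtain C where C: "\<And>f. f \<in> hardy_infinity \<Longrightarrow> little_hankel \<alpha> b f \<in> bergman_space q \<alpha>"
    "\<And>f. f \<in> hardy_infinity \<Longrightarrow> bergman_norm q \<alpha> (little_hankel \<alpha> b f) \<le> C * bergman_norm p \<alpha> f"
    using h unfolding hankel_extends_boundedly_def by blast
  obtain C1 where C1: "C1 > 0" "\<And>h :: complex ^ 'n \<Rightarrow> 'y. h \<in> bergman_space q \<alpha> \<Longrightarrow> norm (h 0) \<le> C1 * bergman_norm q \<alpha> h"
    using bergman_point_evaluation[OF \<alpha> q(1) less_imp_le[OF q(2)]] by blast
  obtain K where K: "K \<ge> 0" "\<And>(a :: complex ^ 'n) j (x :: 'x). norm a < 1 \<Longrightarrow> j \<le> k \<Longrightarrow>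
      bergman_norm p \<alpha> (\<lambda>w. bergman_kernel (?N + real j) w a *\<^sub>C x) \<le> K * (1 - (norm a)\<^sup>2) powr (\<gamma> - real k) * norm x"
    using bergman_norm_kernel_le[OF \<alpha> p(1) \<gamma> kp] by blast
  show ?thesis
  proof (rule Gamma_spaceI[OF \<alpha> hol b k\<gamma>])
    fix j and a :: "complex ^ 'n" assume j: "j \<le> k" and a: "norm a < 1"
    let ?P = "(1 - (norm a)\<^sup>2) powr (\<gamma> - real k)"
    show "norm (kernel_integral \<alpha> b (?N + real j) a) \<le> (C1 * (\<bar>C\<bar> * K)) * ?P"
    proof (rule norm_clinop_le)
      fix x :: 'x
      let ?f = "\<lambda>w. bergman_kernel (?N + real j) w a *\<^sub>C x"
      have f: "?f \<in> hardy_infinity"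
        using N a by (intro hardy_infinity_kernel hardy_infinityI[of _ "norm x"] holomorphic_const) auto
      have "norm (clinop_apply (kernel_integral \<alpha> b (?N + real j) a) (conj_vec x)) = norm (little_hankel \<alpha> b ?f 0)"
        using N by (subst little_hankel_kernel_at_0[OF \<alpha> b a]) auto
      also have "\<dots> \<le> C1 * bergman_norm q \<alpha> (little_hankel \<alpha> b ?f)"
        by (rule C1(2)[OF C(1)[OF f]])
      \<comment> \<open>The constant in the definition of boundedness carries no sign condition; the
        absolute value keeps the later factors monotone.\<close>
      also have "\<dots> \<le> C1 * (\<bar>C\<bar> * bergman_norm p \<alpha> ?f)"
      proof -
        have "C * bergman_norm p \<alpha> ?f \<le> \<bar>C\<bar> * bergman_norm p \<alpha> ?f"
          by (intro mult_right_mono) (auto simp: bergman_norm_def)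
        then show ?thesis
          using C(2)[OF f] C1(1) by (intro mult_left_mono) auto
      qed
      also have "\<dots> \<le> C1 * (\<bar>C\<bar> * (K * ?P * norm x))"
        using C1(1) by (intro mult_left_mono K(2)[OF a j]) auto
      also have "\<dots> = (C1 * (\<bar>C\<bar> * K)) * ?P * norm x"
        by (simp only: mult_ac)
      finally show "norm (clinop_apply (kernel_integral \<alpha> b (?N + real j) a) (conj_vec x)) \<le> (C1 * (\<bar>C\<bar> * K)) * ?P * norm x" .
    qed (use C1(1) K(1) in auto)
  qed
qed

theorem corollary5:
  fixes b :: "complex ^ 'n \<Rightarrow> ('x::cbanach conj_space \<Rightarrow>\<^sub>C\<^sub>L 'y::cbanach)"
    and p \<alpha> \<gamma> :: real
  assumes "0 < p" "p \<le> 1" "\<alpha> > -1"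
    and "\<gamma> = (real CARD('n) + 1 + \<alpha>) * (1 / p - 1)"
    and "b \<in> holomorphic unit_ball"
    and "\<And>z. z \<in> unit_ball \<Longrightarrow>
      (\<integral>\<^sup>+w. ennreal (norm (b w) / cmod (1 - hinner z w) powr (real CARD('n) + 1 + \<alpha>)) \<partial>nu \<alpha>) < \<infinity>"
    and "(\<integral>\<^sup>+z. ennreal (norm (b z) * ln (1 / (1 - (norm z)\<^sup>2))) \<partial>nu \<alpha>) < \<infinity>"
  shows "(\<exists>q. 0 < q \<and> q < 1 \<and> hankel_extends_boundedly \<alpha> b p q) \<longleftrightarrow> b \<in> Gamma_space \<gamma>"
proof -
  \<comment> \<open>At \<open>z = 0\<close> the kernel in the integrability assumption is 1.\<close>
  have "(\<integral>\<^sup>+w. ennreal (norm (b w)) \<partial>nu \<alpha>) < \<infinity>"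
    using assms(6)[of 0] by simp
  then have b: "ball_integrable \<alpha> b"
    using holomorphic_imp_continuous_on[OF assms(5)] by (simp add: ball_integrable_def)
  show ?thesis
    using Gamma_space_imp_hankel_bounded[OF assms(3,1,2,4) b]
      hankel_bounded_imp_Gamma_space[OF assms(3,1,2,4,5) b] by blast
qed

end
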